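(* Let $\mathcal K\subseteq L^2_s(\partial\mathbb B)$ be a closed (right $\mathbb H$-linear) subspace. Then $\mathcal K$ is simply invariant, i.e. $M_q\mathcal K\subsetneq\mathcal K$, if and only if $\mathcal K=\varphi*H^2(\partial\mathbb B):=\{\varphi*f: f\in H^2(\partial\mathbb B)\}$ for some function $\varphi\in L^\infty_s(\partial\mathbb B)$ such that $|\varphi|=1$ $\Sigma$-almost everywhere on $\partial\mathbb B$. Moreover, such a function is unique up to a unitary constant in the following sense: if $\mathcal K=\varphi_1*H^2(\partial\mathbb B)=\varphi_2*H^2(\partial\mathbb B)$ with $\varphi_1,\varphi_2$ two such functions, then $\varphi_2=\varphi_1*u$ for some $u\in\mathbb H$ with $|u|=1$.
   Context: $\mathbb H$ is the skew field of quaternions, $\mathbb B=\{q\in\mathbb H:|q|<1\}$, $\mathbb S=\{q\in\mathbb H: q^2=-1\}$, and $\partial\mathbb B=\{e^{tI}: t\in\mathbb R, I\in\mathbb S\}$, where $e^{tI}=\cos t+I\sin t$. It carries the measure $d\Sigma(e^{tI})=d\sigma(I)\,dt$, with $dt$ Lebesgue measure and $\sigma$ the area measure on $\mathbb S$, normalized so that $\sigma(\mathbb S)=\Sigma(\partial\mathbb B)=1$. A function $f:\partial\mathbb B\to\mathbb H$ is a slice function if for all $J\ne K$ in $\mathbb S$ and all $x+yI\in\partial\mathbb B$ ($x,y\in\mathbb R$, $I\in\mathbb S$), $f(x+yI)=\big((J-K)^{-1}J+I(J-K)^{-1}\big)f(x+yJ)-\big((J-K)^{-1}K+I(J-K)^{-1}\big)f(x+yK)$.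 $L^2_s(\partial\mathbb B)$ is the space of slice functions $f$ with $\int_{\partial\mathbb B}|f|^2\,d\Sigma<\infty$, functions equal $\Sigma$-a.e. being identified. It consists exactly of the functions $f(q)=\sum_{n\in\mathbb Z}q^na_n$ ($\Sigma$-a.e.) with $\{a_n\}\in\ell^2(\mathbb Z,\mathbb H)$, and it is a quaternionic right Hilbert space with inner product $\langle\sum q^na_n,\sum q^nb_n\rangle=\sum_n\overline{b_n}a_n$. $H^2(\partial\mathbb B)$ is the closed subspace of those $f$ with $a_n=0$ for all $n<0$. $L^\infty_s(\partial\mathbb B)$ is the space of $\Sigma$-measurable, $\Sigma$-essentially bounded slice functions on $\partial\mathbb B$. For $f(q)=\sum_n q^na_n$ and $g(q)=\sum_n q^nb_n$ the $*$-product is $f*g(q)=\sum_{n\in\mathbb Z}q^n\sum_{k\in\mathbb Z}a_kb_{n-k}$, equivalently ($\Sigma$-a.e.) $f*g(q)=0$ if $f(q)=0$ and $f*g(q)=f(q)\,g(f(q)^{-1}qf(q))$ if $f(q)\neq0$. The operator $M_q$ is $M_qf=q*f=qf$. *)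

theory Defs
  imports "HOL-Analysis.Analysis" "HOL-Probability.Probability_Measure"
begin

section \<open>The skew field of quaternions\<close>

datatype quat = Quat (qre: real) (qi: real) (qj: real) (qk: real)

lemma quat_eq_iff: "p = q \<longleftrightarrow> qre p = qre q \<and> qi p = qi q \<and> qj p = qj q \<and> qk p = qk q"
  by (cases p; cases q) simp

instantiation quat :: real_vector
begin
definition "0 = Quat 0 0 0 0"
definition "p + q = Quat (qre p + qre q) (qi p + qi q) (qj p + qj q) (qk p + qk q)"
definition "- q = Quat (- qre q) (- qi q) (- qj q) (- qk q)"
definition "p - q = Quat (qre p - qre q) (qi p - qi q) (qj p - qj q) (qk p - qk q)" for p q :: quat
definition "r *\<^sub>R q = Quat (r * qre q) (r * qi q) (r * qj q) (r * qk q)"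
instance
  by standard
    (auto simp: quat_eq_iff zero_quat_def plus_quat_def uminus_quat_def minus_quat_def
      scaleR_quat_def algebra_simps)
end

lemma quat_sel_linear [simp]:
  "qre 0 = 0" "qi 0 = 0" "qj 0 = 0" "qk 0 = 0"
  "qre (p + q) = qre p + qre q" "qi (p + q) = qi p + qi q"
  "qj (p + q) = qj p + qj q" "qk (p + q) = qk p + qk q"
  "qre (- p) = - qre p" "qi (- p) = - qi p" "qj (- p) = - qj p" "qk (- p) = - qk p"
  "qre (p - q) = qre p - qre q" "qi (p - q) = qi p - qi q"
  "qj (p - q) = qj p - qj q" "qk (p - q) = qk p - qk q"
  "qre (r *\<^sub>R p) = r * qre p" "qi (r *\<^sub>R p) = r * qi p"
  "qj (r *\<^sub>R p) = r * qj p" "qk (r *\<^sub>R p) = r * qk p"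
  by (simp_all add: zero_quat_def plus_quat_def uminus_quat_def minus_quat_def scaleR_quat_def)

instantiation quat :: real_algebra_1
begin
definition "1 = Quat 1 0 0 0"
definition "p * q = Quat
  (qre p * qre q - qi p * qi q - qj p * qj q - qk p * qk q)
  (qre p * qi q + qi p * qre q + qj p * qk q - qk p * qj q)
  (qre p * qj q - qi p * qk q + qj p * qre q + qk p * qi q)
  (qre p * qk q + qi p * qj q - qj p * qi q + qk p * qre q)"
instance
  by standard (auto simp: quat_eq_iff one_quat_def times_quat_def algebra_simps)
end

lemma quat_sel_mult [simp]:
  "qre 1 = 1" "qi 1 = 0" "qj 1 = 0" "qk 1 = 0"
  "qre (p * q) = qre p * qre q - qi p * qi q - qj p * qj q - qk p * qk q"
  "qi (p * q) = qre p * qi q + qi p * qre q + qj p * qk q - qk p * qj q"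
  "qj (p * q) = qre p * qj q - qi p * qk q + qj p * qre q + qk p * qi q"
  "qk (p * q) = qre p * qk q + qi p * qj q - qj p * qi q + qk p * qre q"
  by (simp_all add: one_quat_def times_quat_def)

instantiation quat :: real_inner
begin
definition "inner p q = qre p * qre q + qi p * qi q + qj p * qj q + qk p * qk q"
definition "norm q = sqrt ((qre q)\<^sup>2 + (qi q)\<^sup>2 + (qj q)\<^sup>2 + (qk q)\<^sup>2)"
definition "sgn q = q /\<^sub>R norm q" for q :: quat
definition "dist p q = norm (p - q)" for p q :: quat
definition [code del]:
  "(uniformity :: (quat \<times> quat) filter) = (INF e\<in>{0<..}. principal {(x, y). dist x y < e})"
definition [code del]:
  "open (U :: quat set) \<longleftrightarrow>
    (\<forall>x\<in>U. eventually (\<lambda>(x', y). x' = x \<longrightarrow> y \<in> U) uniformity)"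
instance
proof
  fix x y z :: quat and r :: real and U :: "quat set"
  show "dist x y = norm (x - y)" by (rule dist_quat_def)
  show "sgn x = x /\<^sub>R norm x" by (rule sgn_quat_def)
  show "(uniformity :: (quat \<times> quat) filter) = (INF e\<in>{0<..}. principal {(x, y). dist x y < e})"
    by (rule uniformity_quat_def)
  show "open U \<longleftrightarrow> (\<forall>x\<in>U. eventually (\<lambda>(x', y). x' = x \<longrightarrow> y \<in> U) uniformity)"
    by (rule open_quat_def)
  show "inner x y = inner y x" by (simp add: inner_quat_def mult.commute)
  show "inner (x + y) z = inner x z + inner y z" by (simp add: inner_quat_def algebra_simps)
  show "inner (r *\<^sub>R x) y = r * inner x y" by (simp add: inner_quat_def algebra_simps)
  show "0 \<le> inner x x" by (simp add: inner_quat_def)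
  show "inner x x = 0 \<longleftrightarrow> x = 0"
    by (simp add: inner_quat_def quat_eq_iff) (smt (verit) mult_eq_0_iff zero_le_square)
  show "norm x = sqrt (inner x x)" by (simp add: inner_quat_def norm_quat_def power2_eq_square)
qed
end

instantiation quat :: real_normed_div_algebra
begin
definition "inverse q = Quat (qre q) (- qi q) (- qj q) (- qk q) /\<^sub>R (norm q)\<^sup>2"
definition "p div q = p * inverse q" for p q :: quat
instance
proof
  fix x y :: quat
  have sq: "(norm x)\<^sup>2 = (qre x)\<^sup>2 + (qi x)\<^sup>2 + (qj x)\<^sup>2 + (qk x)\<^sup>2"
    by (simp add: norm_quat_def)
  show "norm (x * y) = norm x * norm y"
    unfolding norm_quat_def real_sqrt_mult [symmetric]
    by (rule arg_cong [where f = sqrt]) (simp add: power2_eq_square algebra_simps)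
  show "x div y = x * inverse y" by (rule divide_quat_def)
  show "inverse (0::quat) = 0" by (simp add: inverse_quat_def quat_eq_iff)
  assume "x \<noteq> 0"
  then have nz: "(norm x)\<^sup>2 \<noteq> 0" by simp
  have *: "inverse ((norm x)\<^sup>2) * ((qre x)\<^sup>2 + (qi x)\<^sup>2 + (qj x)\<^sup>2 + (qk x)\<^sup>2) = 1"
    using nz by (simp flip: sq)
  show "inverse x * x = 1" "x * inverse x = 1"
    using * by (simp_all add: inverse_quat_def quat_eq_iff power2_eq_square algebra_simps)
qed
end

instantiation quat :: euclidean_space
begin
definition "Basis = {Quat 1 0 0 0, Quat 0 1 0 0, Quat 0 0 1 0, Quat 0 0 0 1}"
instance
proof
  show "(Basis :: quat set) \<noteq> {}" "finite (Basis :: quat set)"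
    by (simp_all add: Basis_quat_def)
  fix u v x :: quat
  show "inner u v = (if u = v then 1 else 0)" if "u \<in> Basis" "v \<in> Basis"
    using that unfolding Basis_quat_def by (elim insertE emptyE) (simp_all add: inner_quat_def)
  show "(\<forall>u\<in>Basis. inner x u = 0) \<longleftrightarrow> x = 0"
    unfolding Basis_quat_def by (simp add: inner_quat_def quat_eq_iff [of x])
qed
end


section \<open>The boundary of the unit ball and its measure\<close>

definition imag_sphere :: "quat set"  ("\<S>")
  where "\<S> = {q. q\<^sup>2 = -1}"

text \<open>\<^term>\<open>expI t I\<close> is $e^{tI}$.\<close>

definition expI :: "real \<Rightarrow> quat \<Rightarrow> quat"
  where "expI t I = cos t *\<^sub>R 1 + sin t *\<^sub>R I"

definition bdry_ball :: "quat set"  ("\<partial>\<B>")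
  where "\<partial>\<B> = {expI t I | t I. I \<in> \<S>}"

definition spherical :: "real \<times> real \<Rightarrow> quat"
  where "spherical = (\<lambda>(\<theta>, \<psi>). Quat 0 (sin \<theta> * cos \<psi>) (sin \<theta> * sin \<psi>) (cos \<theta>))"

text \<open>The area measure of the 2-sphere \<^term>\<open>\<S>\<close> in spherical coordinates, where the area
  element is \<open>sin \<theta> d\<theta> d\<psi>\<close>; it is divided by the total area \<open>4 * pi\<close>.\<close>

definition area_measure :: "quat measure"  ("\<sigma>")
  where "\<sigma> = distr
    (density lborel
      (\<lambda>(\<theta>, \<psi>). ennreal (indicator ({0..pi} \<times> {0..2 * pi}) (\<theta>, \<psi>) * (sin \<theta> / (4 * pi)))))
    (restrict_space borel \<S>) spherical"

text \<open>One full period of \<open>t\<close> is used. The point \<open>expI t I = expI (- t) (- I)\<close> is then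
  covered twice, which the normalisation to total mass 1 absorbs.\<close>

definition bdry_measure :: "quat measure"  ("\<Sigma>\<^sub>\<B>")
  where "\<Sigma>\<^sub>\<B> = distr (uniform_measure lborel {0..2 * pi} \<Otimes>\<^sub>M \<sigma>)
    (restrict_space borel \<partial>\<B>) (\<lambda>(t, I). expI t I)"

lemma imag_sphere_iff: "q \<in> \<S> \<longleftrightarrow> qre q = 0 \<and> (qi q)\<^sup>2 + (qj q)\<^sup>2 + (qk q)\<^sup>2 = 1"
proof
  assume "q \<in> \<S>"
  then have e: "qre q * qre q - qi q * qi q - qj q * qj q - qk q * qk q = -1"
    "qre q * qi q = 0" "qre q * qj q = 0" "qre q * qk q = 0"
    by (auto simp: imag_sphere_def power2_eq_square quat_eq_iff)
  have "qre q = 0"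
  proof (rule ccontr)
    assume "qre q \<noteq> 0"
    with e have "qre q * qre q = -1" by simp
    then show False using zero_le_square [of "qre q"] by linarith
  qed
  with e show "qre q = 0 \<and> (qi q)\<^sup>2 + (qj q)\<^sup>2 + (qk q)\<^sup>2 = 1"
    by (simp add: power2_eq_square)
next
  assume "qre q = 0 \<and> (qi q)\<^sup>2 + (qj q)\<^sup>2 + (qk q)\<^sup>2 = 1"
  then show "q \<in> \<S>"
    by (auto simp: imag_sphere_def power2_eq_square quat_eq_iff)
qed

lemma spherical_in_sphere: "spherical z \<in> \<S>"
proof (cases z)
  case (Pair \<theta> \<psi>)
  have "(sin \<theta> * cos \<psi>)\<^sup>2 + (sin \<theta> * sin \<psi>)\<^sup>2 + (cos \<theta>)\<^sup>2
      = (sin \<theta>)\<^sup>2 * ((cos \<psi>)\<^sup>2 + (sin \<psi>)\<^sup>2) + (cos \<theta>)\<^sup>2"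
    by (simp only: power_mult_distrib distrib_left)
  also have "\<dots> = 1" by simp
  finally show ?thesis by (simp add: Pair spherical_def imag_sphere_iff)
qed

lemma spherical_measurable: "spherical \<in> measurable borel (restrict_space borel \<S>)"
proof (rule measurable_restrict_space2)
  have "spherical = (\<lambda>z. (sin (fst z) * cos (snd z)) *\<^sub>R Quat 0 1 0 0
      + (sin (fst z) * sin (snd z)) *\<^sub>R Quat 0 0 1 0 + cos (fst z) *\<^sub>R Quat 0 0 0 1)"
    by (simp add: fun_eq_iff spherical_def quat_eq_iff case_prod_unfold)
  moreover have "continuous_on UNIV \<dots>" by (intro continuous_intros)
  ultimately have "continuous_on UNIV spherical" by (simp only:)
  then show "spherical \<in> borel_measurable borel"
    by (rule borel_measurable_continuous_onI)
qed (auto simp: spherical_in_sphere)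

lemma prob_space_area_measure: "prob_space \<sigma>"
proof -
  let ?d = "\<lambda>z::real \<times> real.
    ennreal (indicator ({0..pi} \<times> {0..2 * pi}) z * (sin (fst z) / (4 * pi)))"
  have m: "?d \<in> borel_measurable lborel"
  proof -
    have "(\<lambda>z::real \<times> real. sin (fst z) / (4 * pi)) \<in> borel_measurable borel"
      by (intro borel_measurable_continuous_onI continuous_intros) auto
    moreover have "closed ({0..pi} \<times> {0..2 * pi} :: (real \<times> real) set)"
      by (intro closed_Times) auto
    ultimately have "(\<lambda>z. indicator ({0..pi} \<times> {0..2 * pi}) z * (sin (fst z) / (4 * pi)))
        \<in> borel_measurable borel"
      by (intro borel_measurable_times borel_measurable_indicator borel_closed)
    then show ?thesis
      by (intro measurable_compose [OF _ measurable_ennreal]) simp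
  qed
  have d: "(\<lambda>(\<theta>, \<psi>). ennreal (indicator ({0..pi} \<times> {0..2 * pi}) (\<theta>, \<psi>) * (sin \<theta> / (4 * pi)))) = ?d"
    by (auto simp: fun_eq_iff)
  have s: "(\<integral>\<^sup>+\<theta>. ennreal (sin \<theta> / (4 * pi)) * indicator {0..pi} \<theta> \<partial>lborel)
      = ennreal (- cos pi / (4 * pi) - - cos 0 / (4 * pi))"
    by (rule nn_integral_FTC_Icc)
      (auto intro!: derivative_eq_intros simp: sin_ge_zero has_real_derivative_iff_has_vector_derivative [symmetric])
  have "(\<integral>\<^sup>+z. ?d z \<partial>lborel)
      = (\<integral>\<^sup>+\<theta>. \<integral>\<^sup>+\<psi>. ?d (\<theta>, \<psi>) \<partial>lborel \<partial>lborel)"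
    using lborel.nn_integral_fst [where f = ?d and ?M1.0 = lborel] m
    unfolding lborel_prod by simp
  also have "\<dots> = (\<integral>\<^sup>+\<theta>. \<integral>\<^sup>+\<psi>. (ennreal (sin \<theta> / (4 * pi)) * indicator {0..pi} \<theta>)
      * indicator {0..2 * pi} \<psi> \<partial>lborel \<partial>lborel)"
    by (intro nn_integral_cong) (auto simp: indicator_def)
  also have "\<dots> = (\<integral>\<^sup>+\<theta>. (ennreal (sin \<theta> / (4 * pi)) * indicator {0..pi} \<theta>)
      * ennreal (2 * pi) \<partial>lborel)"
    by (simp add: nn_integral_cmult)
  also have "\<dots> = ennreal (1 / (2 * pi)) * ennreal (2 * pi)"
    by (simp add: nn_integral_multc s)
  also have "\<dots> = 1"
    by (simp flip: ennreal_mult)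
  finally have "prob_space (density lborel ?d)"
    using m by (intro prob_spaceI) (simp add: emeasure_density)
  then show ?thesis
    unfolding area_measure_def d
    by (rule prob_space.prob_space_distr) (use spherical_measurable in simp)
qed

lemma prob_space_bdry_measure: "prob_space \<Sigma>\<^sub>\<B>"
proof -
  interpret s: prob_space \<sigma> by (rule prob_space_area_measure)
  interpret u: prob_space "uniform_measure lborel {0..2 * pi}"
    by (rule prob_space_uniform_measure) auto
  interpret p: pair_prob_space "uniform_measure lborel {0..2 * pi}" \<sigma> ..
  have sets: "sets (uniform_measure lborel {0..2 * pi} \<Otimes>\<^sub>M \<sigma>)
      = sets (borel \<Otimes>\<^sub>M restrict_space borel \<S>)"
    by (intro sets_pair_measure_cong) (auto simp: area_measure_def)
  have id: "(\<lambda>q. q) \<in> measurable (restrict_space borel \<S>) borel"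
    by (rule measurable_restrict_space1) simp
  have "(\<lambda>(t, I). expI t I) \<in> borel_measurable (borel \<Otimes>\<^sub>M restrict_space borel \<S>)"
    unfolding expI_def case_prod_unfold
    using measurable_compose [OF measurable_snd id] by measurable
  then have "(\<lambda>(t, I). expI t I) \<in> measurable (borel \<Otimes>\<^sub>M restrict_space borel \<S>)
      (restrict_space borel \<partial>\<B>)"
    by (intro measurable_restrict_space2)
      (auto simp: space_pair_measure space_restrict_space bdry_ball_def)
  then show ?thesis
    unfolding bdry_measure_def
    by (intro p.prob_space_distr) (simp only: measurable_cong_sets [OF sets refl])
qed


section \<open>Spaces of slice functions\<close>

text \<open>Functions on \<^term>\<open>\<partial>\<B>\<close> are represented by functions on all quaternions whose values
  outside \<^term>\<open>\<partial>\<B>\<close> are irrelevant.\<close>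

definition slice_function :: "(quat \<Rightarrow> quat) \<Rightarrow> bool"
  where "slice_function f \<longleftrightarrow>
    (\<forall>J\<in>\<S>. \<forall>K\<in>\<S>. J \<noteq> K \<longrightarrow>
      (\<forall>x y. \<forall>I\<in>\<S>. x *\<^sub>R 1 + y *\<^sub>R I \<in> \<partial>\<B> \<longrightarrow>
        f (x *\<^sub>R 1 + y *\<^sub>R I) =
          (inverse (J - K) * J + I * inverse (J - K)) * f (x *\<^sub>R 1 + y *\<^sub>R J)
        - (inverse (J - K) * K + I * inverse (J - K)) * f (x *\<^sub>R 1 + y *\<^sub>R K)))"

text \<open>The elements of \<open>L2s\<close> are functions rather than classes modulo equality a.e.; the sets
  of functions defined below from a subset of \<open>L2s\<close> are closed under equality a.e.\<close>

definition L2s :: "(quat \<Rightarrow> quat) set"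
  where "L2s = {f. slice_function f \<and> f \<in> borel_measurable \<Sigma>\<^sub>\<B>
    \<and> integrable \<Sigma>\<^sub>\<B> (\<lambda>q. (norm (f q))\<^sup>2)}"

definition Linf_s :: "(quat \<Rightarrow> quat) set"
  where "Linf_s = {f. slice_function f \<and> f \<in> borel_measurable \<Sigma>\<^sub>\<B>
    \<and> (\<exists>C. AE q in \<Sigma>\<^sub>\<B>. norm (f q) \<le> C)}"

text \<open>\<open>has_series f a\<close> means that \<open>f q\<close> is the sum of \<open>q powi n * a n\<close> over all integers \<open>n\<close>,
  with convergence of the symmetric partial sums in the norm of \<open>L2s\<close>.\<close>

definition has_series :: "(quat \<Rightarrow> quat) \<Rightarrow> (int \<Rightarrow> quat) \<Rightarrow> bool"
  where "has_series f a \<longleftrightarrow> f \<in> L2s \<and> (\<lambda>n. (norm (a n))\<^sup>2) summable_on UNIV \<and>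
    (\<lambda>N::nat. \<integral>q. (norm (f q - (\<Sum>n = - int N..int N. q powi n * a n)))\<^sup>2 \<partial>\<Sigma>\<^sub>\<B>)
      \<longlonglongrightarrow> 0"

definition H2 :: "(quat \<Rightarrow> quat) set"
  where "H2 = {f. \<exists>a. has_series f a \<and> (\<forall>n<0. a n = 0)}"

text \<open>\<open>star_product f g h\<close> means that \<open>h\<close> is (a representative of) the \<open>*\<close>-product of
  \<open>f\<close> and \<open>g\<close>. It is a relation because \<open>h\<close> is determined only up to equality a.e.,
  and because the \<open>*\<close>-product of two functions in \<open>L2s\<close> need not be in \<open>L2s\<close>; it is in
  \<open>L2s\<close> whenever one of the factors is in \<open>Linf_s\<close>.\<close>

definition star_product :: "(quat \<Rightarrow> quat) \<Rightarrow> (quat \<Rightarrow> quat) \<Rightarrow> (quat \<Rightarrow> quat) \<Rightarrow> bool"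
  where "star_product f g h \<longleftrightarrow> (\<exists>a b. has_series f a \<and> has_series g b \<and>
    has_series h (\<lambda>n. \<Sum>\<^sub>\<infinity>k. a k * b (n - k)))"

definition star_H2 :: "(quat \<Rightarrow> quat) \<Rightarrow> (quat \<Rightarrow> quat) set"
  where "star_H2 \<phi> = {h. \<exists>f\<in>H2. star_product \<phi> f h}"

definition M_q :: "(quat \<Rightarrow> quat) \<Rightarrow> (quat \<Rightarrow> quat)"
  where "M_q f = (\<lambda>q. q * f q)"

definition M_q_image :: "(quat \<Rightarrow> quat) set \<Rightarrow> (quat \<Rightarrow> quat) set"
  where "M_q_image \<K> = {g \<in> L2s. \<exists>f\<in>\<K>. AE q in \<Sigma>\<^sub>\<B>. g q = M_q f q}"

text \<open>The last condition, applied to a constant sequence, makes \<open>\<K>\<close> closed under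
  equality a.e. within \<open>L2s\<close>.\<close>

definition closed_right_subspace :: "(quat \<Rightarrow> quat) set \<Rightarrow> bool"
  where "closed_right_subspace \<K> \<longleftrightarrow> \<K> \<subseteq> L2s \<and>
    (\<lambda>_. 0) \<in> \<K> \<and>
    (\<forall>f\<in>\<K>. \<forall>g\<in>\<K>. (\<lambda>q. f q + g q) \<in> \<K>) \<and>
    (\<forall>f\<in>\<K>. \<forall>c. (\<lambda>q. f q * c) \<in> \<K>) \<and>
    (\<forall>F f. (\<forall>n::nat. F n \<in> \<K>) \<and> f \<in> L2s \<and>
       (\<lambda>n. \<integral>q. (norm (F n q - f q))\<^sup>2 \<partial>\<Sigma>\<^sub>\<B>) \<longlonglongrightarrow> 0 \<longrightarrow> f \<in> \<K>)"

definition simply_invariant :: "(quat \<Rightarrow> quat) set \<Rightarrow> bool"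
  where "simply_invariant \<K> \<longleftrightarrow> M_q_image \<K> \<subset> \<K>"

definition unimodular :: "(quat \<Rightarrow> quat) \<Rightarrow> bool"
  where "unimodular \<phi> \<longleftrightarrow> \<phi> \<in> Linf_s \<and> (AE q in \<Sigma>\<^sub>\<B>. norm (\<phi> q) = 1)"

end

theory Submission
  imports Defs
begin

text \<open>
On the upper half circle of a slice, a slice function has the form
\<open>f (e\<^sup>t\<^sup>I) = \<alpha> t + I * \<beta> t\<close> with \<open>\<alpha>, \<beta>\<close> independent of the imaginary unit \<open>I\<close>, and
\<open>(\<alpha>, \<beta>)\<close> on \<open>[0, \<pi>]\<close> can be prescribed arbitrarily. The values at \<open>I\<close> and \<open>-I\<close> together have
square norm \<open>2 * (|\<alpha>|\<^sup>2 + |\<beta>|\<^sup>2)\<close>, so \<open>L2s\<close> is isometric to the space of square-integrable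
functions from \<open>[0, \<pi>]\<close> to \<open>quat \<times> quat\<close>. The pair \<open>(\<alpha>, \<beta>)\<close> is best read as the biquaternion
\<open>\<alpha> + \<iota> \<beta>\<close> in the complexified quaternions, where \<open>\<iota>\<close> is a central square root of \<open>-1\<close>. Indeed \<open>q\<^sup>n a\<close>
becomes \<open>e\<^sup>\<iota>\<^sup>n\<^sup>t a\<close>, the operator \<open>M_q\<close> becomes multiplication by the central scalar
\<open>e\<^sup>\<iota>\<^sup>t\<close>, the \<open>*\<close>-product becomes the pointwise product of biquaternions
(\<open>star_product_iff\<close>), and \<open>|\<phi>| = 1\<close> almost everywhere says that the biquaternion
\<open>P = \<alpha> + \<iota> \<beta>\<close> of \<open>\<phi>\<close> satisfies \<open>P\<^sup>\<dagger> P = 1\<close>, where \<open>\<dagger>\<close> conjugates both the quaternions and \<open>\<iota>\<close>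
(\<open>unimodular_iff\<close>). For such \<open>P\<close> the map \<open>F \<mapsto> P F\<close> is a unitary operator with inverse
\<open>F \<mapsto> P\<^sup>\<dagger> F\<close>.

The theorem is now the wandering subspace argument of Beurling and Helson. If \<open>\<K>\<close> is simply
invariant, projection onto \<open>M_q \<K>\<close> gives a unit vector \<open>\<phi>\<close> of \<open>\<K>\<close> orthogonal to \<open>M_q \<K>\<close>
(\<open>wandering_vector\<close>). The \<open>n\<close>-th Fourier coefficient of \<open>P\<^sup>\<dagger> F\<close> is the quaternionic inner
product of \<open>F\<close> with \<open>q\<^sup>n \<phi>\<close>, hence it vanishes for \<open>n < 0\<close> whenever \<open>F\<close> comes from \<open>\<K>\<close>
(\<open>wandering_coef\<close>). For \<open>F = P\<close> the function \<open>P\<^sup>\<dagger> P\<close> is self-adjoint, so all its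
coefficients but the constant one vanish and \<open>P\<^sup>\<dagger> P = 1\<close> (\<open>wandering_bunitary\<close>): thus \<open>\<phi>\<close> is
unimodular. For general \<open>F\<close> the claim says that \<open>P\<^sup>\<dagger> F\<close> belongs to \<open>H2\<close>, and
\<open>F = P (P\<^sup>\<dagger> F)\<close> shows \<open>\<K> \<subseteq> \<phi> * H2\<close>; the other inclusion holds since \<open>\<K>\<close> is closed and
contains all \<open>q\<^sup>n \<phi> a\<close> with \<open>n \<ge> 0\<close>.

Conversely \<open>\<phi> * H2\<close> is shift invariant, and \<open>\<phi> = q * \<phi> * f\<close> with \<open>f\<close> in \<open>H2\<close> would give
\<open>1 = q * f\<close> after multiplication by \<open>P\<^sup>\<dagger>\<close>, which contradicts the constant coefficient. If
\<open>\<phi>\<^sub>1 * H2 = \<phi>\<^sub>2 * H2\<close>, then \<open>F = P\<^sub>1\<^sup>\<dagger> P\<^sub>2\<close> and \<open>F\<^sup>\<dagger> = P\<^sub>2\<^sup>\<dagger> P\<^sub>1\<close> both have no negative coefficients,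
and the coefficients of \<open>F\<^sup>\<dagger>\<close> are the conjugates of those of \<open>F\<close> in reverse order; so \<open>F\<close> is
constant.

The analytic input is the \<open>L\<^sup>2\<close> theory of the Fourier coefficients on \<open>[0, \<pi>]\<close>: completeness
of \<open>L\<^sup>2\<close> (\<open>l2_complete\<close>), orthogonal projection (\<open>l2_projection\<close>), uniqueness of the coefficients
of an integrable function (\<open>coef_uniqueness\<close>), the theorem of Riesz and Fischer, and the
convolution formula for the coefficients of a product.
\<close>

section \<open>Quaternions and biquaternions\<close>

definition qcnj :: "quat \<Rightarrow> quat"
  where "qcnj q = Quat (qre q) (- qi q) (- qj q) (- qk q)"

lemma qcnj_sel [simp]:
  "qre (qcnj q) = qre q" "qi (qcnj q) = - qi q" "qj (qcnj q) = - qj q" "qk (qcnj q) = - qk q"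
  by (simp_all add: qcnj_def)

lemma qcnj_simps [simp]:
  "qcnj (qcnj p) = p" "qcnj 0 = 0" "qcnj 1 = 1" "qcnj (- p) = - qcnj p"
  "qcnj (p + q) = qcnj p + qcnj q" "qcnj (p - q) = qcnj p - qcnj q"
  "qcnj (r *\<^sub>R p) = r *\<^sub>R qcnj p"
  by (simp_all add: quat_eq_iff)

lemma qcnj_mult [simp]: "qcnj (p * q) = qcnj q * qcnj p"
  by (simp add: quat_eq_iff algebra_simps)

lemma norm_quat_power2: "(norm q)\<^sup>2 = (qre q)\<^sup>2 + (qi q)\<^sup>2 + (qj q)\<^sup>2 + (qk q)\<^sup>2" for q :: quat
  by (simp add: norm_quat_def)

lemma qcnj_mult_self: "qcnj q * q = (norm q)\<^sup>2 *\<^sub>R 1" and mult_qcnj_self: "q * qcnj q = (norm q)\<^sup>2 *\<^sub>R 1"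
  by (simp_all add: quat_eq_iff norm_quat_power2 flip: power2_eq_square)

lemma norm_qcnj [simp]: "norm (qcnj q) = norm q"
  by (simp add: norm_quat_def)

lemma inner_quat_eq: "inner p q = qre (qcnj p * q)"
  by (simp add: inner_quat_def)

lemma bounded_linear_qcnj: "bounded_linear qcnj"
  by (rule bounded_linear_intro [where K = 1]) simp_all

lemma bounded_linear_qre: "bounded_linear qre"
proof (rule bounded_linear_intro [where K = 1])
  fix x :: quat
  have "(qre x)\<^sup>2 \<le> (norm x)\<^sup>2" by (simp add: norm_quat_power2)
  then show "norm (qre x) \<le> norm x * 1"
    by (simp add: abs_le_square_iff [symmetric])
qed simp_all


type_synonym biquat = "quat \<times> quat"

text \<open>The product of the complexified quaternions, on pairs \<open>(a, b)\<close> standing for \<open>a + \<iota> b\<close> with \<open>\<iota>\<close> central and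
\<open>\<iota>\<^sup>2 = -1\<close>.\<close>

definition bmul :: "biquat \<Rightarrow> biquat \<Rightarrow> biquat"  (infixl "\<odot>" 70)
  where "F \<odot> G = (fst F * fst G - snd F * snd G, fst F * snd G + snd F * fst G)"

text \<open>The adjoint \<open>\<dagger>\<close>, conjugate linear also in \<open>\<iota>\<close>; the minus sign comes from there. This choice
makes \<open>badj F \<odot> G\<close> a biquaternion-valued inner product that refines the Euclidean one, see
\<open>inner_biquat\<close> below.\<close>

definition badj :: "biquat \<Rightarrow> biquat"
  where "badj F = (qcnj (fst F), - qcnj (snd F))"

text \<open>Multiplication by the central scalar \<open>e\<^sup>\<iota>\<^sup>t\<close>.\<close>

definition rot :: "real \<Rightarrow> biquat \<Rightarrow> biquat"
  where "rot t F = (cos t *\<^sub>R fst F - sin t *\<^sub>R snd F, sin t *\<^sub>R fst F + cos t *\<^sub>R snd F)"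

lemma bmul_assoc: "F \<odot> G \<odot> H = F \<odot> (G \<odot> H)"
  by (simp add: bmul_def algebra_simps)

lemma bmul_one [simp]: "(1, 0) \<odot> F = F" "F \<odot> (1, 0) = F"
  by (simp_all add: bmul_def)

lemma bmul_quat: "F \<odot> (c, 0) = (fst F * c, snd F * c)"
  by (simp add: bmul_def)

lemma bounded_bilinear_bmul: "bounded_bilinear (\<odot>)"
proof -
  have n: "norm (F \<odot> G) \<le> norm F * norm G * 4" for F G
  proof -
    have f: "norm (fst F) \<le> norm F" "norm (snd F) \<le> norm F"
      "norm (fst G) \<le> norm G" "norm (snd G) \<le> norm G"
      using norm_fst_le [of "fst F" "snd F"] norm_snd_le [of "snd F" "fst F"]
        norm_fst_le [of "fst G" "snd G"] norm_snd_le [of "snd G" "fst G"] by simp_all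
    have p: "norm (p * q) \<le> norm F * norm G" if "norm p \<le> norm F" "norm q \<le> norm G" for p q :: quat
      using that by (simp add: norm_mult mult_mono)
    have "norm (F \<odot> G) \<le> norm (fst (F \<odot> G)) + norm (snd (F \<odot> G))"
      using norm_Pair_le [of "fst (F \<odot> G)" "snd (F \<odot> G)"] by simp
    also have "\<dots> \<le> (norm (fst F * fst G) + norm (snd F * snd G))
        + (norm (fst F * snd G) + norm (snd F * fst G))"
      unfolding bmul_def by (auto intro!: add_mono norm_triangle_ineq norm_triangle_ineq4)
    also have "\<dots> \<le> norm F * norm G * 4"
      using p [OF f(1) f(3)] p [OF f(2) f(4)] p [OF f(1) f(4)] p [OF f(2) f(3)] by simp
    finally show ?thesis .
  qed
  show ?thesis
  proof
    show "\<exists>K. \<forall>F G. norm (F \<odot> G) \<le> norm F * norm G * K" using n by blast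
  qed (simp_all add: bmul_def algebra_simps)
qed

lemma badj_bmul: "badj (F \<odot> G) = badj G \<odot> badj F"
  by (simp add: bmul_def badj_def)

lemma badj_badj [simp]: "badj (badj F) = F"
  by (simp add: badj_def)

lemma norm_badj [simp]: "norm (badj F) = norm F"
  by (cases F) (simp add: badj_def norm_Pair)

lemma bounded_linear_badj: "bounded_linear badj"
  unfolding badj_def
  by (intro bounded_linear_Pair bounded_linear_minus
      bounded_linear_compose [OF bounded_linear_qcnj] bounded_linear_fst bounded_linear_snd)

lemma rot_bmul: "rot t (F \<odot> G) = rot t F \<odot> G" and bmul_rot: "F \<odot> rot t G = rot t (F \<odot> G)"
  by (simp_all add: rot_def bmul_def algebra_simps)

lemma rot_rot [simp]: "rot s (rot t F) = rot (s + t) F"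
  by (simp add: rot_def algebra_simps sin_add cos_add)

lemma rot_0 [simp]: "rot 0 F = F"
  by (simp add: rot_def)

lemma badj_rot: "badj (rot t F) = rot (- t) (badj F)"
  by (simp add: rot_def badj_def algebra_simps)

lemma rot_linear [simp]:
  "rot t 0 = 0" "rot t (F + G) = rot t F + rot t G" "rot t (F - G) = rot t F - rot t G"
  "rot t (r *\<^sub>R F) = r *\<^sub>R rot t F"
  by (simp_all add: rot_def prod_eq_iff algebra_simps)

lemma inner_biquat: "inner F G = qre (fst (badj F \<odot> G))"
  by (cases F; cases G) (simp add: badj_def bmul_def inner_quat_eq)

lemma norm_eq_iff_power2: "norm x = norm y \<longleftrightarrow> inner x x = inner y y" for x y :: "'a::real_inner"
  by (simp add: norm_eq_sqrt_inner)

lemma norm_rot [simp]: "norm (rot t F) = norm F"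
proof -
  have "badj (rot t F) \<odot> rot t F = badj F \<odot> F"
    by (simp add: badj_rot bmul_rot flip: rot_bmul)
  then show ?thesis by (simp add: norm_eq_iff_power2 inner_biquat)
qed

lemma badj_bmul_self:
  "badj F \<odot> F = ((norm F)\<^sup>2 *\<^sub>R 1, qcnj (fst F) * snd F - qcnj (snd F) * fst F)"
  by (cases F) (simp add: badj_def bmul_def qcnj_mult_self norm_Pair flip: scaleR_add_left)

lemma bmul_badj_self:
  "F \<odot> badj F = ((norm F)\<^sup>2 *\<^sub>R 1, snd F * qcnj (fst F) - fst F * qcnj (snd F))"
  by (cases F) (simp add: badj_def bmul_def mult_qcnj_self norm_Pair flip: scaleR_add_left)

definition bunitary :: "biquat \<Rightarrow> bool"
  where "bunitary F \<longleftrightarrow> badj F \<odot> F = (1, 0)"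

lemma qcnj_fixed_imp_real: "qcnj q = q \<Longrightarrow> q = qre q *\<^sub>R 1"
  by (simp add: quat_eq_iff)

text \<open>A one-sided unitary biquaternion is two-sided. For \<open>F = a + \<iota> b\<close> the hypothesis says in
particular that \<open>qcnj a * b\<close> is a real number \<open>r\<close>; conjugating by \<open>a\<close> does not move a real number, hence
\<open>b * qcnj a\<close> equals \<open>r\<close> too.\<close>

lemma bunitary_badj_aux:
  assumes "bunitary F" shows "F \<odot> badj F = (1, 0)"
proof -
  obtain a b where F: "F = (a, b)" by (cases F)
  have n: "(norm F)\<^sup>2 *\<^sub>R (1::quat) = 1" and e: "qcnj a * b = qcnj b * a"
    using assms by (simp_all add: bunitary_def badj_bmul_self F)
  have "b * qcnj a = a * qcnj b"
  proof (cases "a = 0")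
    case False
    define r where "r = qre (qcnj a * b)"
    have r: "qcnj a * b = r *\<^sub>R 1" unfolding r_def
      by (rule qcnj_fixed_imp_real) (simp add: e)
    have "(norm a)\<^sup>2 *\<^sub>R (b * qcnj a) = (a * (qcnj a * b)) * qcnj a"
      using mult_qcnj_self [of a] by (metis mult.assoc mult_scaleR_left mult_1)
    also have "\<dots> = (norm a)\<^sup>2 *\<^sub>R (r *\<^sub>R 1)"
      unfolding r by (simp add: mult_qcnj_self)
    finally have "(norm a)\<^sup>2 *\<^sub>R (b * qcnj a) = (norm a)\<^sup>2 *\<^sub>R (r *\<^sub>R 1)" .
    then have "b * qcnj a = r *\<^sub>R 1" using False by (simp only: scaleR_cancel_left) simp
    moreover from this have "a * qcnj b = r *\<^sub>R 1"
      by (metis qcnj_mult qcnj_simps(1,3,7))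
    ultimately show ?thesis by simp
  qed simp
  then show ?thesis using n by (simp add: bmul_badj_self F)
qed

lemma bunitary_badj: "bunitary (badj F) \<longleftrightarrow> bunitary F"
  using bunitary_badj_aux [of F] bunitary_badj_aux [of "badj F"] by (auto simp: bunitary_def)

lemma bmul_badj_cancel: "bunitary F \<Longrightarrow> badj F \<odot> (F \<odot> G) = G" "bunitary F \<Longrightarrow> F \<odot> (badj F \<odot> G) = G"
  using bunitary_badj_aux [of F] by (simp_all add: bunitary_def flip: bmul_assoc)

lemma norm_bmul_bunitary: assumes "bunitary F" shows "norm (F \<odot> G) = norm G"
proof -
  have "badj (F \<odot> G) \<odot> (F \<odot> G) = badj G \<odot> G"
    using assms by (simp add: badj_bmul bmul_assoc bmul_badj_cancel)
  then show ?thesis by (simp add: norm_eq_iff_power2 inner_biquat)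
qed

lemma unit_imag:
  "Quat 0 1 0 0 \<in> \<S>" "Quat 0 0 1 0 \<in> \<S>" "Quat 0 0 0 1 \<in> \<S>" "I \<in> \<S> \<Longrightarrow> - I \<in> \<S>"
  by (simp_all add: imag_sphere_iff)

text \<open>The cross term is linear in \<open>I\<close>. It therefore cancels between \<open>I\<close> and \<open>-I\<close>, and it vanishes
for every \<open>I\<close> exactly if \<open>b * qcnj a\<close> is real.\<close>

lemma norm_slice_power2:
  assumes "I \<in> \<S>"
  shows "(norm (a + I * b))\<^sup>2 = (norm (a, b))\<^sup>2 + 2 * qre (I * (b * qcnj a))"
proof -
  have i: "qre I = 0" "(norm I)\<^sup>2 = 1" using assms by (simp_all add: imag_sphere_iff norm_quat_power2)
  have "(norm (a + I * b))\<^sup>2 = (norm a)\<^sup>2 + (norm (I * b))\<^sup>2 + 2 * inner a (I * b)"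
    by (simp add: power2_norm_eq_inner inner_add inner_commute)
  also have "(norm (I * b))\<^sup>2 = (norm b)\<^sup>2" using i by (simp add: norm_mult power_mult_distrib)
  also have "inner a (I * b) = qre (I * (b * qcnj a))"
    by (simp add: inner_quat_def i algebra_simps)
  finally show ?thesis by (simp add: norm_Pair)
qed

text \<open>This is the pointwise form of the condition \<open>|\<phi>| = 1\<close>. The values at \<open>\<plusminus>i\<close>, \<open>\<plusminus>j\<close> and \<open>\<plusminus>k\<close>
already determine the norm of \<open>F\<close> and the three imaginary components of \<open>b * qcnj a\<close>.\<close>

lemma bunitary_iff_slice: "bunitary F \<longleftrightarrow> (\<forall>I\<in>\<S>. norm (fst F + I * snd F) = 1)"
proof -
  obtain a b where F: "F = (a, b)" by (cases F)
  have sq: "norm x = 1 \<longleftrightarrow> (norm x)\<^sup>2 = 1" for x :: quat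
    by (simp add: power2_eq_1_iff) (metis norm_ge_zero not_one_le_zero neg_0_le_iff_le le_minus_one_simps(3))
  show ?thesis
  proof
    assume "bunitary F"
    then have "F \<odot> badj F = (1, 0)" by (rule bunitary_badj_aux)
    then have n: "(norm (a, b))\<^sup>2 = 1" and e: "b * qcnj a - a * qcnj b = 0"
      by (auto simp: bmul_badj_self F quat_eq_iff)
    have "b * qcnj a = qre (b * qcnj a) *\<^sub>R 1"
      by (rule qcnj_fixed_imp_real) (use e in simp)
    then have "qre (I * (b * qcnj a)) = 0" if "I \<in> \<S>" for I
      using that by (metis imag_sphere_iff mult_scaleR_right mult.right_neutral quat_sel_linear(17) mult_zero_right)
    then show "\<forall>I\<in>\<S>. norm (fst F + I * snd F) = 1"
      using n by (simp add: F sq norm_slice_power2)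
  next
    assume *: "\<forall>I\<in>\<S>. norm (fst F + I * snd F) = 1"
    define c where "c = b * qcnj a"
    have h: "(norm (a, b))\<^sup>2 + 2 * qre (I * c) = 1" if "I \<in> \<S>" for I
      using * that norm_slice_power2 [OF that, of a b] unfolding c_def F by simp
    have n: "(norm (a, b))\<^sup>2 = 1" and "qi c = 0" "qj c = 0" "qk c = 0"
      using h [OF unit_imag(1)] h [OF unit_imag(2)] h [OF unit_imag(3)]
        h [OF unit_imag(4) [OF unit_imag(1)]] h [OF unit_imag(4) [OF unit_imag(2)]]
        h [OF unit_imag(4) [OF unit_imag(3)]]
      by simp_all
    then have "c = qcnj c" by (simp add: quat_eq_iff)
    also have "\<dots> = a * qcnj b" by (simp add: c_def)
    finally have "F \<odot> badj F = (1, 0)"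
      using n by (simp add: bmul_badj_self F c_def)
    then have "bunitary (badj F)" by (simp add: bunitary_def)
    then show "bunitary F" by (simp add: bunitary_badj)
  qed
qed


section \<open>Square-integrable functions\<close>

definition square_integrable :: "'a measure \<Rightarrow> ('a \<Rightarrow> 'b::euclidean_space) \<Rightarrow> bool"
  where "square_integrable M F \<longleftrightarrow> F \<in> borel_measurable M \<and> integrable M (\<lambda>x. (norm (F x))\<^sup>2)"

definition sqnorm :: "'a measure \<Rightarrow> ('a \<Rightarrow> 'b::euclidean_space) \<Rightarrow> real"
  where "sqnorm M F = (\<integral>x. (norm (F x))\<^sup>2 \<partial>M)"

definition l2_inner :: "'a measure \<Rightarrow> ('a \<Rightarrow> 'b::euclidean_space) \<Rightarrow> ('a \<Rightarrow> 'b) \<Rightarrow> real"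
  where "l2_inner M F G = (\<integral>x. inner (F x) (G x) \<partial>M)"

lemma square_integrableD [measurable_dest]: "square_integrable M F \<Longrightarrow> F \<in> borel_measurable M"
  by (simp add: square_integrable_def)

lemma sqnorm_nonneg [simp]: "0 \<le> sqnorm M F"
  by (simp add: sqnorm_def)

lemma sqnorm_eq_l2_inner: "sqnorm M F = l2_inner M F F"
  by (simp add: sqnorm_def l2_inner_def power2_norm_eq_inner)

lemma sqnorm_minus_commute: "sqnorm M (\<lambda>x. F x - G x) = sqnorm M (\<lambda>x. G x - F x)"
  by (simp add: sqnorm_def norm_minus_commute)

lemma square_integrable_bound:
  assumes F: "square_integrable M F" and G: "G \<in> borel_measurable M"
    and le: "AE x in M. norm (G x) \<le> C * norm (F x)"
  shows "square_integrable M G"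
  unfolding square_integrable_def
proof
  show "integrable M (\<lambda>x. (norm (G x))\<^sup>2)"
  proof (rule Bochner_Integration.integrable_bound)
    show "integrable M (\<lambda>x. C\<^sup>2 * (norm (F x))\<^sup>2)"
      using F by (simp add: square_integrable_def)
    show "AE x in M. norm ((norm (G x))\<^sup>2) \<le> norm (C\<^sup>2 * (norm (F x))\<^sup>2)"
      using le
    proof eventually_elim
      case (elim x)
      then have "(norm (G x))\<^sup>2 \<le> (C * norm (F x))\<^sup>2" by (intro power_mono) auto
      then show ?case by (simp add: power_mult_distrib)
    qed
  qed (use G in measurable)
qed (rule G)

lemma square_integrable_isometry:
  assumes "square_integrable M F" "G \<in> borel_measurable M" "AE x in M. norm (G x) = norm (F x)"
  shows "square_integrable M G"
  by (rule square_integrable_bound [where F = F and C = 1]) (use assms in auto)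

lemma square_integrable_cong:
  assumes "square_integrable M F" "G \<in> borel_measurable M" "AE x in M. G x = F x"
  shows "square_integrable M G"
  by (rule square_integrable_isometry [OF assms(1,2)]) (use assms(3) in auto)

lemma square_integrable_zero [simp]: "square_integrable M (\<lambda>_. 0)"
  by (simp add: square_integrable_def)

lemma square_integrable_scaleR:
  "square_integrable M F \<Longrightarrow> square_integrable M (\<lambda>x. c *\<^sub>R F x)"
  by (rule square_integrable_bound [where F = F and C = "\<bar>c\<bar>"]) (auto simp: square_integrable_def)

lemma square_integrable_add:
  assumes "square_integrable M F" "square_integrable M G"
  shows "square_integrable M (\<lambda>x. F x + G x)"
  unfolding square_integrable_def
proof
  show m: "(\<lambda>x. F x + G x) \<in> borel_measurable M"
    using assms by (auto simp: square_integrable_def)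
  show "integrable M (\<lambda>x. (norm (F x + G x))\<^sup>2)"
  proof (rule Bochner_Integration.integrable_bound)
    show "integrable M (\<lambda>x. 2 * (norm (F x))\<^sup>2 + 2 * (norm (G x))\<^sup>2)"
      using assms by (auto simp: square_integrable_def)
    show "AE x in M. norm ((norm (F x + G x))\<^sup>2) \<le> norm (2 * (norm (F x))\<^sup>2 + 2 * (norm (G x))\<^sup>2)"
    proof (rule AE_I2)
      fix x
      have "(norm (F x + G x))\<^sup>2 \<le> (norm (F x) + norm (G x))\<^sup>2"
        by (intro power_mono norm_triangle_ineq norm_ge_zero)
      also have "\<dots> \<le> 2 * (norm (F x))\<^sup>2 + 2 * (norm (G x))\<^sup>2"
        using sum_squares_bound [of "norm (F x)" "norm (G x)"] by (simp add: power2_sum)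
      finally show "norm ((norm (F x + G x))\<^sup>2) \<le> norm (2 * (norm (F x))\<^sup>2 + 2 * (norm (G x))\<^sup>2)"
        by simp
    qed
  qed (use m in measurable)
qed

lemma square_integrable_diff:
  assumes "square_integrable M F" "square_integrable M G"
  shows "square_integrable M (\<lambda>x. F x - G x)"
  using square_integrable_add [OF assms(1) square_integrable_scaleR [OF assms(2), of "-1"]] by simp

lemma square_integrable_sum:
  "(\<And>i. i \<in> A \<Longrightarrow> square_integrable M (F i)) \<Longrightarrow> square_integrable M (\<lambda>x. \<Sum>i\<in>A. F i x)"
  by (induction A rule: infinite_finite_induct) (auto intro: square_integrable_add)

lemma integrable_norm_mult:
  assumes F: "square_integrable M F" and G: "square_integrable M G"
  shows "integrable M (\<lambda>x. norm (F x) * norm (G x))"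
proof (rule Bochner_Integration.integrable_bound)
  show "integrable M (\<lambda>x. (norm (F x))\<^sup>2 + (norm (G x))\<^sup>2)"
    using assms by (auto simp: square_integrable_def)
  show "AE x in M. norm (norm (F x) * norm (G x)) \<le> norm ((norm (F x))\<^sup>2 + (norm (G x))\<^sup>2)"
  proof (rule AE_I2)
    fix x
    have "norm (F x) * norm (G x) \<le> 2 * norm (F x) * norm (G x)" by simp
    also have "\<dots> \<le> (norm (F x))\<^sup>2 + (norm (G x))\<^sup>2" by (rule sum_squares_bound)
    finally show "norm (norm (F x) * norm (G x)) \<le> norm ((norm (F x))\<^sup>2 + (norm (G x))\<^sup>2)" by simp
  qed
qed (use assms in measurable)

lemma integrable_bilinear:
  assumes "bounded_bilinear B" and F: "square_integrable M F" and G: "square_integrable M G"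
  shows "integrable M (\<lambda>x. B (F x) (G x) :: 'c::euclidean_space)"
proof -
  interpret bounded_bilinear B by fact
  obtain K where K: "norm (B a b) \<le> norm a * norm b * K" for a b using bounded by blast
  show ?thesis
  proof (rule Bochner_Integration.integrable_bound)
    show "integrable M (\<lambda>x. K * (norm (F x) * norm (G x)))"
      by (intro integrable_mult_right integrable_norm_mult F G)
    have "continuous_on UNIV (\<lambda>p. B (fst p) (snd p))"
      by (intro continuous_on continuous_on_fst continuous_on_snd continuous_on_id)
    then show "(\<lambda>x. B (F x) (G x)) \<in> borel_measurable M"
      by (rule borel_measurable_continuous_Pair [OF square_integrableD [OF F] square_integrableD [OF G]])
    show "AE x in M. norm (B (F x) (G x)) \<le> norm (K * (norm (F x) * norm (G x)))"
    proof (rule AE_I2)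
      fix x
      show "norm (B (F x) (G x)) \<le> norm (K * (norm (F x) * norm (G x)))"
        using K [of "F x" "G x"] abs_ge_self [of "K * (norm (F x) * norm (G x))"]
        by (simp only: real_norm_def mult_ac)
    qed
  qed
qed

lemma integrable_inner:
  "square_integrable M F \<Longrightarrow> square_integrable M G \<Longrightarrow> integrable M (\<lambda>x. inner (F x) (G x))"
  by (rule integrable_bilinear [OF bounded_bilinear_inner])

lemma l2_inner_add_left:
  assumes "square_integrable M F" "square_integrable M G" "square_integrable M H"
  shows "l2_inner M (\<lambda>x. F x + G x) H = l2_inner M F H + l2_inner M G H"
  using assms by (simp add: l2_inner_def inner_add_left integrable_inner)

lemma l2_inner_sum_right:
  assumes "square_integrable M F" "\<And>i. i \<in> A \<Longrightarrow> square_integrable M (G i)"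
  shows "l2_inner M F (\<lambda>x. \<Sum>i\<in>A. G i x) = (\<Sum>i\<in>A. l2_inner M F (G i))"
  using assms by (simp add: l2_inner_def inner_sum_right integrable_inner)

lemma sqnorm_add_scaleR:
  assumes "square_integrable M F" "square_integrable M G"
  shows "sqnorm M (\<lambda>x. F x + s *\<^sub>R G x) = sqnorm M F + 2 * s * l2_inner M F G + s\<^sup>2 * sqnorm M G"
proof -
  have "(norm (F x + s *\<^sub>R G x))\<^sup>2 = (norm (F x))\<^sup>2 + 2 * s * inner (F x) (G x) + s\<^sup>2 * (norm (G x))\<^sup>2" for x
    unfolding power2_norm_eq_inner
    by (simp add: inner_add inner_commute power2_eq_square algebra_simps)
  then show ?thesis
    using assms by (simp add: sqnorm_def l2_inner_def integrable_inner square_integrable_def)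
qed

lemma quadratic_nonneg_discriminant:
  fixes A B C :: real
  assumes "0 \<le> C" and q: "\<And>s. 0 \<le> A + 2 * s * B + s\<^sup>2 * C"
  shows "B\<^sup>2 \<le> A * C"
proof (cases "C = 0")
  case True
  have "B = 0"
  proof (rule ccontr)
    assume "B \<noteq> 0"
    with q [of "- (A + 1) / (2 * B)"] True show False by (simp add: field_simps)
  qed
  then show ?thesis using True by simp
next
  case False
  then show ?thesis using q [of "- B / C"] assms(1)
    by (simp add: field_simps power2_eq_square split: if_splits)
qed

lemma l2_Cauchy_Schwarz:
  assumes "square_integrable M F" "square_integrable M G"
  shows "(l2_inner M F G)\<^sup>2 \<le> sqnorm M F * sqnorm M G"
proof (rule quadratic_nonneg_discriminant)
  show "0 \<le> sqnorm M F + 2 * s * l2_inner M F G + s\<^sup>2 * sqnorm M G" for s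
    using sqnorm_nonneg [of M "\<lambda>x. F x + s *\<^sub>R G x"] by (simp only: sqnorm_add_scaleR assms)
qed simp

lemma tendsto_zero_of_power2_le:
  fixes x c :: "nat \<Rightarrow> real"
  assumes "c \<longlonglongrightarrow> 0" "\<And>n. (x n)\<^sup>2 \<le> c n"
  shows "x \<longlonglongrightarrow> 0"
proof -
  have "(\<lambda>n. (x n)\<^sup>2) \<longlonglongrightarrow> 0"
    by (rule tendsto_sandwich [OF _ _ tendsto_const assms(1)]) (use assms(2) in auto)
  then have "(\<lambda>n. sqrt ((x n)\<^sup>2)) \<longlonglongrightarrow> sqrt 0" by (rule tendsto_real_sqrt)
  then show ?thesis by (simp add: tendsto_rabs_zero_iff)
qed

lemma sqnorm_zero_AE:
  assumes "square_integrable M F" "sqnorm M F = 0" shows "AE x in M. F x = 0"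
  using integral_nonneg_eq_0_iff_AE [of M "\<lambda>x. (norm (F x))\<^sup>2"] assms
  by (simp add: square_integrable_def sqnorm_def)

text \<open>Used below to pass to the limit in a product of two square-integrable functions.\<close>

lemma tendsto_integral_norm_mult:
  assumes F: "square_integrable M F" and D: "\<And>n. square_integrable M (D n)"
    and lim: "(\<lambda>n. sqnorm M (D n)) \<longlonglongrightarrow> 0"
  shows "(\<lambda>n. \<integral>x. norm (F x) * norm (D n x) \<partial>M) \<longlonglongrightarrow> 0"
proof (rule tendsto_zero_of_power2_le)
  have n: "square_integrable M (\<lambda>x. norm (G x))" if "square_integrable M G" for G :: "'a \<Rightarrow> 'd::euclidean_space"
    using that by (auto simp: square_integrable_def)
  show "(\<integral>x. norm (F x) * norm (D k x) \<partial>M)\<^sup>2 \<le> sqnorm M F * sqnorm M (D k)" for k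
    using l2_Cauchy_Schwarz [OF n [OF F] n [OF D [of k]]] by (simp add: l2_inner_def sqnorm_def)
  show "(\<lambda>k. sqnorm M F * sqnorm M (D k)) \<longlonglongrightarrow> 0"
    using tendsto_mult_right_zero [OF lim] by simp
qed

text \<open>The rate \<open>4\<^sup>-\<^sup>k\<close> for squared distances is what makes the distances themselves summable.\<close>

lemma fast_subsequence:
  fixes e :: "nat \<Rightarrow> real"
  assumes "e \<longlonglongrightarrow> 0"
  obtains r where "strict_mono r" "\<And>k. e (r k) \<le> (1/4) ^ k"
proof -
  have "\<exists>N. \<forall>n\<ge>N. e n \<le> (1/4) ^ k" for k
  proof -
    have "\<forall>\<^sub>F n in sequentially. e n < (1/4) ^ k"
      using assms by (rule order_tendstoD) simp
    then show ?thesis by (auto simp: eventually_sequentially intro: less_imp_le)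
  qed
  then obtain N where N: "\<And>k n. n \<ge> N k \<Longrightarrow> e n \<le> (1/4) ^ k" by metis
  define r where "r k = (\<Sum>j\<le>k. Suc (N j))" for k
  have "strict_mono r" unfolding strict_mono_Suc_iff r_def by simp
  moreover have "N k \<le> r k" for k
    using member_le_sum [of k "{..k}" "\<lambda>j. Suc (N j)"] by (simp add: r_def)
  ultimately show ?thesis using that N by blast
qed

context finite_measure
begin

lemma square_integrable_integrable:
  assumes "square_integrable M F" shows "integrable M F"
proof (rule Bochner_Integration.integrable_bound)
  show "integrable M (\<lambda>x. 1 + (norm (F x))\<^sup>2)" using assms by (auto simp: square_integrable_def)
  show "AE x in M. norm (F x) \<le> norm (1 + (norm (F x))\<^sup>2)"
  proof (rule AE_I2)
    fix x
    have "norm (F x) \<le> 2 * 1 * norm (F x)" by simp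
    also have "\<dots> \<le> 1\<^sup>2 + (norm (F x))\<^sup>2" by (rule sum_squares_bound)
    finally show "norm (F x) \<le> norm (1 + (norm (F x))\<^sup>2)" by simp
  qed
qed (use assms in \<open>auto simp: square_integrable_def\<close>)

text \<open>By \<open>2 * d \<le> 2\<^sup>k * d\<^sup>2 + 2\<^sup>-\<^sup>k\<close> the integrals of the increments are bounded by a constant times
\<open>2\<^sup>-\<^sup>k\<close>. So the sum of the increments has finite integral, and the telescoping series converges
absolutely at almost every point.\<close>

lemma AE_convergent_of_fast_Cauchy:
  fixes F :: "nat \<Rightarrow> 'a \<Rightarrow> 'b::euclidean_space"
  assumes F: "\<And>n. square_integrable M (F n)"
    and le: "\<And>k. sqnorm M (\<lambda>x. F (Suc k) x - F k x) \<le> (1/4) ^ k"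
  shows "AE x in M. convergent (\<lambda>k. F k x)"
proof -
  define D where "D k x = F (Suc k) x - F k x" for k x
  have D: "square_integrable M (D k)" for k
    unfolding D_def by (intro square_integrable_diff F)
  have m [measurable]: "D k \<in> borel_measurable M" for k using D by (rule square_integrableD)
  define C where "C = 1 + measure M (space M)"
  have "(\<integral>\<^sup>+x. ennreal (norm (D k x)) \<partial>M) \<le> ennreal (C * (1/2) ^ k)" for k
  proof -
    have i: "integrable M (\<lambda>x. 2 ^ k * (norm (D k x))\<^sup>2 + (1/2) ^ k)"
      using D by (simp add: square_integrable_def)
    have "(\<integral>\<^sup>+x. ennreal (norm (D k x)) \<partial>M) \<le> (\<integral>\<^sup>+x. ennreal (2 ^ k * (norm (D k x))\<^sup>2 + (1/2) ^ k) \<partial>M)"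
    proof (intro nn_integral_mono ennreal_leI)
      fix x
      have "2 * norm (D k x) \<le> 2 ^ k * (norm (D k x))\<^sup>2 + (1/2) ^ k"
      proof -
        have "0 \<le> 2 ^ k * (norm (D k x) - (1/2) ^ k)\<^sup>2" by simp
        also have "\<dots> = 2 ^ k * (norm (D k x))\<^sup>2 + (1/2) ^ k - 2 * norm (D k x)"
        proof -
          have e: "2 ^ k * (1/2::real) ^ k = 1" by (simp flip: power_mult_distrib)
          have "2 ^ k * (a - (1/2) ^ k)\<^sup>2
              = 2 ^ k * a\<^sup>2 + (2 ^ k * (1/2) ^ k) * (1/2) ^ k - 2 * a * (2 ^ k * (1/2) ^ k)" for a :: real
            by (simp add: power2_diff power2_eq_square algebra_simps)
          then show ?thesis unfolding e by simp
        qed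
        finally show ?thesis by simp
      qed
      then show "norm (D k x) \<le> 2 ^ k * (norm (D k x))\<^sup>2 + (1/2) ^ k"
        using norm_ge_zero [of "D k x"] by linarith
    qed
    also have "\<dots> = ennreal (\<integral>x. 2 ^ k * (norm (D k x))\<^sup>2 + (1/2) ^ k \<partial>M)"
      by (rule nn_integral_eq_integral [OF i]) auto
    also have "(\<integral>x. 2 ^ k * (norm (D k x))\<^sup>2 + (1/2) ^ k \<partial>M)
        = 2 ^ k * sqnorm M (D k) + (1/2) ^ k * measure M (space M)"
      using D by (simp add: square_integrable_def sqnorm_def mult.commute)
    also have "\<dots> \<le> 2 ^ k * (1/4) ^ k + (1/2) ^ k * measure M (space M)"
      using le [of k] by (simp add: D_def [abs_def])
    also have "\<dots> = C * (1/2) ^ k"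
    proof -
      have "2 ^ k * (1/4::real) ^ k = (1/2) ^ k" by (simp flip: power_mult_distrib)
      then show ?thesis by (simp add: C_def algebra_simps)
    qed
    finally show ?thesis using ennreal_leI by blast
  qed
  then have "(\<Sum>k. \<integral>\<^sup>+x. ennreal (norm (D k x)) \<partial>M) \<le> (\<Sum>k. ennreal (C * (1/2) ^ k))"
    by (intro suminf_le summableI)
  also have "\<dots> < \<infinity>"
  proof -
    have "summable (\<lambda>k. C * (1/2::real) ^ k)" by (intro summable_mult summable_geometric) simp
    then have "(\<Sum>k. ennreal (C * (1/2) ^ k)) = ennreal (\<Sum>k. C * (1/2) ^ k)"
      by (intro suminf_ennreal2) (auto simp: C_def)
    then show ?thesis by simp
  qed
  finally have "(\<integral>\<^sup>+x. (\<Sum>k. ennreal (norm (D k x))) \<partial>M) \<noteq> \<infinity>"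
    by (simp add: nn_integral_suminf)
  then have "AE x in M. (\<Sum>k. ennreal (norm (D k x))) \<noteq> \<infinity>"
    by (intro nn_integral_PInf_AE) auto
  then show ?thesis
  proof eventually_elim
    case (elim x)
    then have "summable (\<lambda>k. norm (D k x))" by (intro summable_suminf_not_top) auto
    then have "summable (\<lambda>k. D k x)" by (rule summable_norm_cancel)
    then have "convergent (\<lambda>n. F 0 x + (\<Sum>k<n. D k x))"
      by (intro convergent_add convergent_const) (simp add: summable_iff_convergent)
    moreover have "F 0 x + (\<Sum>k<n. D k x) = F n x" for n
      using sum_lessThan_telescope [of "\<lambda>k. F k x" n] by (simp add: D_def)
    ultimately show ?case by simp
  qed
qed

text \<open>The limit is the pointwise limit along a fast subsequence; Fatou's lemma bounds its distance
to each \<open>F n\<close>. The rate \<open>e\<close> replaces the usual formulation of the Cauchy condition because all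
applications come with one.\<close>

lemma l2_complete:
  fixes F :: "nat \<Rightarrow> 'a \<Rightarrow> 'b::euclidean_space"
  assumes F: "\<And>n. square_integrable M (F n)" and e: "e \<longlonglongrightarrow> 0"
    and le: "\<And>m n. m \<le> n \<Longrightarrow> sqnorm M (\<lambda>x. F n x - F m x) \<le> e m"
  obtains G where "square_integrable M G" "(\<lambda>n. sqnorm M (\<lambda>x. F n x - G x)) \<longlonglongrightarrow> 0"
proof -
  obtain r where r: "strict_mono r" "\<And>k. e (r k) \<le> (1/4) ^ k"
    using fast_subsequence [OF e] by metis
  have m [measurable]: "F n \<in> borel_measurable M" for n using F by (rule square_integrableD)
  have "sqnorm M (\<lambda>x. F (r (Suc k)) x - F (r k) x) \<le> (1/4) ^ k" for k
    using le [of "r k" "r (Suc k)"] r by (meson less_or_eq_imp_le order_trans strict_mono_Suc_iff)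
  then have conv: "AE x in M. convergent (\<lambda>k. F (r k) x)"
    by (intro AE_convergent_of_fast_Cauchy F)
  define G where "G x = lim (\<lambda>k. F (r k) x)" for x
  have [measurable]: "G \<in> borel_measurable M"
    unfolding G_def by (rule borel_measurable_lim_metric) simp
  have b: "square_integrable M (\<lambda>x. F n x - G x) \<and> sqnorm M (\<lambda>x. F n x - G x) \<le> e n" for n
  proof -
    have "0 \<le> e n" using le [of n n] order_trans sqnorm_nonneg by blast
    have "(\<integral>\<^sup>+x. ennreal ((norm (F n x - G x))\<^sup>2) \<partial>M)
        = (\<integral>\<^sup>+x. liminf (\<lambda>k. ennreal ((norm (F n x - F (r k) x))\<^sup>2)) \<partial>M)"
    proof (rule nn_integral_cong_AE)
      show "AE x in M. ennreal ((norm (F n x - G x))\<^sup>2)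
          = liminf (\<lambda>k. ennreal ((norm (F n x - F (r k) x))\<^sup>2))"
        using conv
      proof eventually_elim
        case (elim x)
        then have "(\<lambda>k. F (r k) x) \<longlonglongrightarrow> G x" by (simp add: G_def convergent_LIMSEQ_iff)
        then have "(\<lambda>k. ennreal ((norm (F n x - F (r k) x))\<^sup>2)) \<longlonglongrightarrow> ennreal ((norm (F n x - G x))\<^sup>2)"
          by (intro tendsto_intros)
        then show ?case by (intro lim_imp_Liminf [symmetric]) simp_all
      qed
    qed
    also have "\<dots> \<le> liminf (\<lambda>k. \<integral>\<^sup>+x. ennreal ((norm (F n x - F (r k) x))\<^sup>2) \<partial>M)"
      by (rule nn_integral_liminf) measurable
    also have "\<dots> \<le> ennreal (e n)"
    proof (rule Liminf_le)
      have "(\<integral>\<^sup>+x. ennreal ((norm (F n x - F (r k) x))\<^sup>2) \<partial>M) \<le> ennreal (e n)" if "n \<le> k" for k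
      proof -
        have "n \<le> r k" using that strict_mono_imp_increasing [OF r(1), of k] by simp
        have "(\<integral>\<^sup>+x. ennreal ((norm (F n x - F (r k) x))\<^sup>2) \<partial>M) = ennreal (sqnorm M (\<lambda>x. F n x - F (r k) x))"
          unfolding sqnorm_def
          by (rule nn_integral_eq_integral)
            (use square_integrable_diff [OF F [of n] F [of "r k"]] in \<open>auto simp: square_integrable_def\<close>)
        also have "\<dots> \<le> ennreal (e n)"
          using le [OF \<open>n \<le> r k\<close>] by (subst sqnorm_minus_commute) (rule ennreal_leI)
        finally show ?thesis .
      qed
      then show "\<forall>\<^sub>F k in sequentially. (\<integral>\<^sup>+x. ennreal ((norm (F n x - F (r k) x))\<^sup>2) \<partial>M) \<le> ennreal (e n)"
        by (auto simp: eventually_sequentially)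
    qed simp
    finally have fin: "(\<integral>\<^sup>+x. ennreal ((norm (F n x - G x))\<^sup>2) \<partial>M) \<le> ennreal (e n)" .
    have i: "integrable M (\<lambda>x. (norm (F n x - G x))\<^sup>2)"
      using fin by (intro integrableI_nonneg) (auto simp: top_unique less_top[symmetric])
    have "ennreal (sqnorm M (\<lambda>x. F n x - G x)) \<le> ennreal (e n)"
      using fin unfolding sqnorm_def by (subst nn_integral_eq_integral [OF i, symmetric]) auto
    then show ?thesis using i \<open>0 \<le> e n\<close> by (simp add: square_integrable_def)
  qed
  have "square_integrable M (\<lambda>x. F 0 x - (F 0 x - G x))"
    by (rule square_integrable_diff [OF F]) (use b [of 0] in simp)
  moreover have "(\<lambda>n. sqnorm M (\<lambda>x. F n x - G x)) \<longlonglongrightarrow> 0"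
    by (rule tendsto_sandwich [OF _ _ tendsto_const e]) (use b in auto)
  ultimately show ?thesis using that by simp
qed

text \<open>A minimising sequence for the distance from \<open>g\<close> to \<open>C\<close> is Cauchy by the parallelogram law.
Orthogonality is obtained along the sequence: perturbing \<open>h n\<close> by multiples of \<open>c\<close> cannot bring
the squared distance below \<open>d\<close>, which bounds the inner product with \<open>c\<close> through a discriminant.\<close>

lemma l2_projection:
  fixes C :: "('a \<Rightarrow> 'b::euclidean_space) set"
  assumes sq: "\<And>F. F \<in> C \<Longrightarrow> square_integrable M F"
    and zero: "(\<lambda>_. 0) \<in> C"
    and add: "\<And>F G. F \<in> C \<Longrightarrow> G \<in> C \<Longrightarrow> (\<lambda>x. F x + G x) \<in> C"
    and scale: "\<And>F s. F \<in> C \<Longrightarrow> (\<lambda>x. s *\<^sub>R F x) \<in> C"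
    and closed: "\<And>F G. (\<And>n. F n \<in> C) \<Longrightarrow> square_integrable M G \<Longrightarrow>
      (\<lambda>n. sqnorm M (\<lambda>x. F n x - G x)) \<longlonglongrightarrow> 0 \<Longrightarrow> G \<in> C"
    and g: "square_integrable M g"
  obtains h where "h \<in> C" "\<And>c. c \<in> C \<Longrightarrow> l2_inner M (\<lambda>x. g x - h x) c = 0"
proof -
  define d where "d = (INF c\<in>C. sqnorm M (\<lambda>x. g x - c x))"
  have bdd: "bdd_below ((\<lambda>c. sqnorm M (\<lambda>x. g x - c x)) ` C)"
    by (rule bdd_belowI2 [where m = 0]) simp
  have d: "d \<le> sqnorm M (\<lambda>x. g x - c x)" if "c \<in> C" for c
    unfolding d_def by (rule cINF_lower [OF bdd that])
  have "\<exists>c\<in>C. sqnorm M (\<lambda>x. g x - c x) < d + 1 / Suc n" for n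
  proof -
    have "d < d + 1 / Suc n" by simp
    then show ?thesis using zero unfolding d_def
      by (subst (asm) cINF_less_iff [OF _ bdd]) auto
  qed
  then obtain h where h: "\<And>n. h n \<in> C" "\<And>n. sqnorm M (\<lambda>x. g x - h n x) < d + 1 / Suc n"
    by metis
  have gh: "square_integrable M (\<lambda>x. g x - h n x)" for n
    by (intro square_integrable_diff g sq h)
  have cauchy: "sqnorm M (\<lambda>x. h n x - h m x) \<le> 4 * (1 / Suc m)" if "m \<le> n" for m n
  proof -
    let ?A = "\<lambda>x. g x - h n x" and ?B = "\<lambda>x. g x - h m x"
    \<comment> \<open>the midpoint of two almost minimisers is not closer than d\<close>
    have "(\<lambda>x. (1/2) *\<^sub>R (h n x + h m x)) \<in> C" by (intro scale add h)
    then have "d \<le> sqnorm M (\<lambda>x. g x - (1/2) *\<^sub>R (h n x + h m x))" by (rule d)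
    also have "(\<lambda>x. g x - (1/2) *\<^sub>R (h n x + h m x)) = (\<lambda>x. (1/2) *\<^sub>R ?A x + (1/2) *\<^sub>R ?B x)"
    proof
      show "g x - (1/2) *\<^sub>R (h n x + h m x) = (1/2) *\<^sub>R ?A x + (1/2) *\<^sub>R ?B x" for x
        using scaleR_half_double [of "g x"] by (simp only: scaleR_right_distrib scaleR_diff_right) simp
    qed
    also have "sqnorm M (\<lambda>x. (1/2) *\<^sub>R ?A x + (1/2) *\<^sub>R ?B x) = sqnorm M (\<lambda>x. (1/2) *\<^sub>R (?A x + 1 *\<^sub>R ?B x))"
      by (simp add: algebra_simps)
    also have "\<dots> = sqnorm M (\<lambda>x. ?A x + 1 *\<^sub>R ?B x) / 4"
      unfolding sqnorm_def by (simp add: power_divide)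
    also have "\<dots> = (sqnorm M ?A + 2 * l2_inner M ?A ?B + sqnorm M ?B) / 4"
      by (subst sqnorm_add_scaleR [OF gh gh]) simp
    finally have 1: "4 * d \<le> sqnorm M ?A + 2 * l2_inner M ?A ?B + sqnorm M ?B" by simp
    have "sqnorm M (\<lambda>x. h n x - h m x) = sqnorm M (\<lambda>x. ?A x + (-1) *\<^sub>R ?B x)"
      by (subst sqnorm_minus_commute) simp
    also have "\<dots> = sqnorm M ?A - 2 * l2_inner M ?A ?B + sqnorm M ?B"
      by (subst sqnorm_add_scaleR [OF gh gh]) simp
    also have "\<dots> \<le> 2 * sqnorm M ?A + 2 * sqnorm M ?B - 4 * d" using 1 by simp
    also have "\<dots> \<le> 2 * (1 / Suc n) + 2 * (1 / Suc m)" using h(2) [of n] h(2) [of m] by simp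
    also have "\<dots> \<le> 4 * (1 / Suc m)"
      using frac_le [of 1 1 "real (Suc m)" "real (Suc n)"] that by simp
    finally show ?thesis .
  qed
  have e: "(\<lambda>m. 4 * (1 / real (Suc m))) \<longlonglongrightarrow> 0"
    using tendsto_mult_right_zero [OF LIMSEQ_inverse_real_of_nat, of 4] by (simp add: inverse_eq_divide)
  obtain H where H: "square_integrable M H" "(\<lambda>n. sqnorm M (\<lambda>x. h n x - H x)) \<longlonglongrightarrow> 0"
    using l2_complete [OF sq [OF h(1)] e cauchy] by metis
  have "H \<in> C" by (rule closed [OF h(1) H])
  moreover have "l2_inner M (\<lambda>x. g x - H x) c = 0" if c: "c \<in> C" for c
  proof -
    have hH: "square_integrable M (\<lambda>x. h n x - H x)" for n by (intro square_integrable_diff sq h H)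
    have "(l2_inner M (\<lambda>x. g x - h n x) c)\<^sup>2 \<le> (1 / Suc n) * sqnorm M c" for n
    proof (rule quadratic_nonneg_discriminant)
      fix s
      have "(\<lambda>x. h n x + (- s) *\<^sub>R c x) \<in> C" by (intro add scale h c)
      then have "d \<le> sqnorm M (\<lambda>x. g x - (h n x + (- s) *\<^sub>R c x))" by (rule d)
      also have "\<dots> = sqnorm M (\<lambda>x. (g x - h n x) + s *\<^sub>R c x)" by (simp add: algebra_simps)
      also have "\<dots> = sqnorm M (\<lambda>x. g x - h n x) + 2 * s * l2_inner M (\<lambda>x. g x - h n x) c + s\<^sup>2 * sqnorm M c"
        by (intro sqnorm_add_scaleR gh sq c)
      finally show "0 \<le> 1 / Suc n + 2 * s * l2_inner M (\<lambda>x. g x - h n x) c + s\<^sup>2 * sqnorm M c"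
        using h(2) [of n] by linarith
    qed simp
    moreover have "(\<lambda>n. (1 / Suc n) * sqnorm M c) \<longlonglongrightarrow> 0"
      using tendsto_mult_left_zero [OF LIMSEQ_inverse_real_of_nat] by (simp add: inverse_eq_divide)
    ultimately have 1: "(\<lambda>n. l2_inner M (\<lambda>x. g x - h n x) c) \<longlonglongrightarrow> 0"
      by (rule tendsto_zero_of_power2_le [rotated])
    have "(\<lambda>n. sqnorm M (\<lambda>x. h n x - H x) * sqnorm M c) \<longlonglongrightarrow> 0"
      using tendsto_mult_left_zero [OF H(2)] by simp
    then have 2: "(\<lambda>n. l2_inner M (\<lambda>x. h n x - H x) c) \<longlonglongrightarrow> 0"
      by (rule tendsto_zero_of_power2_le) (intro l2_Cauchy_Schwarz hH sq c)
    have "l2_inner M (\<lambda>x. g x - h n x) c + l2_inner M (\<lambda>x. h n x - H x) c = l2_inner M (\<lambda>x. g x - H x) c" for n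
      by (subst l2_inner_add_left [symmetric]) (auto intro: gh hH sq c)
    with tendsto_add [OF 1 2] show ?thesis by (simp add: LIMSEQ_const_iff)
  qed
  ultimately show ?thesis using that by blast
qed

end


section \<open>Uniqueness of cosine and sine coefficients\<close>

text \<open>Normalised Lebesgue measure on \<open>[0, \<pi>]\<close>, the parameter space of the upper half circle.\<close>

definition arc_measure :: "real measure"
  where "arc_measure = uniform_measure lborel {0..pi}"

lemma sets_arc [measurable_cong, simp]: "sets arc_measure = sets borel"
  by (simp add: arc_measure_def)

lemma space_arc [simp]: "space arc_measure = UNIV"
  by (simp add: arc_measure_def)

interpretation arc: prob_space arc_measure
  unfolding arc_measure_def by (rule prob_space_uniform_measure) auto

lemma AE_arc: "(AE t in arc_measure. P t) \<longleftrightarrow> (AE t in lborel. t \<in> {0..pi} \<longrightarrow> P t)"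
  unfolding arc_measure_def by (rule AE_uniform_measure) auto

lemma AE_arc_interior: "AE t in arc_measure. 0 < t \<and> t < pi"
  unfolding AE_arc using AE_lborel_singleton [of "0::real"] AE_lborel_singleton [of pi]
  by eventually_elim auto

lemma arc_eq_density: "arc_measure = density lborel (\<lambda>t. ennreal (indicator {0..pi} t / pi))"
  unfolding arc_measure_def uniform_measure_def
  by (rule arg_cong [where f = "density lborel"])
    (use divide_ennreal [of 1 pi] in \<open>auto simp: fun_eq_iff indicator_def\<close>)

lemma integral_cos_arc: "(\<integral>t. cos (of_int n * t) \<partial>arc_measure) = (if n = 0 then 1 else 0)"
proof (cases "n = 0")
  case True
  then show ?thesis using arc.prob_space by simp
next
  case False
  have "(\<integral>t. cos (of_int n * t) \<partial>arc_measure) = (\<integral>t. indicator {0..pi} t / pi * cos (of_int n * t) \<partial>lborel)"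
    unfolding arc_eq_density by (subst integral_density) auto
  also have "\<dots> = (\<integral>t. cos (of_int n * t) / pi * indicator {0..pi} t \<partial>lborel)"
    by (simp add: mult.commute)
  also have "\<dots> = sin (of_int n * pi) / (of_int n * pi) - sin (of_int n * 0) / (of_int n * pi)"
    by (rule integral_FTC_Icc_real)
      (use False in \<open>auto intro!: derivative_eq_intros continuous_intros simp: field_simps\<close>)
  also have "\<dots> = 0" by (simp add: mult.commute [of _ pi])
  finally show ?thesis using False by simp
qed

lemma integrable_arc_mult:
  fixes h c :: "real \<Rightarrow> real"
  assumes "integrable arc_measure h" "c \<in> borel_measurable borel" "\<And>t. \<bar>c t\<bar> \<le> 1"
  shows "integrable arc_measure (\<lambda>t. h t * c t)"
proof (rule Bochner_Integration.integrable_bound [OF assms(1)])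
  show "AE t in arc_measure. norm (h t * c t) \<le> norm (h t)"
    by (rule AE_I2) (simp add: abs_mult mult_left_le assms(3))
  show "(\<lambda>t. h t * c t) \<in> borel_measurable arc_measure"
    using assms(1,2) by (intro borel_measurable_times) (auto simp: measurable_cong_sets [OF sets_arc refl])
qed

text \<open>Clamping the argument makes the function continuous, hence measurable, on all of \<open>\<real>\<close>.\<close>

definition arccos_clamp :: "real \<Rightarrow> real"
  where "arccos_clamp x = arccos (max (-1) (min 1 x))"

lemma arccos_clamp_cos: "0 \<le> t \<Longrightarrow> t \<le> pi \<Longrightarrow> arccos_clamp (cos t) = t"
  by (simp add: arccos_clamp_def min_absorb2 max_absorb2 arccos_cos)

lemma borel_measurable_arccos_clamp [measurable]: "arccos_clamp \<in> borel_measurable borel"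
  unfolding arccos_clamp_def [abs_def]
  by (intro borel_measurable_continuous_onI continuous_intros) (auto simp: max_def min_def)

text \<open>By \<open>2 * cos t * cos (n * t) = cos ((n + 1) * t) + cos ((n - 1) * t)\<close> a function orthogonal to all
\<open>cos (n * t)\<close> is orthogonal to all polynomials in \<open>cos t\<close>.\<close>

lemma cosine_moments:
  fixes h :: "real \<Rightarrow> real"
  assumes h: "integrable arc_measure h" and c: "\<And>n::nat. (\<integral>t. h t * cos (n * t) \<partial>arc_measure) = 0"
  shows "(\<integral>t. h t * (cos t ^ m * cos (real n * t)) \<partial>arc_measure) = 0"
proof (induction m arbitrary: n)
  case 0
  then show ?case using c by simp
next
  case (Suc m)
  have i: "integrable arc_measure (\<lambda>t. h t * (cos t ^ m * cos (real n * t)))" for n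
    by (rule integrable_arc_mult [OF h])
      (auto intro!: borel_measurable_continuous_onI continuous_intros mult_le_one simp: abs_mult power_abs power_le_one)
  show ?case
  proof (cases n)
    case 0
    then show ?thesis using Suc [of 1] by (simp add: mult.commute)
  next
    case (Suc k)
    have "cos t * cos (real n * t) = (cos (real (Suc n) * t) + cos (real k * t)) / 2" for t
      unfolding cos_times_cos using cos_minus [of "t - real n * t"]
      by (simp add: Suc algebra_simps)
    note product = this
    have e: "h t * (cos t ^ Suc m * cos (real n * t))
        = (h t * (cos t ^ m * cos (real (Suc n) * t)) + h t * (cos t ^ m * cos (real k * t))) / 2" for t
    proof -
      have "h t * (cos t ^ Suc m * cos (real n * t)) = h t * cos t ^ m * (cos t * cos (real n * t))"
        by (simp add: mult_ac)
      also have "\<dots> = h t * cos t ^ m * ((cos (real (Suc n) * t) + cos (real k * t)) / 2)"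
        unfolding product ..
      also have "\<dots> = (h t * (cos t ^ m * cos (real (Suc n) * t)) + h t * (cos t ^ m * cos (real k * t))) / 2"
        by (simp only: distrib_left times_divide_eq_right mult.assoc)
      finally show ?thesis .
    qed
    show ?thesis unfolding e
      using Suc.IH [of "Suc n"] Suc.IH [of k] i [of "Suc n"] i [of k]
      by (simp del: of_nat_Suc power_Suc)
  qed
qed

text \<open>By Weierstrass, polynomials are uniformly dense in the continuous functions on the range
\<open>[-1, 1]\<close> of the cosine.\<close>

lemma continuous_moments:
  fixes h g :: "real \<Rightarrow> real"
  assumes h: "integrable arc_measure h" and c: "\<And>n::nat. (\<integral>t. h t * cos (n * t) \<partial>arc_measure) = 0"
    and g: "continuous_on UNIV g" "\<And>x. \<bar>g x\<bar> \<le> 1"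
  shows "(\<integral>t. h t * g (cos t) \<partial>arc_measure) = 0"
proof -
  have "continuous_on UNIV (\<lambda>t. g (cos t))"
    by (rule continuous_on_compose2 [OF g(1) continuous_on_cos [OF continuous_on_id]]) simp
  then have gi: "integrable arc_measure (\<lambda>t. h t * g (cos t))"
    by (rule integrable_arc_mult [OF h borel_measurable_continuous_onI]) (rule g(2))
  define B where "B = (\<integral>t. \<bar>h t\<bar> \<partial>arc_measure)"
  have le: "\<bar>\<integral>t. h t * g (cos t) \<partial>arc_measure\<bar> \<le> e * B" if e: "0 < e" for e
  proof -
    obtain p where p: "real_polynomial_function p" "\<And>x. x \<in> {-1..1} \<Longrightarrow> \<bar>g x - p x\<bar> < e"
      using Stone_Weierstrass_real_polynomial_function
        [OF compact_Icc [of "-1" 1] continuous_on_subset [OF g(1) subset_UNIV] e] by blast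
    obtain a N where pa: "p = (\<lambda>x. \<Sum>i\<le>N::nat. a i * x ^ i)"
      using p(1) unfolding real_polynomial_function_iff_sum by blast
    have i: "integrable arc_measure (\<lambda>t. h t * cos t ^ i)" for i
      by (rule integrable_arc_mult [OF h])
        (auto intro!: borel_measurable_continuous_onI continuous_intros simp: power_abs power_le_one)
    have hp: "h t * p (cos t) = (\<Sum>i\<le>N. a i * (h t * cos t ^ i))" for t
      by (simp add: pa sum_distrib_left mult_ac)
    have "(\<integral>t. h t * p (cos t) \<partial>arc_measure) = (\<Sum>i\<le>N. a i * (\<integral>t. h t * cos t ^ i \<partial>arc_measure))"
      unfolding hp using i by simp
    also have "\<dots> = 0"
      using cosine_moments [OF h c, of _ 0] by simp
    finally have p0: "(\<integral>t. h t * p (cos t) \<partial>arc_measure) = 0" .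
    have pi: "integrable arc_measure (\<lambda>t. h t * p (cos t))"
      unfolding hp using i by simp
    have "\<bar>\<integral>t. h t * g (cos t) \<partial>arc_measure\<bar> = \<bar>\<integral>t. h t * g (cos t) - h t * p (cos t) \<partial>arc_measure\<bar>"
      using gi pi p0 by simp
    also have "\<dots> \<le> (\<integral>t. e * \<bar>h t\<bar> \<partial>arc_measure)"
    proof (rule order_trans [OF integral_abs_bound], rule integral_mono)
      fix t
      have "\<bar>g (cos t) - p (cos t)\<bar> \<le> e" using p(2) [of "cos t"] by simp
      then show "\<bar>h t * g (cos t) - h t * p (cos t)\<bar> \<le> e * \<bar>h t\<bar>"
        using mult_left_mono [OF _ abs_ge_zero [of "h t"], of "\<bar>g (cos t) - p (cos t)\<bar>" e]
        by (simp add: abs_mult mult.commute flip: right_diff_distrib)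
    qed (use gi pi h in auto)
    also have "\<dots> = e * B" by (simp add: B_def)
    finally show ?thesis .
  qed
  have "0 \<le> B" by (simp add: B_def)
  have "\<bar>\<integral>t. h t * g (cos t) \<partial>arc_measure\<bar> \<le> e" if "0 < e" for e
  proof -
    have "\<bar>\<integral>t. h t * g (cos t) \<partial>arc_measure\<bar> \<le> e / (B + 1) * B"
      by (rule le) (use \<open>0 \<le> B\<close> that in simp)
    also have "\<dots> \<le> e" using \<open>0 \<le> B\<close> that by (simp add: field_simps)
    finally show ?thesis .
  qed
  then show ?thesis using field_le_epsilon [of "\<bar>\<integral>t. h t * g (cos t) \<partial>arc_measure\<bar>" 0] by simp
qed

text \<open>The indicator of a closed set is the pointwise limit of continuous functions of the distance
to the set.\<close>

lemma closed_moments: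
  fixes h :: "real \<Rightarrow> real"
  assumes h: "integrable arc_measure h" and c: "\<And>n::nat. (\<integral>t. h t * cos (n * t) \<partial>arc_measure) = 0"
    and C: "closed C"
  shows "(\<integral>t. h t * indicator C (cos t) \<partial>arc_measure) = 0"
proof (cases "C = {}")
  case False
  define g where "g k x = max 0 (1 - real k * infdist x C)" for k x
  have g: "continuous_on UNIV (g k)" "\<bar>g k x\<bar> \<le> 1" for k x
  proof -
    show "continuous_on UNIV (g k)" unfolding g_def [abs_def] by (intro continuous_intros)
    have "0 \<le> real k * infdist x C" by (simp add: infdist_nonneg)
    then show "\<bar>g k x\<bar> \<le> 1" unfolding g_def by linarith
  qed
  have [measurable]: "h \<in> borel_measurable borel" "C \<in> sets borel"
    using h C by (auto simp: measurable_cong_sets [OF sets_arc refl] dest: borel_measurable_integrable)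
  have [measurable]: "(\<lambda>t. g k (cos t)) \<in> borel_measurable borel" for k
    by (intro borel_measurable_continuous_onI
        continuous_on_compose2 [OF g(1) continuous_on_cos [OF continuous_on_id]]) simp
  have "(\<lambda>k. \<integral>t. h t * g k (cos t) \<partial>arc_measure) \<longlonglongrightarrow> (\<integral>t. h t * indicator C (cos t) \<partial>arc_measure)"
  proof (rule integral_dominated_convergence [where w = "\<lambda>t. \<bar>h t\<bar>"])
    have "(\<lambda>k. g k x) \<longlonglongrightarrow> indicator C x" for x
    proof (cases "x \<in> C")
      case True
      then show ?thesis by (simp add: g_def)
    next
      case notin: False
      have pos: "0 < infdist x C" by (rule infdist_pos_not_in_closed [OF C False notin])
      obtain K where K: "1 < real K * infdist x C" using pos reals_Archimedean3 by blast
      have "g k x = 0" if "K \<le> k" for k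
      proof -
        have "real K * infdist x C \<le> real k * infdist x C" using that pos by simp
        then show ?thesis using K by (simp add: g_def)
      qed
      then have "\<forall>\<^sub>F k in sequentially. g k x = 0"
        by (auto simp: eventually_sequentially)
      then show ?thesis using notin by (simp add: tendsto_eventually)
    qed
    then show "AE t in arc_measure. (\<lambda>k. h t * g k (cos t)) \<longlonglongrightarrow> h t * indicator C (cos t)"
      by (intro AE_I2 tendsto_mult tendsto_const)
    show "AE t in arc_measure. norm (h t * g k (cos t)) \<le> \<bar>h t\<bar>" for k
      by (rule AE_I2) (simp add: abs_mult mult_left_le g)
  qed (use h in auto)
  then show ?thesis by (simp add: continuous_moments [OF h c g] LIMSEQ_const_iff)
qed simp

lemma cos_vimage: "A \<in> sets borel \<Longrightarrow> cos -` A \<in> sets borel" for A :: "real set"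
  using measurable_sets [of "cos :: real \<Rightarrow> real" borel borel A]
  by (simp add: borel_measurable_continuous_onI)

text \<open>The Borel sets with this property form a Dynkin system, and the closed sets are an
intersection-stable generator.\<close>

lemma borel_moments:
  fixes h :: "real \<Rightarrow> real"
  assumes h: "integrable arc_measure h" and c: "\<And>n::nat. (\<integral>t. h t * cos (n * t) \<partial>arc_measure) = 0"
    and A: "A \<in> sets borel"
  shows "(LINT t:cos -` A|arc_measure. h t) = 0"
proof -
  have "A \<in> sigma_sets UNIV (Collect closed)"
    using A by (simp add: borel_eq_closed)
  have cos: "cos -` A \<in> sets arc_measure" if "A \<in> sigma_sets UNIV (Collect closed)" for A :: "real set"
    using that cos_vimage [of A] by (simp add: borel_eq_closed)
  have si: "set_integrable arc_measure B h" if "B \<in> sets arc_measure" for B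
    unfolding set_integrable_def using integrable_mult_indicator [OF that h] .
  have all: "(LINT t:UNIV|arc_measure. h t) = 0"
    using c [of 0] by (simp add: set_lebesgue_integral_def)
  have "Int_stable (Collect closed :: real set set)" by (auto simp: Int_stable_def)
  moreover have "(Collect closed :: real set set) \<subseteq> Pow UNIV" by simp
  ultimately show ?thesis using \<open>A \<in> sigma_sets UNIV (Collect closed)\<close>
  proof (induction rule: sigma_sets_induct_disjoint)
    case (basic A)
    have "indicator (cos -` A) t = (indicator A (cos t) :: real)" for t :: real by (simp add: indicator_def)
    then show ?case
      using closed_moments [OF h c, of A] basic by (simp add: set_lebesgue_integral_def mult.commute)
  next
    case empty
    then show ?case by (simp add: set_lebesgue_integral_def)
  next
    case (compl A)
    have "(LINT t:cos -` A \<union> cos -` (UNIV - A)|arc_measure. h t)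
        = (LINT t:cos -` A|arc_measure. h t) + (LINT t:cos -` (UNIV - A)|arc_measure. h t)"
      using cos [OF compl(1)] by (intro set_integral_Un si) (auto simp: vimage_Diff)
    moreover have "cos -` A \<union> cos -` (UNIV - A) = UNIV" by auto
    ultimately show ?case using compl(2) all by simp
  next
    case (union A)
    have 1: "cos -` A i \<in> sets arc_measure" for i using union(2) by (intro cos) auto
    have "(LINT t:(\<Union>i. cos -` A i)|arc_measure. h t) = (\<Sum>i. (LINT t:cos -` A i|arc_measure. h t))"
      using 1 union(1) by (intro lebesgue_integral_countable_add si sets.countable_UN)
        (auto simp: disjoint_family_on_def)
    then show ?case by (simp add: union(3) vimage_UN)
  qed
qed

text \<open>Since \<open>cos\<close> is injective on \<open>[0, \<pi>]\<close>, every Borel subset of the interval is the preimage of a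
Borel set under \<open>cos\<close>. So \<open>borel_moments\<close> applies to the sets where \<open>h\<close> is positive and where it is
negative.\<close>

lemma cosine_uniqueness:
  fixes h :: "real \<Rightarrow> real"
  assumes h: "integrable arc_measure h" and c: "\<And>n::nat. (\<integral>t. h t * cos (n * t) \<partial>arc_measure) = 0"
  shows "AE t in arc_measure. h t = 0"
proof -
  have nonpos: "AE t in arc_measure. h t \<le> 0"
    if h: "integrable arc_measure h" and c: "\<And>n::nat. (\<integral>t. h t * cos (n * t) \<partial>arc_measure) = 0" for h
  proof -
    have [measurable]: "h \<in> borel_measurable borel"
      using h by (auto simp: measurable_cong_sets [OF sets_arc refl] dest: borel_measurable_integrable)
    define B where "B = {t. 0 < h t}"
    have [measurable]: "B \<in> sets borel" unfolding B_def by measurable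
    define A where "A = arccos_clamp -` B"
    have A: "A \<in> sets borel"
      unfolding A_def using measurable_sets [OF borel_measurable_arccos_clamp, of B] by simp
    have hB: "integrable arc_measure (\<lambda>t. indicator B t *\<^sub>R h t)"
      by (rule integrable_mult_indicator [OF _ h]) simp
    have ae: "AE t in arc_measure. indicator (cos -` A) t *\<^sub>R h t = indicator B t *\<^sub>R h t"
      using AE_arc_interior by eventually_elim (auto simp: A_def indicator_def arccos_clamp_cos)
    have "cos -` A \<in> sets arc_measure"
      using cos_vimage [OF A] by simp
    then have m: "(\<lambda>t. indicator (cos -` A) t *\<^sub>R h t) \<in> borel_measurable arc_measure"
      by (intro borel_measurable_integrable integrable_mult_indicator h)
    have "(\<integral>t. indicator B t *\<^sub>R h t \<partial>arc_measure) = (LINT t:cos -` A|arc_measure. h t)"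
      unfolding set_lebesgue_integral_def
      by (rule integral_cong_AE [symmetric]) (use ae m hB in auto)
    also have "\<dots> = 0" by (rule borel_moments [OF h c A])
    finally have "AE t in arc_measure. indicator B t *\<^sub>R h t = 0"
      using integral_nonneg_eq_0_iff_AE [OF hB] by (auto simp: B_def indicator_def)
    then show ?thesis by eventually_elim (auto simp: B_def indicator_def split: if_splits)
  qed
  have "AE t in arc_measure. - h t \<le> 0"
    by (rule nonpos) (use h c in auto)
  with nonpos [OF h c] show ?thesis by eventually_elim simp
qed

text \<open>By \<open>2 * sin t * cos (n * t) = sin ((n + 1) * t) - sin ((n - 1) * t)\<close> the function \<open>h t * sin t\<close> is
orthogonal to all cosines, and \<open>sin\<close> has no zero inside the interval.\<close>

lemma sine_uniqueness:
  fixes h :: "real \<Rightarrow> real"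
  assumes h: "integrable arc_measure h" and s: "\<And>n::nat. (\<integral>t. h t * sin (n * t) \<partial>arc_measure) = 0"
  shows "AE t in arc_measure. h t = 0"
proof -
  have i: "integrable arc_measure (\<lambda>t. h t * sin (real n * t))" for n
    by (rule integrable_arc_mult [OF h]) (auto intro!: borel_measurable_continuous_onI continuous_intros)
  have "(\<integral>t. (h t * sin t) * cos (real n * t) \<partial>arc_measure) = 0" for n
  proof (cases n)
    case 0
    then show ?thesis using s [of 1] by simp
  next
    case (Suc k)
    have "sin t * cos (real n * t) = (sin (real (Suc n) * t) - sin (real k * t)) / 2" for t
      unfolding sin_times_cos using sin_minus [of "t - real n * t"]
      by (simp add: Suc algebra_simps)
    then have e: "(h t * sin t) * cos (real n * t)
        = (h t * sin (real (Suc n) * t) - h t * sin (real k * t)) / 2" for t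
      by (simp only: mult.assoc) (simp add: right_diff_distrib)
    show ?thesis unfolding e using i [of "Suc n"] i [of k] s [of "Suc n"] s [of k]
      by (simp del: of_nat_Suc)
  qed
  then have "AE t in arc_measure. h t * sin t = 0"
    using i [of 1] by (intro cosine_uniqueness) auto
  with AE_arc_interior show ?thesis
  proof eventually_elim
    case (elim t)
    then have "0 < sin t" by (intro sin_gt_zero) auto
    then show ?case using elim by simp
  qed
qed


section \<open>Fourier coefficients of biquaternion-valued functions\<close>

lemma rot_sel: "fst (rot t F) = cos t *\<^sub>R fst F - sin t *\<^sub>R snd F"
  "snd (rot t F) = sin t *\<^sub>R fst F + cos t *\<^sub>R snd F"
  by (simp_all add: rot_def)

lemma borel_measurable_rot [measurable (raw)]:
  assumes "g \<in> borel_measurable M" "F \<in> borel_measurable M"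
  shows "(\<lambda>x. rot (g x) (F x)) \<in> borel_measurable M"
proof (rule borel_measurable_continuous_Pair [OF assms])
  show "continuous_on UNIV (\<lambda>p. rot (fst p) (snd p))"
    unfolding rot_def by (intro continuous_intros)
qed

lemma borel_measurable_bmul [measurable (raw)]:
  assumes "F \<in> borel_measurable M" "G \<in> borel_measurable M"
  shows "(\<lambda>x. F x \<odot> G x) \<in> borel_measurable M"
  by (rule borel_measurable_continuous_Pair [OF assms])
    (intro bounded_bilinear.continuous_on [OF bounded_bilinear_bmul] continuous_on_fst continuous_on_snd continuous_on_id)

lemma borel_measurable_badj [measurable (raw)]:
  assumes "F \<in> borel_measurable M" shows "(\<lambda>x. badj (F x)) \<in> borel_measurable M"
  using borel_measurable_continuous_onI [OF linear_continuous_on [OF bounded_linear_badj]] assms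
  by (rule measurable_compose [rotated])

lemma integrable_rot:
  assumes "integrable M F" "g \<in> borel_measurable M"
  shows "integrable M (\<lambda>x. rot (g x) (F x))"
  by (rule Bochner_Integration.integrable_bound [OF assms(1)])
    (use assms in \<open>auto intro!: borel_measurable_rot borel_measurable_integrable\<close>)

text \<open>For \<open>F = \<alpha> + \<iota> \<beta>\<close> this is the mean of \<open>cos (n * t) * \<alpha> t + sin (n * t) * \<beta> t\<close>. Taking the first
component makes up for the missing lower half of the circle: there the biquaternion function of
a slice function continues with even first and odd second component.\<close>

definition coef :: "int \<Rightarrow> (real \<Rightarrow> biquat) \<Rightarrow> quat"
  where "coef n F = (\<integral>t. fst (rot (- (of_int n * t)) (F t)) \<partial>arc_measure)"

text \<open>The biquaternion function of \<open>q\<^sup>n a\<close>.\<close>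

definition monomial :: "int \<Rightarrow> quat \<Rightarrow> real \<Rightarrow> biquat"
  where "monomial n a t = rot (of_int n * t) (a, 0)"

lemma measurable_arc [measurable]: "(\<lambda>t. c * t) \<in> borel_measurable arc_measure"
  by (simp add: measurable_cong_sets [OF sets_arc refl])

lemma integrable_coef:
  assumes "integrable arc_measure F"
  shows "integrable arc_measure (\<lambda>t. fst (rot (- (of_int n * t)) (F t)))"
  by (intro integrable_bounded_linear [OF bounded_linear_fst] integrable_rot assms) measurable

lemma coef_cong_AE:
  assumes "AE t in arc_measure. F t = G t" "F \<in> borel_measurable arc_measure" "G \<in> borel_measurable arc_measure"
  shows "coef n F = coef n G"
  unfolding coef_def
proof (rule integral_cong_AE)
  have m: "(\<lambda>t. fst (rot (- (real_of_int n * t)) (F t))) \<in> borel_measurable arc_measure"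
    if "F \<in> borel_measurable arc_measure" for F
    using measurable_compose [OF borel_measurable_rot [OF _ that] borel_measurable_continuous_onI [OF linear_continuous_on [OF bounded_linear_fst]]]
    by measurable
  show "(\<lambda>t. fst (rot (- (real_of_int n * t)) (F t))) \<in> borel_measurable arc_measure"
    "(\<lambda>t. fst (rot (- (real_of_int n * t)) (G t))) \<in> borel_measurable arc_measure"
    using assms by (simp_all add: m)
  show "AE t in arc_measure. fst (rot (- (real_of_int n * t)) (F t)) = fst (rot (- (real_of_int n * t)) (G t))"
    using assms(1) by eventually_elim simp
qed

lemma coef_add:
  "integrable arc_measure F \<Longrightarrow> integrable arc_measure G \<Longrightarrow> coef n (\<lambda>t. F t + G t) = coef n F + coef n G"
  by (simp add: coef_def integrable_coef)

lemma coef_diff: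
  "integrable arc_measure F \<Longrightarrow> integrable arc_measure G \<Longrightarrow> coef n (\<lambda>t. F t - G t) = coef n F - coef n G"
  by (simp add: coef_def integrable_coef)

lemma coef_zero [simp]: "coef n (\<lambda>t. 0) = 0"
  by (simp add: coef_def)

lemma coef_sum:
  assumes "\<And>i. i \<in> A \<Longrightarrow> integrable arc_measure (F i)"
  shows "coef n (\<lambda>t. \<Sum>i\<in>A. F i t) = (\<Sum>i\<in>A. coef n (F i))"
  using assms
  by (induction A rule: infinite_finite_induct) (simp_all add: coef_add)

lemma coef_rot: "coef n (\<lambda>t. rot (of_int m * t) (F t)) = coef (n - m) F"
  by (simp add: coef_def algebra_simps)

lemma coef_bmul_quat:
  assumes "integrable arc_measure F" shows "coef n (\<lambda>t. F t \<odot> (c, 0)) = coef n F * c"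
proof -
  have "fst (rot s (X \<odot> (c, 0))) = fst (rot s X) * c" for s X
    by (simp add: rot_sel bmul_quat algebra_simps)
  then show ?thesis using integrable_coef [OF assms, of n] by (simp add: coef_def)
qed

lemma coef_badj:
  assumes "integrable arc_measure F" shows "coef n (\<lambda>t. badj (F t)) = qcnj (coef (- n) F)"
proof -
  have "fst (rot (- (real_of_int n * t)) (badj (F t))) = qcnj (fst (rot (- (real_of_int (- n) * t)) (F t)))" for t
  proof -
    have "fst (rot (- (real_of_int n * t)) (badj (F t))) = fst (badj (rot (real_of_int n * t) (F t)))"
      by (simp add: badj_rot)
    also have "\<dots> = qcnj (fst (rot (real_of_int n * t) (F t)))" by (simp only: badj_def fst_conv)
    finally show ?thesis by simp
  qed
  then show ?thesis
    using integrable_coef [OF assms, of "- n"]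
    by (simp add: coef_def integral_bounded_linear [OF bounded_linear_qcnj])
qed

lemma coef_const: "coef n (\<lambda>t. (c, 0)) = (if n = 0 then c else 0)"
proof -
  have "integrable arc_measure (\<lambda>t. 1 * cos (of_int n * t))"
    by (rule integrable_arc_mult) (auto intro!: borel_measurable_continuous_onI continuous_intros)
  then have "(\<integral>t. cos (of_int n * t) *\<^sub>R c \<partial>arc_measure) = (if n = 0 then 1 else 0) *\<^sub>R c"
    unfolding integral_cos_arc [symmetric] by (intro integral_scaleR_left) simp
  then show ?thesis by (simp add: coef_def rot_sel)
qed

lemma norm_monomial [simp]: "norm (monomial n a t) = norm a"
  by (simp add: monomial_def norm_Pair)

lemma square_integrable_monomial [simp]: "square_integrable arc_measure (monomial n a)"
proof -
  have "monomial n a \<in> borel_measurable arc_measure"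
    unfolding monomial_def [abs_def] by measurable
  then show ?thesis by (simp add: square_integrable_def)
qed

lemma integrable_monomial [simp]: "integrable arc_measure (monomial n a)"
  by (rule arc.square_integrable_integrable) simp

lemma coef_monomial: "coef m (monomial n a) = (if m = n then a else 0)"
  unfolding monomial_def [abs_def] by (simp add: coef_rot coef_const)

lemma l2_inner_monomial:
  assumes "square_integrable arc_measure F"
  shows "l2_inner arc_measure F (monomial n a) = inner (coef n F) a"
proof -
  have "inner (F t) (monomial n a t) = inner (fst (rot (- (of_int n * t)) (F t))) a" for t
    by (cases "F t") (simp add: monomial_def rot_def inner_add_left)
  then show ?thesis
    using integrable_coef [OF arc.square_integrable_integrable [OF assms]]
    by (simp add: l2_inner_def coef_def)
qed

lemma sqnorm_monomial [simp]: "sqnorm arc_measure (monomial n a) = (norm a)\<^sup>2"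
  using arc.prob_space by (simp add: sqnorm_def)

lemma norm_coef_le:
  assumes F: "square_integrable arc_measure F"
  shows "(norm (coef n F))\<^sup>2 \<le> sqnorm arc_measure F"
proof -
  have "0 \<le> sqnorm arc_measure (\<lambda>t. F t + (-1) *\<^sub>R monomial n (coef n F) t)" by simp
  also have "\<dots> = sqnorm arc_measure F - (norm (coef n F))\<^sup>2"
    by (subst sqnorm_add_scaleR) (simp_all add: F l2_inner_monomial power2_norm_eq_inner)
  finally show ?thesis by simp
qed

lemma coef_tendsto:
  assumes "\<And>N. square_integrable arc_measure (F N)" "square_integrable arc_measure G"
    and lim: "(\<lambda>N. sqnorm arc_measure (\<lambda>t. F N t - G t)) \<longlonglongrightarrow> 0"
  shows "(\<lambda>N. coef n (F N)) \<longlonglongrightarrow> coef n G"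
proof -
  have "(norm (coef n (F N) - coef n G))\<^sup>2 \<le> sqnorm arc_measure (\<lambda>t. F N t - G t)" for N
    using norm_coef_le [OF square_integrable_diff [OF assms(1) [of N] assms(2)], of n] assms(1,2)
    by (simp add: coef_diff arc.square_integrable_integrable)
  then have "(\<lambda>N. norm (coef n (F N) - coef n G)) \<longlonglongrightarrow> 0"
    by (rule tendsto_zero_of_power2_le [OF lim])
  then show ?thesis by (simp add: LIM_zero_iff tendsto_norm_zero_iff)
qed

lemma AE_eq_zero_componentwise:
  fixes f :: "'a \<Rightarrow> 'b::euclidean_space"
  assumes "\<And>b. b \<in> Basis \<Longrightarrow> AE t in M. inner (f t) b = 0"
  shows "AE t in M. f t = 0"
proof -
  have "AE t in M. \<forall>b\<in>Basis. inner (f t) b = 0"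
    by (rule AE_finite_allI) (use assms in auto)
  then show ?thesis by eventually_elim (simp add: euclidean_all_zero_iff)
qed

text \<open>The coefficients at \<open>n\<close> and \<open>-n\<close> separate the cosine coefficient of the first component from
the sine coefficient of the second one.\<close>

lemma coef_uniqueness:
  assumes F: "integrable arc_measure F" and 0: "\<And>n. coef n F = 0"
  shows "AE t in arc_measure. F t = 0"
proof -
  have i: "integrable arc_measure (\<lambda>t. fst (F t))" "integrable arc_measure (\<lambda>t. snd (F t))"
    by (intro integrable_bounded_linear [OF bounded_linear_fst] integrable_bounded_linear [OF bounded_linear_snd] F)+
  have c: "integrable arc_measure (\<lambda>t. cos (of_int n * t) *\<^sub>R fst (F t))"
    "integrable arc_measure (\<lambda>t. sin (of_int n * t) *\<^sub>R snd (F t))" for n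
  proof -
    have "integrable arc_measure (\<lambda>t. (1/2) *\<^sub>R (fst (rot (- (of_int n * t)) (F t)) + fst (rot (- (of_int (- n) * t)) (F t))))"
      by (intro integrable_scaleR_right Bochner_Integration.integrable_add integrable_coef F)
    then show "integrable arc_measure (\<lambda>t. cos (of_int n * t) *\<^sub>R fst (F t))"
      by (simp add: rot_sel flip: scaleR_add_left)
    have "integrable arc_measure (\<lambda>t. (1/2) *\<^sub>R (fst (rot (- (of_int n * t)) (F t)) - fst (rot (- (of_int (- n) * t)) (F t))))"
      by (intro integrable_scaleR_right Bochner_Integration.integrable_diff integrable_coef F)
    then show "integrable arc_measure (\<lambda>t. sin (of_int n * t) *\<^sub>R snd (F t))"
      by (simp add: rot_sel flip: scaleR_add_left)
  qed
  define C where "C n = (\<integral>t. cos (of_int n * t) *\<^sub>R fst (F t) \<partial>arc_measure)" for n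
  define S where "S n = (\<integral>t. sin (of_int n * t) *\<^sub>R snd (F t) \<partial>arc_measure)" for n
  have "C n + S n = 0" "C n - S n = 0" for n
    using 0 [of n] 0 [of "- n"] c [of n] by (simp_all add: coef_def rot_sel C_def S_def)
  then have "2 *\<^sub>R C n = 0" "2 *\<^sub>R S n = 0" for n
    by (metis (no_types) add_diff_cancel_left' diff_add_cancel diff_zero add.commute scaleR_2 add_0)+
  then have CS: "C n = 0" "S n = 0" for n by simp_all
  have "AE t in arc_measure. inner (fst (F t)) b = 0" if "b \<in> Basis" for b
  proof (rule cosine_uniqueness)
    show "(\<integral>t. inner (fst (F t)) b * cos (real n * t) \<partial>arc_measure) = 0" for n
      using CS(1) [of "int n"] c(1) [of "int n"] integral_inner_left [of b arc_measure "\<lambda>t. cos (of_int (int n) * t) *\<^sub>R fst (F t)"]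
      by (simp add: C_def mult.commute)
  qed (use i in simp)
  then have 1: "AE t in arc_measure. fst (F t) = 0" by (rule AE_eq_zero_componentwise)
  have "AE t in arc_measure. inner (snd (F t)) b = 0" if "b \<in> Basis" for b
  proof (rule sine_uniqueness)
    show "(\<integral>t. inner (snd (F t)) b * sin (real n * t) \<partial>arc_measure) = 0" for n
      using CS(2) [of "int n"] c(2) [of "int n"] integral_inner_left [of b arc_measure "\<lambda>t. sin (of_int (int n) * t) *\<^sub>R snd (F t)"]
      by (simp add: S_def mult.commute)
  qed (use i in simp)
  then have "AE t in arc_measure. snd (F t) = 0" by (rule AE_eq_zero_componentwise)
  with 1 show ?thesis by eventually_elim (simp add: prod_eq_iff)
qed

lemma coef_eq_AE:
  assumes "integrable arc_measure F" "integrable arc_measure G" "\<And>n. coef n F = coef n G"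
  shows "AE t in arc_measure. F t = G t"
proof -
  have "AE t in arc_measure. F t - G t = 0"
    by (rule coef_uniqueness) (simp_all add: assms coef_diff)
  then show ?thesis by simp
qed


definition fsum :: "int set \<Rightarrow> (int \<Rightarrow> quat) \<Rightarrow> real \<Rightarrow> biquat"
  where "fsum A a t = (\<Sum>n\<in>A. monomial n (a n) t)"

lemma square_integrable_fsum [simp]: "square_integrable arc_measure (fsum A a)"
  unfolding fsum_def [abs_def] by (intro square_integrable_sum) simp

lemma coef_fsum:
  assumes "finite A" shows "coef m (fsum A a) = (if m \<in> A then a m else 0)"
  unfolding fsum_def [abs_def] using assms by (subst coef_sum) (simp_all add: coef_monomial)

lemma l2_inner_fsum:
  assumes "square_integrable arc_measure F"
  shows "l2_inner arc_measure F (fsum A a) = (\<Sum>n\<in>A. inner (coef n F) (a n))"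
  unfolding fsum_def [abs_def] by (simp add: l2_inner_sum_right assms l2_inner_monomial)

lemma sqnorm_fsum:
  assumes "finite A" shows "sqnorm arc_measure (fsum A a) = (\<Sum>n\<in>A. (norm (a n))\<^sup>2)"
  using assms by (simp add: sqnorm_eq_l2_inner l2_inner_fsum coef_fsum power2_norm_eq_inner)

lemma Bessel:
  assumes F: "square_integrable arc_measure F" and A: "finite A"
  shows "(\<Sum>n\<in>A. (norm (coef n F))\<^sup>2) \<le> sqnorm arc_measure F"
proof -
  have "0 \<le> sqnorm arc_measure (\<lambda>t. F t + (-1) *\<^sub>R fsum A (\<lambda>n. coef n F) t)" by simp
  also have "\<dots> = sqnorm arc_measure F - (\<Sum>n\<in>A. (norm (coef n F))\<^sup>2)"
    by (subst sqnorm_add_scaleR) (simp_all add: F A l2_inner_fsum sqnorm_fsum power2_norm_eq_inner)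
  finally show ?thesis by simp
qed

text \<open>The index set of the symmetric partial sums in \<open>has_series\<close>.\<close>

definition sym_interval :: "nat \<Rightarrow> int set"
  where "sym_interval N = {- int N..int N}"

lemma finite_sym_interval [simp]: "finite (sym_interval N)"
  by (simp add: sym_interval_def)

lemma filterlim_sym_interval: "filterlim sym_interval (finite_subsets_at_top UNIV) sequentially"
  unfolding filterlim_iff eventually_finite_subsets_at_top
proof safe
  fix P :: "int set \<Rightarrow> bool" and X :: "int set"
  assume X: "finite X" "\<forall>Y. finite Y \<and> X \<subseteq> Y \<and> Y \<subseteq> UNIV \<longrightarrow> P Y"
  define N where "N = (\<Sum>x\<in>X. nat \<bar>x\<bar>)"
  have "X \<subseteq> sym_interval n" if "N \<le> n" for n
  proof
    fix x assume "x \<in> X"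
    then have "nat \<bar>x\<bar> \<le> N" unfolding N_def using X(1) by (intro member_le_sum) auto
    then show "x \<in> sym_interval n" using that unfolding sym_interval_def by auto
  qed
  then have "P (sym_interval n)" if "N \<le> n" for n
    using X(2) that by (simp add: sym_interval_def)
  then show "\<forall>\<^sub>F n in sequentially. P (sym_interval n)"
    by (rule eventually_sequentiallyI)
qed

lemma coef_fsum_tendsto: "(\<lambda>N. coef n (fsum (sym_interval N) a)) \<longlonglongrightarrow> a n"
proof (rule tendsto_eventually)
  have "\<forall>\<^sub>F N in sequentially. n \<in> sym_interval N"
    unfolding eventually_sequentially by (rule exI [of _ "nat \<bar>n\<bar>"]) (auto simp: sym_interval_def)
  then show "\<forall>\<^sub>F N in sequentially. coef n (fsum (sym_interval N) a) = a n"
    by eventually_elim (simp add: coef_fsum)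
qed

lemma has_sum_sym_interval:
  "(f has_sum s) UNIV \<Longrightarrow> (\<lambda>N. \<Sum>n\<in>sym_interval N. f n) \<longlonglongrightarrow> s"
  unfolding has_sum_def by (rule filterlim_compose [OF _ filterlim_sym_interval])

text \<open>The symmetric partial sums form a Cauchy sequence, with rate the tail of the sum of
\<open>|a n|\<^sup>2\<close>.\<close>

lemma Riesz_Fischer:
  assumes a: "(\<lambda>n. (norm (a n))\<^sup>2) summable_on UNIV"
  obtains F where "square_integrable arc_measure F" "\<And>n. coef n F = a n"
    "(\<lambda>N. sqnorm arc_measure (\<lambda>t. fsum (sym_interval N) a t - F t)) \<longlonglongrightarrow> 0"
proof -
  define s where "s = (\<Sum>\<^sub>\<infinity>n. (norm (a n))\<^sup>2)"
  define e where "e N = s - (\<Sum>n\<in>sym_interval N. (norm (a n))\<^sup>2)" for N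
  have hs: "((\<lambda>n. (norm (a n))\<^sup>2) has_sum s) UNIV"
    unfolding s_def by (rule has_sum_infsum [OF a])
  have "e \<longlonglongrightarrow> s - s" unfolding e_def [abs_def]
    by (intro tendsto_diff tendsto_const has_sum_sym_interval hs)
  then have e: "e \<longlonglongrightarrow> 0" by simp
  have le: "sqnorm arc_measure (\<lambda>t. fsum (sym_interval N) a t - fsum (sym_interval M) a t) \<le> e M" if "M \<le> N" for M N
  proof -
    have sub: "sym_interval M \<subseteq> sym_interval N" using that by (auto simp: sym_interval_def)
    have "(\<lambda>t. fsum (sym_interval N) a t - fsum (sym_interval M) a t) = fsum (sym_interval N - sym_interval M) a"
      by (simp add: fun_eq_iff fsum_def sum_diff sub)
    then have "sqnorm arc_measure (\<lambda>t. fsum (sym_interval N) a t - fsum (sym_interval M) a t)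
        = (\<Sum>n\<in>sym_interval N. (norm (a n))\<^sup>2) - (\<Sum>n\<in>sym_interval M. (norm (a n))\<^sup>2)"
      by (simp add: sqnorm_fsum sum_diff sub)
    also have "(\<Sum>n\<in>sym_interval N. (norm (a n))\<^sup>2) \<le> s"
      unfolding s_def by (rule finite_sum_le_infsum [OF a]) auto
    finally show ?thesis by (simp add: e_def)
  qed
  obtain F where F: "square_integrable arc_measure F"
    "(\<lambda>N. sqnorm arc_measure (\<lambda>t. fsum (sym_interval N) a t - F t)) \<longlonglongrightarrow> 0"
    by (rule arc.l2_complete [OF square_integrable_fsum e le])
  have "coef n F = a n" for n
  proof (rule LIMSEQ_unique)
    show "(\<lambda>N. coef n (fsum (sym_interval N) a)) \<longlonglongrightarrow> coef n F"
      by (rule coef_tendsto [OF _ F]) simp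
    show "(\<lambda>N. coef n (fsum (sym_interval N) a)) \<longlonglongrightarrow> a n" by (rule coef_fsum_tendsto)
  qed
  with F show ?thesis using that by blast
qed

text \<open>By Bessel's inequality and the theorem of Riesz and Fischer, the series converges to some
function with the same coefficients, which is \<open>F\<close> by uniqueness.\<close>

lemma Fourier_series:
  assumes F: "square_integrable arc_measure F"
  shows "(\<lambda>n. (norm (coef n F))\<^sup>2) summable_on UNIV"
    "(\<lambda>N. sqnorm arc_measure (\<lambda>t. fsum (sym_interval N) (\<lambda>n. coef n F) t - F t)) \<longlonglongrightarrow> 0"
proof -
  show *: "(\<lambda>n. (norm (coef n F))\<^sup>2) summable_on UNIV"
  proof (rule nonneg_bdd_above_summable_on)
    show "bdd_above (sum (\<lambda>n. (norm (coef n F))\<^sup>2) ` {A. A \<subseteq> UNIV \<and> finite A})"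
      using Bessel [OF F] by (intro bdd_aboveI2) auto
  qed simp
  obtain G where G: "square_integrable arc_measure G" "\<And>n. coef n G = coef n F"
    "(\<lambda>N. sqnorm arc_measure (\<lambda>t. fsum (sym_interval N) (\<lambda>n. coef n F) t - G t)) \<longlonglongrightarrow> 0"
    by (rule Riesz_Fischer [OF *]) blast
  have ae: "AE t in arc_measure. G t = F t"
    by (rule coef_eq_AE) (simp_all add: G F arc.square_integrable_integrable)
  have "sqnorm arc_measure (\<lambda>t. fsum A a t - G t) = sqnorm arc_measure (\<lambda>t. fsum A a t - F t)" for A a
    unfolding sqnorm_def
  proof (rule integral_cong_AE)
    show "AE t in arc_measure. (norm (fsum A a t - G t))\<^sup>2 = (norm (fsum A a t - F t))\<^sup>2"
      using ae by eventually_elim simp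
  qed (use square_integrableD [OF square_integrable_diff [OF square_integrable_fsum G(1)]]
      square_integrableD [OF square_integrable_diff [OF square_integrable_fsum F]] in measurable)
  then show "(\<lambda>N. sqnorm arc_measure (\<lambda>t. fsum (sym_interval N) (\<lambda>n. coef n F) t - F t)) \<longlonglongrightarrow> 0"
    using G(3) by simp
qed

lemma integrable_bmul:
  "square_integrable arc_measure F \<Longrightarrow> square_integrable arc_measure G \<Longrightarrow>
    integrable arc_measure (\<lambda>t. F t \<odot> G t)"
  by (rule integrable_bilinear [OF bounded_bilinear_bmul])

lemma coef_bmul_monomial:
  assumes "integrable arc_measure F"
  shows "coef n (\<lambda>t. F t \<odot> monomial m b t) = coef (n - m) F * b"
  by (simp add: monomial_def bmul_rot coef_rot coef_bmul_quat assms)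

text \<open>Both sides are continuous in \<open>G\<close>: for a monomial \<open>G\<close> the identity is \<open>coef_bmul_monomial\<close>, and
\<open>G\<close> is the limit of its partial sums.\<close>

lemma convolution:
  assumes F: "square_integrable arc_measure F" and G: "square_integrable arc_measure G"
  shows "coef n (\<lambda>t. F t \<odot> G t) = (\<Sum>\<^sub>\<infinity>k. coef k F * coef (n - k) G)"
proof -
  define f where "f m = coef (n - m) F * coef m G" for m
  define S where "S N = fsum (sym_interval N) (\<lambda>m. coef m G)" for N
  have S: "square_integrable arc_measure (S N)" for N by (simp add: S_def)
  have cS: "coef n (\<lambda>t. F t \<odot> S N t) = (\<Sum>m\<in>sym_interval N. f m)" for N
  proof -
    have "F t \<odot> S N t = (\<Sum>m\<in>sym_interval N. F t \<odot> monomial m (coef m G) t)" for t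
      by (simp add: S_def fsum_def bounded_bilinear.sum_right [OF bounded_bilinear_bmul])
    then show ?thesis
      by (simp add: coef_sum integrable_bmul F coef_bmul_monomial arc.square_integrable_integrable f_def)
  qed
  have 1: "(\<lambda>N. coef n (\<lambda>t. F t \<odot> S N t)) \<longlonglongrightarrow> coef n (\<lambda>t. F t \<odot> G t)"
  proof -
    obtain K where K: "0 \<le> K" "\<And>a b. norm (a \<odot> b) \<le> norm a * norm b * K"
      using bounded_bilinear.nonneg_bounded [OF bounded_bilinear_bmul] by blast
    define D where "D N t = S N t - G t" for N t
    have D: "square_integrable arc_measure (D N)" for N
      unfolding D_def by (intro square_integrable_diff S G)
    have "(\<lambda>N. sqnorm arc_measure (D N)) \<longlonglongrightarrow> 0"
      unfolding D_def [abs_def] S_def by (rule Fourier_series(2) [OF G])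
    then have "(\<lambda>N. \<integral>t. norm (F t) * norm (D N t) \<partial>arc_measure) \<longlonglongrightarrow> 0"
      by (rule tendsto_integral_norm_mult [OF F D])
    then have lim: "(\<lambda>N. K * (\<integral>t. norm (F t) * norm (D N t) \<partial>arc_measure)) \<longlonglongrightarrow> 0"
      by (rule tendsto_mult_right_zero)
    have le: "norm (coef n (\<lambda>t. F t \<odot> S N t) - coef n (\<lambda>t. F t \<odot> G t))
        \<le> K * (\<integral>t. norm (F t) * norm (D N t) \<partial>arc_measure)" for N
    proof -
      have "coef n (\<lambda>t. F t \<odot> S N t) - coef n (\<lambda>t. F t \<odot> G t) = coef n (\<lambda>t. F t \<odot> D N t)"
        by (simp add: coef_diff [symmetric] integrable_bmul F S G D_def bounded_bilinear.diff_right [OF bounded_bilinear_bmul])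
      also have "norm \<dots> \<le> (\<integral>t. norm (fst (rot (- (of_int n * t)) (F t \<odot> D N t))) \<partial>arc_measure)"
        unfolding coef_def by (rule integral_norm_bound)
      also have "\<dots> \<le> (\<integral>t. K * (norm (F t) * norm (D N t)) \<partial>arc_measure)"
      proof (rule integral_mono)
        fix t
        have "norm (fst (rot (- (of_int n * t)) (F t \<odot> D N t))) \<le> norm (rot (- (of_int n * t)) (F t \<odot> D N t))"
          using norm_fst_le [of "fst (rot (- (of_int n * t)) (F t \<odot> D N t))"] by (metis prod.collapse)
        also have "\<dots> \<le> K * (norm (F t) * norm (D N t))"
          using K(2) [of "F t" "D N t"] by (simp add: mult.commute)
        finally show "norm (fst (rot (- (of_int n * t)) (F t \<odot> D N t))) \<le> K * (norm (F t) * norm (D N t))" .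
      qed (intro integrable_norm integrable_coef integrable_bmul F D integrable_mult_right integrable_norm_mult)+
      finally show ?thesis by simp
    qed
    have "(\<lambda>N. norm (coef n (\<lambda>t. F t \<odot> S N t) - coef n (\<lambda>t. F t \<odot> G t))) \<longlonglongrightarrow> 0"
      by (rule tendsto_sandwich [OF _ _ tendsto_const lim]) (use le in auto)
    then show ?thesis by (simp add: LIM_zero_iff tendsto_norm_zero_iff)
  qed
  have "f summable_on UNIV"
  proof (rule abs_summable_summable)
    have r: "(\<lambda>m. (norm (coef (n - m) F))\<^sup>2) summable_on UNIV"
    proof -
      have "bij_betw (\<lambda>m. n - m) UNIV UNIV" by (rule bij_betw_byWitness [where f' = "\<lambda>m. n - m"]) auto
      from summable_on_reindex_bij_betw [OF this, of "\<lambda>m. (norm (coef m F))\<^sup>2"] show ?thesis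
        using Fourier_series(1) [OF F] by simp
    qed
    show "(\<lambda>m. norm (f m)) summable_on UNIV"
    proof (rule summable_on_comparison_test)
      show "(\<lambda>m. (norm (coef (n - m) F))\<^sup>2 + (norm (coef m G))\<^sup>2) summable_on UNIV"
        by (intro summable_on_add r Fourier_series G)
      fix m
      have "norm (coef (n - m) F) * norm (coef m G) \<le> 2 * norm (coef (n - m) F) * norm (coef m G)" by simp
      also have "\<dots> \<le> (norm (coef (n - m) F))\<^sup>2 + (norm (coef m G))\<^sup>2" by (rule sum_squares_bound)
      finally show "norm (f m) \<le> (norm (coef (n - m) F))\<^sup>2 + (norm (coef m G))\<^sup>2"
        by (simp add: f_def norm_mult)
    qed simp
  qed
  then have "(\<lambda>N. \<Sum>m\<in>sym_interval N. f m) \<longlonglongrightarrow> (\<Sum>\<^sub>\<infinity>m. f m)"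
    by (intro has_sum_sym_interval has_sum_infsum)
  with 1 have "coef n (\<lambda>t. F t \<odot> G t) = (\<Sum>\<^sub>\<infinity>m. f m)"
    unfolding cS by (rule LIMSEQ_unique)
  also have "\<dots> = (\<Sum>\<^sub>\<infinity>k. f (n - k))"
    by (rule infsum_reindex_bij_betw [symmetric], rule bij_betw_byWitness [where f' = "\<lambda>m. n - m"]) auto
  finally show ?thesis by (simp add: f_def)
qed


section \<open>Slice functions as biquaternion-valued functions\<close>

lemma imag_mult_self: "I \<in> \<S> \<Longrightarrow> I * I = -1"
  by (simp add: imag_sphere_def power2_eq_square)

lemma imag_mult_cancel: "I \<in> \<S> \<Longrightarrow> I * (I * q) = - q"
  by (simp add: imag_mult_self flip: mult.assoc)

lemma norm_imag: "I \<in> \<S> \<Longrightarrow> norm I = 1"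
  by (simp add: imag_sphere_iff norm_quat_def)

lemma expI_mult: "I \<in> \<S> \<Longrightarrow> expI s I * expI t I = expI (s + t) I"
  by (simp add: expI_def algebra_simps sin_add cos_add imag_mult_self)

lemma norm_expI: "I \<in> \<S> \<Longrightarrow> norm (expI t I) = 1"
proof -
  assume I: "I \<in> \<S>"
  have "(cos t)\<^sup>2 + ((sin t * qi I)\<^sup>2 + (sin t * qj I)\<^sup>2 + (sin t * qk I)\<^sup>2)
      = (cos t)\<^sup>2 + (sin t)\<^sup>2 * ((qi I)\<^sup>2 + (qj I)\<^sup>2 + (qk I)\<^sup>2)"
    by (simp add: power_mult_distrib algebra_simps)
  also have "\<dots> = 1" using I by (simp add: imag_sphere_iff)
  finally show ?thesis using I by (simp add: norm_quat_def expI_def imag_sphere_iff algebra_simps)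
qed

lemma expI_in_bdry: "I \<in> \<S> \<Longrightarrow> expI t I \<in> \<partial>\<B>"
  by (auto simp: bdry_ball_def)

lemma expI_powi: assumes I: "I \<in> \<S>" shows "expI t I powi n = expI (of_int n * t) I"
proof -
  have pow: "expI s I ^ m = expI (of_nat m * s) I" for m s
    by (induction m) (simp_all add: expI_mult I algebra_simps, simp add: expI_def)
  have inv: "inverse (expI s I) = expI (- s) I" for s
    by (rule inverse_unique) (simp add: expI_mult I, simp add: expI_def)
  show ?thesis
    by (cases n rule: int_cases2) (simp_all add: pow inv power_int_minus)
qed

text \<open>Replacing \<open>I\<close> by \<open>-I\<close> if necessary, \<open>t\<close> can be taken in the half period.\<close>

lemma bdry_cases:
  assumes "q \<in> \<partial>\<B>"
  obtains t I where "0 \<le> t" "t \<le> pi" "I \<in> \<S>" "q = expI t I"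
proof -
  obtain s J where q: "q = expI s J" "J \<in> \<S>" using assms by (auto simp: bdry_ball_def)
  define t where "t = arccos (cos s)"
  have t: "0 \<le> t" "t \<le> pi" "cos t = cos s"
    by (simp_all add: t_def arccos_lbound arccos_ubound)
  have "sin t = \<bar>sin s\<bar>"
    unfolding t_def by (simp add: sin_arccos_abs sin_squared_eq[symmetric] flip: sin_squared_eq)
  then have "q = expI t (if 0 \<le> sin s then J else - J)"
    using q t by (simp add: expI_def)
  moreover have "(if 0 \<le> sin s then J else - J) \<in> \<S>" using q unit_imag(4) by simp
  ultimately show ?thesis using that t by blast
qed

text \<open>The components \<open>(\<alpha> t, \<beta> t)\<close> of \<open>f\<close>, read off from the two points \<open>e\<^sup>t\<^sup>I\<close>
with \<open>I = \<plusminus>i\<close>.\<close>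

definition slice_pair :: "(quat \<Rightarrow> quat) \<Rightarrow> real \<Rightarrow> biquat"
  where "slice_pair f t =
    ((1/2) *\<^sub>R (f (expI t (Quat 0 1 0 0)) + f (expI t (- Quat 0 1 0 0))),
     (-1/2) *\<^sub>R (Quat 0 1 0 0 * (f (expI t (Quat 0 1 0 0)) - f (expI t (- Quat 0 1 0 0)))))"

lemma slice_pair_linear:
  "slice_pair (\<lambda>q. f q + g q) t = slice_pair f t + slice_pair g t"
  "slice_pair (\<lambda>q. f q - g q) t = slice_pair f t - slice_pair g t"
  "slice_pair (\<lambda>q. f q * c) t = slice_pair f t \<odot> (c, 0)"
  by (simp_all add: slice_pair_def bmul_quat algebra_simps)

lemma slice_pair_eq:
  assumes "\<And>I. I \<in> \<S> \<Longrightarrow> f (expI t I) = A + I * B"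
  shows "slice_pair f t = (A, B)"
  using assms [OF unit_imag(1)] assms [OF unit_imag(4) [OF unit_imag(1)]]
  by (simp add: slice_pair_def scaleR_2 [symmetric] right_diff_distrib imag_mult_cancel unit_imag
      flip: scaleR_add_left)

text \<open>The representation formula in the definition of slice functions, for \<open>J = i\<close> and \<open>K = -i\<close>.\<close>

lemma slice_function_eval:
  assumes f: "slice_function f" and I: "I \<in> \<S>"
  shows "f (expI t I) = fst (slice_pair f t) + I * snd (slice_pair f t)"
proof -
  let ?J = "Quat 0 1 0 0"
  have ne: "?J \<noteq> - ?J" by (simp add: quat_eq_iff)
  have inv: "inverse (?J - - ?J) = Quat 0 (-1/2) 0 0"
    by (simp add: inverse_quat_def norm_quat_def quat_eq_iff)
  have "f (expI t I) = (inverse (?J - - ?J) * ?J + I * inverse (?J - - ?J)) * f (expI t ?J)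
      - (inverse (?J - - ?J) * (- ?J) + I * inverse (?J - - ?J)) * f (expI t (- ?J))"
    using f I ne unit_imag(1) unit_imag(4) [OF unit_imag(1)] expI_in_bdry [OF I, of t]
    unfolding slice_function_def expI_def by blast
  then show ?thesis
    unfolding inv slice_pair_def by (simp add: quat_eq_iff algebra_simps)
qed

text \<open>A converse to \<open>slice_function_eval\<close>: with \<open>D = (J - K)\<^sup>-\<^sup>1\<close> the representation formula reduces
to \<open>D * (J - K) = 1\<close> and \<open>J\<^sup>2 = K\<^sup>2\<close>.\<close>

lemma slice_functionI:
  assumes f: "\<And>t I. I \<in> \<S> \<Longrightarrow> f (expI t I) = A t + I * B t"
  shows "slice_function f"
  unfolding slice_function_def
proof (intro ballI impI allI)
  fix J K I x y
  assume JK: "J \<in> \<S>" "K \<in> \<S>" "J \<noteq> K" and I: "I \<in> \<S>" and "x *\<^sub>R 1 + y *\<^sub>R I \<in> \<partial>\<B>"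
  then have "(norm (x *\<^sub>R 1 + y *\<^sub>R I))\<^sup>2 = 1"
    by (auto simp: bdry_ball_def norm_expI)
  moreover have "(norm (x *\<^sub>R 1 + y *\<^sub>R I))\<^sup>2 = x\<^sup>2 + y\<^sup>2 * ((qi I)\<^sup>2 + (qj I)\<^sup>2 + (qk I)\<^sup>2)"
    using imag_sphere_iff [THEN iffD1, OF I, THEN conjunct1]
    by (simp add: norm_quat_power2 power_mult_distrib distrib_left)
  ultimately have "x\<^sup>2 + y\<^sup>2 = 1" using I by (simp add: imag_sphere_iff)
  then obtain t where t: "x = cos t" "y = sin t" by (rule sincos_total_2pi)
  have e: "x *\<^sub>R 1 + y *\<^sub>R L = expI t L" for L by (simp add: t expI_def)
  define D where "D = inverse (J - K)"
  have D: "D * (J - K) = 1" unfolding D_def using JK by simp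
  have "(D * J + I * D) * (A t + J * B t) - (D * K + I * D) * (A t + K * B t)
      = D * (J - K) * A t + I * (D * (J - K)) * B t + D * (J * (J * B t) - K * (K * B t))"
    by (simp add: algebra_simps)
  also have "\<dots> = A t + I * B t"
    using D JK by (simp add: imag_mult_cancel)
  finally show "f (x *\<^sub>R 1 + y *\<^sub>R I) = (inverse (J - K) * J + I * inverse (J - K)) * f (x *\<^sub>R 1 + y *\<^sub>R J) -
        (inverse (J - K) * K + I * inverse (J - K)) * f (x *\<^sub>R 1 + y *\<^sub>R K)"
    unfolding e using f JK I by (simp add: D_def)
qed

lemma slice_function_linear:
  assumes "slice_function f"
  shows "slice_function g \<Longrightarrow> slice_function (\<lambda>q. f q + g q)"
    "slice_function g \<Longrightarrow> slice_function (\<lambda>q. f q - g q)"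
    "slice_function (\<lambda>q. f q * c)"
proof -
  note e = slice_function_eval
  show "slice_function (\<lambda>q. f q + g q)" if "slice_function g"
    by (rule slice_functionI [where A = "\<lambda>t. fst (slice_pair f t) + fst (slice_pair g t)"
          and B = "\<lambda>t. snd (slice_pair f t) + snd (slice_pair g t)"])
      (simp add: e [OF assms] e [OF that] algebra_simps)
  show "slice_function (\<lambda>q. f q - g q)" if "slice_function g"
    by (rule slice_functionI [where A = "\<lambda>t. fst (slice_pair f t) - fst (slice_pair g t)"
          and B = "\<lambda>t. snd (slice_pair f t) - snd (slice_pair g t)"])
      (simp add: e [OF assms] e [OF that] algebra_simps)
  show "slice_function (\<lambda>q. f q * c)"
    by (rule slice_functionI [where A = "\<lambda>t. fst (slice_pair f t) * c" and B = "\<lambda>t. snd (slice_pair f t) * c"])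
      (simp add: e [OF assms] algebra_simps)
qed

lemma expI_mult_slice:
  "I \<in> \<S> \<Longrightarrow> expI s I * (fst F + I * snd F) = fst (rot s F) + I * snd (rot s F)"
  by (simp add: expI_def rot_sel algebra_simps imag_mult_cancel)

lemma slice_M_q:
  assumes f: "slice_function f"
  shows "slice_function (M_q f)" "slice_pair (M_q f) t = rot t (slice_pair f t)"
proof -
  have e: "M_q f (expI t I) = fst (rot t (slice_pair f t)) + I * snd (rot t (slice_pair f t))"
    if "I \<in> \<S>" for t I
    using that by (simp add: M_q_def slice_function_eval [OF f] expI_mult_slice)
  show "slice_function (M_q f)" by (rule slice_functionI [OF e])
  show "slice_pair (M_q f) t = rot t (slice_pair f t)" using slice_pair_eq [OF e] by simp
qed

lemma slice_fsum:
  "slice_function (\<lambda>q. \<Sum>n\<in>A. q powi n * a n)"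
  "slice_pair (\<lambda>q. \<Sum>n\<in>A. q powi n * a n) t = fsum A a t"
proof -
  have e: "(\<Sum>n\<in>A. expI t I powi n * a n) = fst (fsum A a t) + I * snd (fsum A a t)"
    if "I \<in> \<S>" for t I
    using that expI_mult_slice [OF that, of _ "(_, 0)"]
    by (simp add: fsum_def monomial_def expI_powi fst_sum snd_sum sum_distrib_left sum.distrib)
  show "slice_function (\<lambda>q. \<Sum>n\<in>A. q powi n * a n)" by (rule slice_functionI [OF e])
  show "slice_pair (\<lambda>q. \<Sum>n\<in>A. q powi n * a n) t = fsum A a t" using slice_pair_eq [OF e] by simp
qed

lemma slice_const: "slice_function (\<lambda>_. c)" "slice_pair (\<lambda>_. c) t = (c, 0)"
proof -
  show "slice_function (\<lambda>_. c)" by (rule slice_functionI [where A = "\<lambda>_. c" and B = "\<lambda>_. 0"]) simp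
  show "slice_pair (\<lambda>_. c) t = (c, 0)" by (rule slice_pair_eq) simp
qed

text \<open>The slice function with components \<open>F\<close> on the upper half circle. The factor \<open>sgn\<close> is the
imaginary unit of the slice that carries \<open>q\<close> in its upper half, and 0 at the two real points.\<close>

definition slice_ext :: "(real \<Rightarrow> biquat) \<Rightarrow> quat \<Rightarrow> quat"
  where "slice_ext F q = fst (F (arccos_clamp (qre q)))
    + sgn (q - qre q *\<^sub>R 1) * snd (F (arccos_clamp (qre q)))"

lemma slice_ext_expI:
  assumes "I \<in> \<S>"
  shows "slice_ext F (expI t I) = fst (F (arccos_clamp (cos t)))
    + I * (sgn (sin t) *\<^sub>R snd (F (arccos_clamp (cos t))))"
proof -
  have "qre (expI t I) = cos t" using assms by (simp add: expI_def imag_sphere_iff)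
  moreover have "sgn (expI t I - cos t *\<^sub>R 1) = sgn (sin t) *\<^sub>R I"
    using norm_imag [OF assms] by (simp add: expI_def sgn_scaleR) (simp add: sgn_div_norm)
  ultimately show ?thesis by (simp add: slice_ext_def)
qed

lemma slice_function_ext: "slice_function (slice_ext F)"
  by (rule slice_functionI [OF slice_ext_expI])

lemma slice_pair_ext: "0 < t \<Longrightarrow> t < pi \<Longrightarrow> slice_pair (slice_ext F) t = F t"
proof -
  assume t: "0 < t" "t < pi"
  then have "sgn (sin t) = 1" using sin_gt_zero by simp
  then show ?thesis
    using slice_pair_eq [of "slice_ext F" t, OF slice_ext_expI] t
    by (simp add: arccos_clamp_cos)
qed

text \<open>At the real points this needs that \<open>\<beta>\<close> vanishes there, which holds since \<open>i\<close> and \<open>-i\<close> give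
the same point.\<close>

lemma slice_ext_slice_pair:
  assumes f: "slice_function f" and q: "q \<in> \<partial>\<B>"
  shows "slice_ext (slice_pair f) q = f q"
proof -
  obtain t I where t: "0 \<le> t" "t \<le> pi" and I: "I \<in> \<S>" and q: "q = expI t I"
    using bdry_cases [OF q] .
  have *: "sgn (sin t) *\<^sub>R snd (slice_pair f t) = snd (slice_pair f t)"
  proof (cases "sin t = 0")
    case True
    then show ?thesis by (simp add: slice_pair_def expI_def)
  next
    case False
    then show ?thesis using sin_ge_zero [OF t] by simp
  qed
  show ?thesis
    using slice_function_eval [OF f I, of t] * t
    by (simp add: q slice_ext_expI I arccos_clamp_cos)
qed

lemma slice_ext_linear:
  "slice_ext (\<lambda>t. F t + G t) q = slice_ext F q + slice_ext G q"
  "slice_ext (\<lambda>t. F t - G t) q = slice_ext F q - slice_ext G q"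
  "slice_ext (\<lambda>t. F t \<odot> (c, 0)) q = slice_ext F q * c"
  by (simp_all add: slice_ext_def bmul_quat algebra_simps)


section \<open>The isometry between slice functions and functions on the half circle\<close>

lemma sets_bdry: "sets \<Sigma>\<^sub>\<B> = sets (restrict_space borel \<partial>\<B>)"
  by (simp add: bdry_measure_def)

lemma space_bdry: "space \<Sigma>\<^sub>\<B> = \<partial>\<B>"
  using sets_eq_imp_space_eq [OF sets_bdry] by (simp add: space_restrict_space)

lemma space_area: "space \<sigma> = \<S>"
  by (simp add: area_measure_def space_restrict_space)

interpretation bdry: prob_space \<Sigma>\<^sub>\<B> by (rule prob_space_bdry_measure)
interpretation area: prob_space \<sigma> by (rule prob_space_area_measure)

abbreviation circle_measure :: "real measure"
  where "circle_measure \<equiv> uniform_measure lborel {0..2 * pi}"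

interpretation circle: prob_space circle_measure
  by (rule prob_space_uniform_measure) auto
interpretation circle_area: pair_prob_space circle_measure \<sigma> ..

lemma measurable_expI_fixed:
  assumes "I \<in> \<S>" shows "(\<lambda>t. expI t I) \<in> measurable borel \<Sigma>\<^sub>\<B>"
  unfolding measurable_cong_sets [OF refl sets_bdry]
proof (rule measurable_restrict_space2)
  show "(\<lambda>t. expI t I) \<in> borel_measurable borel"
    unfolding expI_def by (intro borel_measurable_continuous_onI continuous_intros)
qed (use assms in \<open>auto simp: expI_in_bdry\<close>)

lemma measurable_expI: "(\<lambda>(t, I). expI t I) \<in> measurable (circle_measure \<Otimes>\<^sub>M \<sigma>) (restrict_space borel \<partial>\<B>)"
proof -
  have sets: "sets (circle_measure \<Otimes>\<^sub>M \<sigma>) = sets (borel \<Otimes>\<^sub>M restrict_space borel \<S>)"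
    by (intro sets_pair_measure_cong) (auto simp: area_measure_def)
  have id: "(\<lambda>q. q) \<in> measurable (restrict_space borel \<S>) borel"
    by (rule measurable_restrict_space1) simp
  have "(\<lambda>(t, I). expI t I) \<in> borel_measurable (borel \<Otimes>\<^sub>M restrict_space borel \<S>)"
    unfolding expI_def case_prod_unfold
    using measurable_compose [OF measurable_snd id] by measurable
  then have "(\<lambda>(t, I). expI t I) \<in> measurable (borel \<Otimes>\<^sub>M restrict_space borel \<S>) (restrict_space borel \<partial>\<B>)"
    by (intro measurable_restrict_space2)
      (auto simp: space_pair_measure space_restrict_space expI_in_bdry)
  then show ?thesis by (simp only: measurable_cong_sets [OF sets refl])
qed

lemma borel_measurable_slice_pair:
  assumes "f \<in> borel_measurable \<Sigma>\<^sub>\<B>" shows "slice_pair f \<in> borel_measurable borel"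
proof -
  have [measurable]: "(\<lambda>t. f (expI t I)) \<in> borel_measurable borel" if "I \<in> \<S>" for I
    using measurable_compose [OF measurable_expI_fixed [OF that] assms] .
  note [measurable] = this [OF unit_imag(1)] this [OF unit_imag(4) [OF unit_imag(1)]]
  have "(\<lambda>t. slice_pair f t) \<in> borel_measurable (borel :: real measure)"
    unfolding slice_pair_def borel_prod [symmetric] by measurable
  then show ?thesis .
qed

lemma borel_measurable_slice_ext:
  assumes F: "F \<in> borel_measurable borel" shows "slice_ext F \<in> borel_measurable \<Sigma>\<^sub>\<B>"
proof -
  have re [measurable]: "qre \<in> borel_measurable borel"
    by (intro borel_measurable_continuous_onI linear_continuous_on bounded_linear_qre)
  have c [measurable]: "(\<lambda>q. F (arccos_clamp (qre q))) \<in> borel_measurable borel"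
    using measurable_compose [OF measurable_compose [OF re borel_measurable_arccos_clamp] F] .
  have [measurable]: "(\<lambda>q. fst (F (arccos_clamp (qre q)))) \<in> borel_measurable borel"
    "(\<lambda>q. snd (F (arccos_clamp (qre q)))) \<in> borel_measurable borel"
    by (rule measurable_compose [OF c], intro borel_measurable_continuous_onI continuous_intros)+
  have "(\<lambda>q. slice_ext F q) \<in> borel_measurable borel"
    unfolding slice_ext_def sgn_div_norm by measurable
  then show ?thesis
    unfolding measurable_cong_sets [OF sets_bdry refl] by (rule measurable_restrict_space1)
qed

text \<open>Measurability on the boundary of the ball can be tested on one slice, because the function is
rebuilt measurably from its components.\<close>

lemma borel_measurable_slice_iff:
  assumes "slice_function f"
  shows "f \<in> borel_measurable \<Sigma>\<^sub>\<B> \<longleftrightarrow> slice_pair f \<in> borel_measurable borel"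
proof
  assume "slice_pair f \<in> borel_measurable borel"
  then have "slice_ext (slice_pair f) \<in> borel_measurable \<Sigma>\<^sub>\<B>" by (rule borel_measurable_slice_ext)
  then show "f \<in> borel_measurable \<Sigma>\<^sub>\<B>"
    by (rule subst [OF measurable_cong, rotated]) (simp add: space_bdry slice_ext_slice_pair assms)
qed (rule borel_measurable_slice_pair)

lemma circle_eq_density: "circle_measure = density lborel (\<lambda>t. ennreal (indicator {0..2 * pi} t / (2 * pi)))"
  unfolding uniform_measure_def
  by (rule arg_cong [where f = "density lborel"])
    (use divide_ennreal [of 1 "2 * pi"] in \<open>auto simp: fun_eq_iff indicator_def\<close>)

text \<open>The substitution \<open>t \<mapsto> 2 * \<pi> - t\<close> folds the lower half of the circle onto the upper half.\<close>

lemma nn_integral_circle_fold: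
  fixes g :: "real \<Rightarrow> ennreal"
  assumes [measurable]: "g \<in> borel_measurable borel"
  shows "(\<integral>\<^sup>+t. g t \<partial>circle_measure) = (\<integral>\<^sup>+t. ennreal (1/2) * (g t + g (2 * pi - t)) \<partial>arc_measure)"
proof -
  define c where "c = ennreal (1 / (2 * pi))"
  have "(\<integral>\<^sup>+t. g t \<partial>circle_measure) = (\<integral>\<^sup>+t. c * g t * indicator {0..2 * pi} t \<partial>lborel)"
    unfolding circle_eq_density c_def
    by (subst nn_integral_density) (auto intro!: nn_integral_cong simp: indicator_def)
  also have "\<dots> = (\<integral>\<^sup>+t. c * g t * indicator {0..pi} t + c * g t * indicator {pi<..2 * pi} t \<partial>lborel)"
    by (intro nn_integral_cong) (auto simp: indicator_def)
  also have "\<dots> = (\<integral>\<^sup>+t. c * g t * indicator {0..pi} t \<partial>lborel)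
      + (\<integral>\<^sup>+t. c * g t * indicator {pi<..2 * pi} t \<partial>lborel)"
    by (rule nn_integral_add) auto
  also have "(\<integral>\<^sup>+t. c * g t * indicator {pi<..2 * pi} t \<partial>lborel)
      = (\<integral>\<^sup>+t. c * g (2 * pi - t) * indicator {pi<..2 * pi} (2 * pi - t) \<partial>lborel)"
    by (subst nn_integral_real_affine [where c = "-1" and t = "2 * pi"]) auto
  also have "\<dots> = (\<integral>\<^sup>+t. c * g (2 * pi - t) * indicator {0..pi} t \<partial>lborel)"
    by (rule nn_integral_cong_AE)
      (use AE_lborel_singleton [of pi] in \<open>eventually_elim, auto simp: indicator_def\<close>)
  also have "(\<integral>\<^sup>+t. c * g t * indicator {0..pi} t \<partial>lborel) + \<dots>
      = (\<integral>\<^sup>+t. c * g t * indicator {0..pi} t + c * g (2 * pi - t) * indicator {0..pi} t \<partial>lborel)"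
    by (rule nn_integral_add [symmetric]) auto
  also have "\<dots> = (\<integral>\<^sup>+t. ennreal (indicator {0..pi} t / pi) * (ennreal (1/2) * (g t + g (2 * pi - t))) \<partial>lborel)"
  proof (rule nn_integral_cong)
    fix t :: real
    have "ennreal (1 / pi) * (ennreal (1/2) * x) = c * x" for x
    proof -
      have "ennreal (1 / pi) * ennreal (1 / 2) = c"
        unfolding c_def by (subst ennreal_mult [symmetric]) (simp_all add: mult.commute)
      then show ?thesis by (metis mult.assoc)
    qed
    then show "c * g t * indicator {0..pi} t + c * g (2 * pi - t) * indicator {0..pi} t
        = ennreal (indicator {0..pi} t / pi) * (ennreal (1/2) * (g t + g (2 * pi - t)))"
      by (simp add: indicator_def distrib_left)
  qed
  also have "\<dots> = (\<integral>\<^sup>+t. ennreal (1/2) * (g t + g (2 * pi - t)) \<partial>arc_measure)"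
    unfolding arc_eq_density by (rule nn_integral_density [symmetric]) auto
  finally show ?thesis .
qed

lemma nn_integral_bdry:
  fixes g :: "quat \<Rightarrow> ennreal"
  assumes g: "g \<in> borel_measurable \<Sigma>\<^sub>\<B>"
  shows "(\<integral>\<^sup>+q. g q \<partial>\<Sigma>\<^sub>\<B>)
    = (\<integral>\<^sup>+I. \<integral>\<^sup>+t. ennreal (1/2) * (g (expI t I) + g (expI t (- I))) \<partial>arc_measure \<partial>\<sigma>)"
proof -
  have g': "g \<in> borel_measurable (restrict_space borel \<partial>\<B>)"
    using g by (simp add: measurable_cong_sets [OF sets_bdry refl])
  have m: "(\<lambda>(t, I). g (expI t I)) \<in> borel_measurable (circle_measure \<Otimes>\<^sub>M \<sigma>)"
    using measurable_compose [OF measurable_expI g'] by (simp add: case_prod_unfold)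
  have "(\<integral>\<^sup>+q. g q \<partial>\<Sigma>\<^sub>\<B>) = (\<integral>\<^sup>+z. (\<lambda>(t, I). g (expI t I)) z \<partial>(circle_measure \<Otimes>\<^sub>M \<sigma>))"
    using nn_integral_distr [OF measurable_expI, of g] g
    unfolding bdry_measure_def [symmetric] by (simp add: case_prod_unfold)
  also have "\<dots> = (\<integral>\<^sup>+I. \<integral>\<^sup>+t. g (expI t I) \<partial>circle_measure \<partial>\<sigma>)"
    using circle_area.nn_integral_snd [OF m] by simp
  also have "\<dots> = (\<integral>\<^sup>+I. \<integral>\<^sup>+t. ennreal (1/2) * (g (expI t I) + g (expI t (- I))) \<partial>arc_measure \<partial>\<sigma>)"
  proof (rule nn_integral_cong)
    fix I assume "I \<in> space \<sigma>"
    then have I: "I \<in> \<S>" by (simp add: space_area)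
    have "expI (2 * pi - t) I = expI t (- I)" for t by (simp add: expI_def)
    then show "(\<integral>\<^sup>+t. g (expI t I) \<partial>circle_measure)
        = (\<integral>\<^sup>+t. ennreal (1/2) * (g (expI t I) + g (expI t (- I))) \<partial>arc_measure)"
      using nn_integral_circle_fold [OF measurable_compose [OF measurable_expI_fixed [OF I] g]] by simp
  qed
  finally show ?thesis .
qed

text \<open>For a fixed \<open>I\<close>, the points \<open>e\<^sup>t\<^sup>I\<close> and \<open>e\<^sup>-\<^sup>t\<^sup>I\<close> together contribute twice the square norm of
\<open>slice_pair f t\<close>, by \<open>norm_slice_power2\<close>. The inner integral is thus the same for all \<open>I\<close>, and
the integral over the sphere only sees its total mass.\<close>

lemma nn_integral_slice_norm:
  assumes f: "slice_function f" "f \<in> borel_measurable \<Sigma>\<^sub>\<B>"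
  shows "(\<integral>\<^sup>+q. ennreal ((norm (f q))\<^sup>2) \<partial>\<Sigma>\<^sub>\<B>) = (\<integral>\<^sup>+t. ennreal ((norm (slice_pair f t))\<^sup>2) \<partial>arc_measure)"
proof -
  have "ennreal (1/2) * (ennreal ((norm (f (expI t I)))\<^sup>2) + ennreal ((norm (f (expI t (- I))))\<^sup>2))
      = ennreal ((norm (slice_pair f t))\<^sup>2)" if "I \<in> \<S>" for t I
  proof -
    have "(norm (f (expI t I)))\<^sup>2 + (norm (f (expI t (- I))))\<^sup>2 = 2 * (norm (slice_pair f t))\<^sup>2"
      using norm_slice_power2 [OF that, of "fst (slice_pair f t)" "snd (slice_pair f t)"]
        norm_slice_power2 [OF unit_imag(4) [OF that], of "fst (slice_pair f t)" "snd (slice_pair f t)"]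
      by (simp add: slice_function_eval f that unit_imag(4))
    moreover have "ennreal (1/2) * (ennreal a + ennreal b) = ennreal (1/2 * (a + b))" if "0 \<le> a" "0 \<le> b" for a b
      using that by (subst ennreal_plus [symmetric], simp, simp, subst ennreal_mult [symmetric]) simp_all
    ultimately show ?thesis by simp
  qed
  note pointwise = this
  have "(\<integral>\<^sup>+q. ennreal ((norm (f q))\<^sup>2) \<partial>\<Sigma>\<^sub>\<B>)
      = (\<integral>\<^sup>+I. \<integral>\<^sup>+t. ennreal (1/2) * (ennreal ((norm (f (expI t I)))\<^sup>2)
          + ennreal ((norm (f (expI t (- I))))\<^sup>2)) \<partial>arc_measure \<partial>\<sigma>)"
    by (rule nn_integral_bdry) (use f(2) in measurable)
  also have "\<dots> = (\<integral>\<^sup>+I. \<integral>\<^sup>+t. ennreal ((norm (slice_pair f t))\<^sup>2) \<partial>arc_measure \<partial>\<sigma>)"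
    by (intro nn_integral_cong pointwise) (simp only: space_area)
  also have "\<dots> = (\<integral>\<^sup>+t. ennreal ((norm (slice_pair f t))\<^sup>2) \<partial>arc_measure)"
    by (simp add: area.emeasure_space_1)
  finally show ?thesis .
qed

lemma L2s_iff: "f \<in> L2s \<longleftrightarrow> slice_function f \<and> square_integrable arc_measure (slice_pair f)"
  and L2s_sqnorm: "f \<in> L2s \<Longrightarrow> (\<integral>q. (norm (f q))\<^sup>2 \<partial>\<Sigma>\<^sub>\<B>) = sqnorm arc_measure (slice_pair f)"
proof -
  have *: "(f \<in> borel_measurable \<Sigma>\<^sub>\<B> \<and> integrable \<Sigma>\<^sub>\<B> (\<lambda>q. (norm (f q))\<^sup>2) \<longleftrightarrow> square_integrable arc_measure (slice_pair f))
    \<and> (f \<in> borel_measurable \<Sigma>\<^sub>\<B> \<longrightarrow> (\<integral>q. (norm (f q))\<^sup>2 \<partial>\<Sigma>\<^sub>\<B>) = sqnorm arc_measure (slice_pair f))"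
    if f: "slice_function f"
  proof (cases "f \<in> borel_measurable \<Sigma>\<^sub>\<B>")
    case True
    then have m: "slice_pair f \<in> borel_measurable arc_measure"
      using borel_measurable_slice_pair by (simp add: measurable_cong_sets [OF sets_arc refl])
    have m2: "(\<lambda>q. (norm (f q))\<^sup>2) \<in> borel_measurable \<Sigma>\<^sub>\<B>"
      "(\<lambda>t. (norm (slice_pair f t))\<^sup>2) \<in> borel_measurable arc_measure"
      using True m by measurable
    show ?thesis
      using nn_integral_slice_norm [OF f True] m m2 True
      by (simp add: square_integrable_def integrable_iff_bounded sqnorm_def integral_eq_nn_integral)
  next
    case False
    then show ?thesis
      using borel_measurable_slice_iff [OF f]
      by (simp add: square_integrable_def measurable_cong_sets [OF sets_arc refl])
  qed
  show "f \<in> L2s \<longleftrightarrow> slice_function f \<and> square_integrable arc_measure (slice_pair f)"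
    using * by (auto simp: L2s_def)
  show "f \<in> L2s \<Longrightarrow> (\<integral>q. (norm (f q))\<^sup>2 \<partial>\<Sigma>\<^sub>\<B>) = sqnorm arc_measure (slice_pair f)"
    using * by (auto simp: L2s_def)
qed


section \<open>Series, star product and unimodular functions\<close>

lemma L2s_linear:
  assumes "f \<in> L2s"
  shows "g \<in> L2s \<Longrightarrow> (\<lambda>q. f q + g q) \<in> L2s" "g \<in> L2s \<Longrightarrow> (\<lambda>q. f q - g q) \<in> L2s"
  using assms
  by (auto simp: L2s_iff slice_function_linear slice_pair_linear [abs_def]
      intro: square_integrable_add square_integrable_diff)

lemma L2s_AE_eq_iff:
  assumes f: "f \<in> L2s" and g: "g \<in> L2s"
  shows "(AE q in \<Sigma>\<^sub>\<B>. f q = g q) \<longleftrightarrow> (AE t in arc_measure. slice_pair f t = slice_pair g t)"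
proof -
  have d: "(\<lambda>q. f q - g q) \<in> L2s" by (rule L2s_linear [OF f g])
  have "(AE q in \<Sigma>\<^sub>\<B>. f q = g q) \<longleftrightarrow> (\<integral>q. (norm (f q - g q))\<^sup>2 \<partial>\<Sigma>\<^sub>\<B>) = 0"
    using d by (subst integral_nonneg_eq_0_iff_AE) (auto simp: L2s_def)
  also have "\<dots> \<longleftrightarrow> sqnorm arc_measure (\<lambda>t. slice_pair f t - slice_pair g t) = 0"
    by (simp add: L2s_sqnorm [OF d] slice_pair_linear [abs_def])
  also have "\<dots> \<longleftrightarrow> (AE t in arc_measure. slice_pair f t = slice_pair g t)"
    using d unfolding sqnorm_def
    by (subst integral_nonneg_eq_0_iff_AE) (auto simp: L2s_iff square_integrable_def slice_pair_linear [abs_def])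
  finally show ?thesis .
qed

lemma L2s_ext:
  assumes F: "square_integrable arc_measure F"
  shows "slice_ext F \<in> L2s" "AE t in arc_measure. slice_pair (slice_ext F) t = F t"
proof -
  show ae: "AE t in arc_measure. slice_pair (slice_ext F) t = F t"
    using AE_arc_interior by eventually_elim (simp add: slice_pair_ext)
  have "F \<in> borel_measurable borel"
    using square_integrableD [OF F] by (simp add: measurable_cong_sets [OF sets_arc refl])
  then have "slice_pair (slice_ext F) \<in> borel_measurable arc_measure"
    by (simp add: measurable_cong_sets [OF sets_arc refl] borel_measurable_slice_pair borel_measurable_slice_ext)
  then have "square_integrable arc_measure (slice_pair (slice_ext F))"
    by (rule square_integrable_cong [OF F _ ae])
  then show "slice_ext F \<in> L2s" by (simp add: L2s_iff slice_function_ext)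
qed

lemma sqnorm_cong_AE:
  assumes "AE x in M. F x = G x" "F \<in> borel_measurable M" "G \<in> borel_measurable M"
  shows "sqnorm M F = sqnorm M G"
  unfolding sqnorm_def
proof (rule integral_cong_AE)
  show "AE x in M. (norm (F x))\<^sup>2 = (norm (G x))\<^sup>2"
    using assms(1) by eventually_elim simp
qed (use assms(2,3) in measurable)

text \<open>The partial sums of the series are mapped to partial sums of the Fourier series of the
components, and every square-integrable function is the sum of its Fourier series.\<close>

lemma has_series_iff:
  "has_series f a \<longleftrightarrow> f \<in> L2s \<and> (\<forall>n. coef n (slice_pair f) = a n)"
proof (cases "f \<in> L2s")
  case f: True
  then have F: "square_integrable arc_measure (slice_pair f)" by (simp add: L2s_iff)
  have int: "(\<integral>q. (norm (f q - (\<Sum>n = - int N..int N. q powi n * a n)))\<^sup>2 \<partial>\<Sigma>\<^sub>\<B>)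
      = sqnorm arc_measure (\<lambda>t. fsum (sym_interval N) a t - slice_pair f t)" for N
  proof -
    have "(\<lambda>q. \<Sum>n = - int N..int N. q powi n * a n) \<in> L2s"
      by (simp add: L2s_iff slice_fsum(1) slice_fsum(2) [abs_def])
    then have "(\<lambda>q. f q - (\<Sum>n = - int N..int N. q powi n * a n)) \<in> L2s"
      by (rule L2s_linear [OF f])
    from L2s_sqnorm [OF this] show ?thesis
      by (simp add: slice_pair_linear [abs_def] slice_fsum sym_interval_def
          sqnorm_minus_commute [of _ "\<lambda>t. fsum _ _ t"])
  qed
  show ?thesis
  proof
    assume h: "has_series f a"
    have "(\<lambda>N. coef n (fsum (sym_interval N) a)) \<longlonglongrightarrow> coef n (slice_pair f)" for n
      using h by (intro coef_tendsto F) (simp_all add: has_series_def int)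
    then have "coef n (slice_pair f) = a n" for n
      using coef_fsum_tendsto by (rule LIMSEQ_unique)
    with f show "f \<in> L2s \<and> (\<forall>n. coef n (slice_pair f) = a n)" by simp
  next
    assume "f \<in> L2s \<and> (\<forall>n. coef n (slice_pair f) = a n)"
    then have c: "coef n (slice_pair f) = a n" for n by simp
    show "has_series f a"
      using f Fourier_series [OF F] unfolding has_series_def int c by simp
  qed
qed (simp add: has_series_def)

text \<open>By the convolution formula both sides say that two integrable functions have the same
coefficients.\<close>

lemma star_product_iff:
  "star_product f g h \<longleftrightarrow> f \<in> L2s \<and> g \<in> L2s \<and> h \<in> L2s \<and>
    (AE t in arc_measure. slice_pair h t = slice_pair f t \<odot> slice_pair g t)"
proof (cases "f \<in> L2s \<and> g \<in> L2s \<and> h \<in> L2s")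
  case True
  then have sq: "square_integrable arc_measure (slice_pair f)" "square_integrable arc_measure (slice_pair g)"
      "square_integrable arc_measure (slice_pair h)"
    by (simp_all add: L2s_iff)
  have i: "integrable arc_measure (\<lambda>t. slice_pair f t \<odot> slice_pair g t)"
    by (rule integrable_bmul [OF sq(1,2)])
  have "star_product f g h \<longleftrightarrow> (\<forall>n. coef n (slice_pair h) = coef n (\<lambda>t. slice_pair f t \<odot> slice_pair g t))"
    using True by (auto simp: star_product_def has_series_iff convolution [OF sq(1,2)])
  also have "\<dots> \<longleftrightarrow> (AE t in arc_measure. slice_pair h t = slice_pair f t \<odot> slice_pair g t)"
    using coef_eq_AE [OF arc.square_integrable_integrable [OF sq(3)] i]
      coef_cong_AE [OF _ borel_measurable_integrable [OF arc.square_integrable_integrable [OF sq(3)]]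
        borel_measurable_integrable [OF i]]
    by blast
  finally show ?thesis using True by simp
qed (auto simp: star_product_def has_series_def)

lemma H2_iff: "f \<in> H2 \<longleftrightarrow> f \<in> L2s \<and> (\<forall>n<0. coef n (slice_pair f) = 0)"
  by (auto simp: H2_def has_series_iff)

text \<open>Spherical coordinates have positive density in the open coordinate rectangle. So a continuous
function that is constant almost everywhere on the sphere is constant on the image of a dense
subset of the closed rectangle, hence on the image of the closed rectangle, which is the whole
sphere.\<close>

lemma AE_area_imp_all:
  assumes ae: "AE I in \<sigma>. g I = c" and g: "continuous_on UNIV g" and I: "I \<in> \<S>"
  shows "g I = (c::real)"
proof -
  let ?R = "{0<..<pi} \<times> {0<..<2 * pi} :: (real \<times> real) set"
  have meas: "spherical \<in> measurable (density lborel
      (\<lambda>(\<theta>, \<psi>). ennreal (indicator ({0..pi} \<times> {0..2 * pi}) (\<theta>, \<psi>) * (sin \<theta> / (4 * pi))))) (restrict_space borel \<S>)"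
    using spherical_measurable by simp
  have cs: "continuous_on UNIV spherical"
  proof -
    have "spherical = (\<lambda>z. (sin (fst z) * cos (snd z)) *\<^sub>R Quat 0 1 0 0
        + (sin (fst z) * sin (snd z)) *\<^sub>R Quat 0 0 1 0 + cos (fst z) *\<^sub>R Quat 0 0 0 1)"
      by (simp add: fun_eq_iff spherical_def quat_eq_iff case_prod_unfold)
    moreover have "continuous_on UNIV \<dots>" by (intro continuous_intros)
    ultimately show ?thesis by (simp only:)
  qed
  have cg: "continuous_on UNIV (\<lambda>z. g (spherical z))"
    by (rule continuous_on_compose2 [OF g cs]) simp
  have m: "(\<lambda>z::real \<times> real. ennreal (indicator ({0..pi} \<times> {0..2 * pi}) z * (sin (fst z) / (4 * pi)))) \<in> borel_measurable lborel"
  proof -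
    have "(\<lambda>z::real \<times> real. sin (fst z) / (4 * pi)) \<in> borel_measurable borel"
      by (intro borel_measurable_continuous_onI continuous_intros) auto
    moreover have "closed ({0..pi} \<times> {0..2 * pi} :: (real \<times> real) set)"
      by (intro closed_Times) auto
    ultimately have "(\<lambda>z. indicator ({0..pi} \<times> {0..2 * pi}) z * (sin (fst z) / (4 * pi))) \<in> borel_measurable borel"
      by (intro borel_measurable_times borel_measurable_indicator borel_closed)
    then show ?thesis by (intro measurable_compose [OF _ measurable_ennreal]) simp
  qed
  have d: "(\<lambda>(\<theta>, \<psi>). ennreal (indicator ({0..pi} \<times> {0..2 * pi}) (\<theta>, \<psi>) * (sin \<theta> / (4 * pi))))
      = (\<lambda>z. ennreal (indicator ({0..pi} \<times> {0..2 * pi}) z * (sin (fst z) / (4 * pi))))"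
    by (simp add: fun_eq_iff)
  have "AE z in density lborel (\<lambda>z. ennreal (indicator ({0..pi} \<times> {0..2 * pi}) z * (sin (fst z) / (4 * pi)))).
      g (spherical z) = c"
    using AE_distrD [OF meas ae [unfolded area_measure_def]] unfolding d .
  then have "AE z in lborel. 0 < ennreal (indicator ({0..pi} \<times> {0..2 * pi}) z * (sin (fst z) / (4 * pi)))
      \<longrightarrow> g (spherical z) = c"
    by (simp add: AE_density [OF m])
  then have ae': "AE z in lborel. z \<in> ?R \<longrightarrow> g (spherical z) = c"
  proof eventually_elim
    case (elim z)
    show ?case
    proof
      assume z: "z \<in> ?R"
      then have "0 < fst z" "fst z < pi" "0 < snd z" "snd z < 2 * pi"
        by auto
      then have "0 < indicator ({0..pi} \<times> {0..2 * pi}) z * (sin (fst z) / (4 * pi))"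
        by (cases z) (auto simp: indicator_def sin_gt_zero)
      then show "g (spherical z) = c" using elim by simp
    qed
  qed
  define U where "U = {z \<in> ?R. g (spherical z) \<noteq> c}"
  have "open U"
  proof -
    have "open ((\<lambda>z. g (spherical z)) -` (- {c}))"
      using cg by (rule open_vimage [rotated]) auto
    moreover have "U = ?R \<inter> (\<lambda>z. g (spherical z)) -` (- {c})" by (auto simp: U_def)
    ultimately show ?thesis by (auto intro!: open_Times)
  qed
  moreover have "negligible U"
  proof -
    have "AE z in lborel. z \<notin> U"
      using ae' by eventually_elim (simp add: U_def)
    then have "U \<in> null_sets lborel"
      using \<open>open U\<close> by (subst AE_iff_null_sets) auto
    then show ?thesis by (simp add: negligible_iff_null_sets null_sets_completionI)
  qed
  ultimately have "U = {}" using open_not_negligible by blast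
  then have "g (spherical z) = c" if "z \<in> ?R" for z using that by (auto simp: U_def)
  moreover have "closure ?R = {0..pi} \<times> {0..2 * pi}"
    by (simp add: closure_Times)
  ultimately have R: "g (spherical z) = c" if "z \<in> {0..pi} \<times> {0..2 * pi}" for z
    using continuous_constant_on_closure [of ?R "\<lambda>z. g (spherical z)" c z] that
      continuous_on_subset [OF cg] by auto
  have "qre I = 0" and sq: "(qi I)\<^sup>2 + (qj I)\<^sup>2 + (qk I)\<^sup>2 = 1" using I by (simp_all add: imag_sphere_iff)
  have k: "\<bar>qk I\<bar> \<le> 1" using sq by (simp add: abs_square_le_1 [symmetric]) (smt (verit) zero_le_power2)
  define \<theta> where "\<theta> = arccos (qk I)"
  have th: "0 \<le> \<theta>" "\<theta> \<le> pi" "cos \<theta> = qk I" using k by (auto simp: \<theta>_def arccos_lbound arccos_ubound)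
  obtain \<psi> where ps: "0 \<le> \<psi>" "\<psi> \<le> 2 * pi" "qi I = sin \<theta> * cos \<psi>" "qj I = sin \<theta> * sin \<psi>"
  proof (cases "sin \<theta> = 0")
    case True
    then have "(qk I)\<^sup>2 = 1" using sin_cos_squared_add [of \<theta>] th by simp
    then have "(qi I)\<^sup>2 + (qj I)\<^sup>2 = 0" using sq by simp
    then have "qi I = 0" "qj I = 0" by simp_all
    then show ?thesis using that [of 0] True by simp
  next
    case False
    have e: "(qi I)\<^sup>2 + (qj I)\<^sup>2 = (sin \<theta>)\<^sup>2" using sin_cos_squared_add [of \<theta>] th sq by simp
    have "(qi I / sin \<theta>)\<^sup>2 + (qj I / sin \<theta>)\<^sup>2 = ((qi I)\<^sup>2 + (qj I)\<^sup>2) / (sin \<theta>)\<^sup>2"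
      by (simp only: power_divide add_divide_distrib)
    also have "\<dots> = 1" unfolding e using False by simp
    finally obtain \<psi> where "0 \<le> \<psi>" "\<psi> < 2 * pi" "qi I / sin \<theta> = cos \<psi>" "qj I / sin \<theta> = sin \<psi>"
      by (rule sincos_total_2pi)
    then show ?thesis using that [of \<psi>] False by (simp add: field_simps)
  qed
  have "I = spherical (\<theta>, \<psi>)"
    using \<open>qre I = 0\<close> th ps by (simp add: spherical_def quat_eq_iff)
  then show ?thesis using R [of "(\<theta>, \<psi>)"] th ps by simp
qed

lemma Linf_s_subset_L2s: "Linf_s \<subseteq> L2s"
proof
  fix f assume "f \<in> Linf_s"
  then obtain C where f: "slice_function f" and [measurable]: "f \<in> borel_measurable \<Sigma>\<^sub>\<B>"
    and C: "AE q in \<Sigma>\<^sub>\<B>. norm (f q) \<le> C"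
    by (auto simp: Linf_s_def)
  have "AE q in \<Sigma>\<^sub>\<B>. norm ((norm (f q))\<^sup>2) \<le> C\<^sup>2"
    using C by eventually_elim (simp add: power_mono)
  then have "integrable \<Sigma>\<^sub>\<B> (\<lambda>q. (norm (f q))\<^sup>2)"
    by (rule bdry.integrable_const_bound) measurable
  then show "f \<in> L2s" using f by (simp add: L2s_def)
qed

text \<open>From left to right, for almost every \<open>t\<close> the equation \<open>|\<alpha> t + I * \<beta> t| = 1\<close> holds for almost
every \<open>I\<close> by Fubini's theorem, hence for every \<open>I\<close> by continuity.\<close>

lemma unimodular_iff:
  "unimodular \<phi> \<longleftrightarrow> \<phi> \<in> L2s \<and> (AE t in arc_measure. bunitary (slice_pair \<phi> t))"
proof
  assume u: "unimodular \<phi>"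
  then have L: "\<phi> \<in> L2s" using Linf_s_subset_L2s by (auto simp: unimodular_def)
  then have sl: "slice_function \<phi>" and [measurable]: "\<phi> \<in> borel_measurable \<Sigma>\<^sub>\<B>"
    by (auto simp: L2s_def)
  have "AE q in \<Sigma>\<^sub>\<B>. norm (\<phi> q) = 1" using u by (simp add: unimodular_def)
  then have "AE z in circle_measure \<Otimes>\<^sub>M \<sigma>. norm (\<phi> (case z of (t, I) \<Rightarrow> expI t I)) = 1"
    unfolding bdry_measure_def by (rule AE_distrD [OF measurable_expI])
  then have "AE t in circle_measure. AE I in \<sigma>. norm (\<phi> (expI t I)) = 1"
    using circle_area.AE_pair by fastforce
  then have "AE t in lborel. t \<in> {0..2 * pi} \<longrightarrow> (AE I in \<sigma>. norm (\<phi> (expI t I)) = 1)"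
    by (subst (asm) AE_uniform_measure) auto
  then have "AE t in arc_measure. AE I in \<sigma>. norm (\<phi> (expI t I)) = 1"
    unfolding AE_arc by eventually_elim auto
  then have "AE t in arc_measure. bunitary (slice_pair \<phi> t)"
  proof eventually_elim
    case (elim t)
    let ?F = "slice_pair \<phi> t"
    have "AE I in \<sigma>. norm (fst ?F + I * snd ?F) = 1"
      using elim AE_space [of \<sigma>]
      by eventually_elim (simp add: space_area slice_function_eval [OF sl])
    then have "norm (fst ?F + I * snd ?F) = 1" if "I \<in> \<S>" for I
      by (rule AE_area_imp_all [OF _ _ that]) (intro continuous_intros)
    then show ?case by (simp add: bunitary_iff_slice)
  qed
  with L show "\<phi> \<in> L2s \<and> (AE t in arc_measure. bunitary (slice_pair \<phi> t))" by simp
next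
  assume "\<phi> \<in> L2s \<and> (AE t in arc_measure. bunitary (slice_pair \<phi> t))"
  then have L: "\<phi> \<in> L2s" and u: "AE t in arc_measure. bunitary (slice_pair \<phi> t)" by auto
  then have sl: "slice_function \<phi>" and m [measurable]: "\<phi> \<in> borel_measurable \<Sigma>\<^sub>\<B>"
    by (auto simp: L2s_def)
  define N where "N = {q \<in> space \<Sigma>\<^sub>\<B>. norm (\<phi> q) \<noteq> 1}"
  have N: "N \<in> sets \<Sigma>\<^sub>\<B>" unfolding N_def by measurable
  have "emeasure \<Sigma>\<^sub>\<B> N = (\<integral>\<^sup>+q. indicator N q \<partial>\<Sigma>\<^sub>\<B>)" using N by simp
  also have "\<dots> = (\<integral>\<^sup>+I. \<integral>\<^sup>+t. ennreal (1/2) * (indicator N (expI t I) + indicator N (expI t (- I))) \<partial>arc_measure \<partial>\<sigma>)"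
    by (rule nn_integral_bdry) (use N in measurable)
  also have "\<dots> = (\<integral>\<^sup>+I. 0 \<partial>\<sigma>)"
  proof (rule nn_integral_cong)
    fix I assume "I \<in> space \<sigma>"
    then have I: "I \<in> \<S>" "- I \<in> \<S>" by (simp_all add: space_area unit_imag)
    have "(\<integral>\<^sup>+t. ennreal (1/2) * (indicator N (expI t I) + indicator N (expI t (- I))) \<partial>arc_measure) = (\<integral>\<^sup>+t. 0 \<partial>arc_measure)"
    proof (rule nn_integral_cong_AE)
      show "AE t in arc_measure. ennreal (1/2) * (indicator N (expI t I) + indicator N (expI t (- I))) = 0"
        using u
      proof eventually_elim
        case (elim t)
        then have "norm (\<phi> (expI t J)) = 1" if "J \<in> \<S>" for J
          using that by (simp add: slice_function_eval [OF sl] bunitary_iff_slice)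
        then show ?case using I by (simp add: N_def)
      qed
    qed
    then show "(\<integral>\<^sup>+t. ennreal (1/2) * (indicator N (expI t I) + indicator N (expI t (- I))) \<partial>arc_measure) = 0"
      by simp
  qed
  finally have "N \<in> null_sets \<Sigma>\<^sub>\<B>" using N by (simp add: null_sets_def)
  then have ae: "AE q in \<Sigma>\<^sub>\<B>. norm (\<phi> q) = 1"
    by (rule AE_I') (simp add: N_def)
  have "AE q in \<Sigma>\<^sub>\<B>. norm (\<phi> q) \<le> 1" using ae by eventually_elim simp
  then show "unimodular \<phi>" using ae sl m by (auto simp: unimodular_def Linf_s_def)
qed


section \<open>Invariant subspaces\<close>

text \<open>The closed subspace of biquaternion-valued functions that corresponds to \<open>K\<close>.\<close>

definition pairs :: "(quat \<Rightarrow> quat) set \<Rightarrow> (real \<Rightarrow> biquat) set"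
  where "pairs K = {F. square_integrable arc_measure F \<and> slice_ext F \<in> K}"

lemma closed_right_subspace_limit:
  assumes "closed_right_subspace K" "\<And>n. F n \<in> K" "f \<in> L2s"
    "(\<lambda>n. \<integral>q. (norm (F n q - f q))\<^sup>2 \<partial>\<Sigma>\<^sub>\<B>) \<longlonglongrightarrow> 0"
  shows "f \<in> K"
  using assms unfolding closed_right_subspace_def by blast

lemma closed_subspace_cong:
  assumes K: "closed_right_subspace K" and f: "f \<in> K" and g: "g \<in> L2s"
    and ae: "AE t in arc_measure. slice_pair f t = slice_pair g t"
  shows "g \<in> K"
proof -
  have "f \<in> L2s" using K f by (auto simp: closed_right_subspace_def)
  then have "AE q in \<Sigma>\<^sub>\<B>. f q = g q" using ae g by (simp add: L2s_AE_eq_iff)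
  then have "AE q in \<Sigma>\<^sub>\<B>. (norm (f q - g q))\<^sup>2 = 0" by eventually_elim simp
  then have "(\<integral>q. (norm (f q - g q))\<^sup>2 \<partial>\<Sigma>\<^sub>\<B>) = 0" by (rule integral_eq_zero_AE)
  then show ?thesis
    by (intro closed_right_subspace_limit [OF K f g]) simp
qed

lemma pairs_square_integrable: "F \<in> pairs K \<Longrightarrow> square_integrable arc_measure F"
  by (simp add: pairs_def)

text \<open>Passing to components and back changes a function at most on a null set (and outside the
boundary of the ball), which a closed subspace does not see.\<close>

lemma slice_pair_in_pairs_iff:
  assumes K: "closed_right_subspace K" and f: "f \<in> L2s"
  shows "slice_pair f \<in> pairs K \<longleftrightarrow> f \<in> K"
proof -
  have sq: "square_integrable arc_measure (slice_pair f)" using f by (simp add: L2s_iff)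
  have e: "slice_ext (slice_pair f) \<in> L2s" "AE t in arc_measure. slice_pair (slice_ext (slice_pair f)) t = slice_pair f t"
    using L2s_ext [OF sq] by auto
  show ?thesis
    using closed_subspace_cong [OF K _ f e(2)] closed_subspace_cong [OF K _ e(1)] e(2) sq
    by (auto simp: pairs_def eq_commute [of "slice_pair f _"])
qed

lemma pairs_cong:
  assumes K: "closed_right_subspace K" and F: "F \<in> pairs K" and G: "square_integrable arc_measure G"
    and ae: "AE t in arc_measure. F t = G t"
  shows "G \<in> pairs K"
proof -
  note f = L2s_ext [OF pairs_square_integrable [OF F]] and g = L2s_ext [OF G]
  have "AE t in arc_measure. slice_pair (slice_ext F) t = slice_pair (slice_ext G) t"
    using ae f(2) g(2) by eventually_elim simp
  moreover have "slice_ext F \<in> K" using F by (simp add: pairs_def)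
  ultimately have "slice_ext G \<in> K"
    by (intro closed_subspace_cong [OF K _ g(1)])
  then show ?thesis using G by (simp add: pairs_def)
qed

lemma square_integrable_bmul_quat:
  "square_integrable arc_measure F \<Longrightarrow> square_integrable arc_measure (\<lambda>t. F t \<odot> (c, 0))"
proof -
  assume F: "square_integrable arc_measure F"
  obtain K where K: "\<And>a b. norm (a \<odot> b) \<le> norm a * norm b * K"
    using bounded_bilinear.nonneg_bounded [OF bounded_bilinear_bmul] by blast
  have [measurable]: "F \<in> borel_measurable arc_measure" using F by (rule square_integrableD)
  show ?thesis
    by (rule square_integrable_bound [OF F, where C = "norm (c, 0::quat) * K"])
      (use K [of "F _" "(c, 0)"] in \<open>auto simp: mult_ac\<close>)
qed

lemma square_integrable_rot:
  assumes "square_integrable arc_measure F"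
  shows "square_integrable arc_measure (\<lambda>t. rot (c * t) (F t))"
proof (rule square_integrable_isometry [OF assms])
  show "(\<lambda>t. rot (c * t) (F t)) \<in> borel_measurable arc_measure"
    using square_integrableD [OF assms] by measurable
qed simp

lemma
  assumes K: "closed_right_subspace K"
  shows pairs_zero: "(\<lambda>_. 0) \<in> pairs K"
    and pairs_add: "F \<in> pairs K \<Longrightarrow> G \<in> pairs K \<Longrightarrow> (\<lambda>t. F t + G t) \<in> pairs K"
    and pairs_bmul_quat: "F \<in> pairs K \<Longrightarrow> (\<lambda>t. F t \<odot> (c, 0)) \<in> pairs K"
proof -
  have "slice_ext (\<lambda>_. 0) = (\<lambda>_. 0)" by (simp add: fun_eq_iff slice_ext_def)
  then show "(\<lambda>_. 0) \<in> pairs K" using K by (simp add: pairs_def closed_right_subspace_def)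
  show "F \<in> pairs K \<Longrightarrow> G \<in> pairs K \<Longrightarrow> (\<lambda>t. F t + G t) \<in> pairs K"
    using K by (auto simp: pairs_def closed_right_subspace_def slice_ext_linear [abs_def] square_integrable_add)
  show "F \<in> pairs K \<Longrightarrow> (\<lambda>t. F t \<odot> (c, 0)) \<in> pairs K"
    using K by (auto simp: pairs_def closed_right_subspace_def slice_ext_linear [abs_def] square_integrable_bmul_quat)
qed

lemma pairs_scaleR:
  assumes K: "closed_right_subspace K" and F: "F \<in> pairs K"
  shows "(\<lambda>t. r *\<^sub>R F t) \<in> pairs K"
  using pairs_bmul_quat [OF K F, of "r *\<^sub>R 1"] by (simp add: bmul_quat scaleR_prod_def)

lemma pairs_diff:
  assumes K: "closed_right_subspace K" and "F \<in> pairs K" "G \<in> pairs K"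
  shows "(\<lambda>t. F t - G t) \<in> pairs K"
  using pairs_add [OF K assms(2) pairs_scaleR [OF K assms(3), of "-1"]] by simp

lemma pairs_sum:
  assumes K: "closed_right_subspace K" and "\<And>i. i \<in> A \<Longrightarrow> F i \<in> pairs K"
  shows "(\<lambda>t. \<Sum>i\<in>A. F i t) \<in> pairs K"
  using assms(2) by (induction A rule: infinite_finite_induct) (auto intro: pairs_zero pairs_add K)

lemma pairs_closed:
  assumes K: "closed_right_subspace K" and F: "\<And>n. F n \<in> pairs K"
    and G: "square_integrable arc_measure G"
    and lim: "(\<lambda>n. sqnorm arc_measure (\<lambda>t. F n t - G t)) \<longlonglongrightarrow> 0"
  shows "G \<in> pairs K"
proof -
  have "(\<integral>q. (norm (slice_ext (F n) q - slice_ext G q))\<^sup>2 \<partial>\<Sigma>\<^sub>\<B>) = sqnorm arc_measure (\<lambda>t. F n t - G t)" for n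
  proof -
    have D: "square_integrable arc_measure (\<lambda>t. F n t - G t)"
      by (rule square_integrable_diff [OF pairs_square_integrable [OF F] G])
    have "(\<integral>q. (norm (slice_ext (\<lambda>t. F n t - G t) q))\<^sup>2 \<partial>\<Sigma>\<^sub>\<B>)
        = sqnorm arc_measure (slice_pair (slice_ext (\<lambda>t. F n t - G t)))"
      by (rule L2s_sqnorm [OF L2s_ext(1) [OF D]])
    also have "\<dots> = sqnorm arc_measure (\<lambda>t. F n t - G t)"
      using L2s_ext [OF D] square_integrableD [OF D]
      by (intro sqnorm_cong_AE) (auto simp: L2s_iff square_integrable_def)
    finally show ?thesis by (simp add: slice_ext_linear)
  qed
  then have "(\<lambda>n. \<integral>q. (norm (slice_ext (F n) q - slice_ext G q))\<^sup>2 \<partial>\<Sigma>\<^sub>\<B>) \<longlonglongrightarrow> 0"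
    using lim by simp
  then have "slice_ext G \<in> K"
    using F by (intro closed_right_subspace_limit [OF K _ L2s_ext(1) [OF G]]) (simp_all add: pairs_def)
  then show ?thesis using G by (simp add: pairs_def)
qed

lemma M_q_L2s: assumes "f \<in> L2s" shows "M_q f \<in> L2s"
proof -
  have "slice_pair (M_q f) = (\<lambda>t. rot (1 * t) (slice_pair f t))"
    using assms by (simp add: fun_eq_iff L2s_iff slice_M_q)
  then show ?thesis
    using assms square_integrable_rot [of "slice_pair f" 1] by (simp add: L2s_iff slice_M_q)
qed

lemma M_q_image_iff:
  assumes "K \<subseteq> L2s"
  shows "g \<in> M_q_image K \<longleftrightarrow> g \<in> L2s \<and>
    (\<exists>f\<in>K. AE t in arc_measure. slice_pair g t = rot t (slice_pair f t))"
proof -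
  have "(AE q in \<Sigma>\<^sub>\<B>. g q = M_q f q) \<longleftrightarrow> (AE t in arc_measure. slice_pair g t = rot t (slice_pair f t))"
    if "g \<in> L2s" "f \<in> K" for f
  proof -
    have "f \<in> L2s" using that assms by auto
    then show ?thesis using that M_q_L2s [of f] by (simp add: L2s_AE_eq_iff slice_M_q L2s_iff)
  qed
  then show ?thesis by (auto simp: M_q_image_def)
qed

lemma star_H2_iff:
  "h \<in> star_H2 \<phi> \<longleftrightarrow> \<phi> \<in> L2s \<and> h \<in> L2s \<and> (\<exists>F. square_integrable arc_measure F \<and>
    (\<forall>n<0. coef n F = 0) \<and> (AE t in arc_measure. slice_pair h t = slice_pair \<phi> t \<odot> F t))"
proof
  assume "h \<in> star_H2 \<phi>"
  then obtain f where "f \<in> H2" "star_product \<phi> f h" by (auto simp: star_H2_def)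
  then show "\<phi> \<in> L2s \<and> h \<in> L2s \<and> (\<exists>F. square_integrable arc_measure F \<and>
    (\<forall>n<0. coef n F = 0) \<and> (AE t in arc_measure. slice_pair h t = slice_pair \<phi> t \<odot> F t))"
    by (auto simp: H2_iff star_product_iff L2s_iff)
next
  assume "\<phi> \<in> L2s \<and> h \<in> L2s \<and> (\<exists>F. square_integrable arc_measure F \<and>
    (\<forall>n<0. coef n F = 0) \<and> (AE t in arc_measure. slice_pair h t = slice_pair \<phi> t \<odot> F t))"
  then obtain F where L: "\<phi> \<in> L2s" "h \<in> L2s" and F: "square_integrable arc_measure F"
    and c: "\<forall>n<0. coef n F = 0" and ae: "AE t in arc_measure. slice_pair h t = slice_pair \<phi> t \<odot> F t"
    by auto
  note e = L2s_ext [OF F]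
  have "coef n (slice_pair (slice_ext F)) = coef n F" for n
    using e F by (intro coef_cong_AE) (auto simp: L2s_iff square_integrable_def)
  then have "slice_ext F \<in> H2" using e c by (simp add: H2_iff)
  moreover have "AE t in arc_measure. slice_pair h t = slice_pair \<phi> t \<odot> slice_pair (slice_ext F) t"
    using ae e(2) by eventually_elim simp
  then have "star_product \<phi> (slice_ext F) h" using L e by (simp add: star_product_iff)
  ultimately show "h \<in> star_H2 \<phi>" by (auto simp: star_H2_def)
qed

lemma square_integrable_bmul_bunitary:
  assumes F: "square_integrable arc_measure F" and P: "square_integrable arc_measure P"
    and u: "AE t in arc_measure. bunitary (P t)"
  shows "square_integrable arc_measure (\<lambda>t. P t \<odot> F t)"
proof (rule square_integrable_isometry [OF F])
  show "(\<lambda>t. P t \<odot> F t) \<in> borel_measurable arc_measure"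
    using square_integrableD [OF F] square_integrableD [OF P] by measurable
  show "AE t in arc_measure. norm (P t \<odot> F t) = norm (F t)"
    using u by eventually_elim (simp add: norm_bmul_bunitary)
qed

lemma square_integrable_badj:
  assumes "square_integrable arc_measure P" shows "square_integrable arc_measure (\<lambda>t. badj (P t))"
  using square_integrableD [OF assms] by (intro square_integrable_isometry [OF assms]) auto

lemma unimodularD:
  assumes "unimodular \<phi>"
  shows "\<phi> \<in> L2s" "square_integrable arc_measure (slice_pair \<phi>)" "AE t in arc_measure. bunitary (slice_pair \<phi> t)"
  using assms by (auto simp: unimodular_iff L2s_iff)

definition shift_invariant :: "(real \<Rightarrow> biquat) set \<Rightarrow> bool"
  where "shift_invariant C \<longleftrightarrow> (\<forall>F\<in>C. (\<lambda>t. rot t (F t)) \<in> C)"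

text \<open>The projection is onto the image \<open>C\<close> of \<open>pairs K\<close> under the shift. It is described as the
preimage under the inverse rotation, so that its closedness follows from that of \<open>pairs K\<close>. The
residual of any \<open>g\<close> in \<open>K\<close> outside \<open>M_q K\<close> is nonzero, since otherwise \<open>g\<close> would agree almost
everywhere with an element of \<open>C\<close>.\<close>

lemma wandering_vector:
  assumes K: "closed_right_subspace K" and inv: "simply_invariant K"
  obtains P where "shift_invariant (pairs K)" "P \<in> pairs K" "sqnorm arc_measure P = 1"
    "\<And>F. F \<in> pairs K \<Longrightarrow> l2_inner arc_measure P (\<lambda>t. rot t (F t)) = 0"
proof -
  have KL: "K \<subseteq> L2s" using K by (simp add: closed_right_subspace_def)
  have sub: "M_q_image K \<subseteq> K" and ne: "M_q_image K \<noteq> K"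
    using inv by (auto simp: simply_invariant_def)
  have rotK: "(\<lambda>t. rot t (F t)) \<in> pairs K" if F: "F \<in> pairs K" for F
  proof -
    let ?f = "slice_ext F"
    have f: "?f \<in> K" "?f \<in> L2s" using F KL by (auto simp: pairs_def)
    have "M_q ?f \<in> M_q_image K"
      using M_q_L2s [OF f(2)] f(1) by (auto simp: M_q_image_def)
    then have "M_q ?f \<in> K" using sub by auto
    then have "slice_pair (M_q ?f) \<in> pairs K" using KL by (simp add: slice_pair_in_pairs_iff K subset_iff)
    then show ?thesis
    proof (rule pairs_cong [OF K])
      show "square_integrable arc_measure (\<lambda>t. rot t (F t))"
        using square_integrable_rot [OF pairs_square_integrable [OF F], of 1] by simp
      show "AE t in arc_measure. slice_pair (M_q ?f) t = rot t (F t)"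
        using L2s_ext(2) [OF pairs_square_integrable [OF F]]
        by eventually_elim (use f in \<open>simp add: slice_M_q L2s_iff\<close>)
    qed
  qed
  obtain g where g: "g \<in> K" "g \<notin> M_q_image K" using sub ne by auto
  define G where "G = slice_pair g"
  have G: "G \<in> pairs K" using g KL by (auto simp: G_def slice_pair_in_pairs_iff K)
  define C where "C = {H. (\<lambda>t. rot (- t) (H t)) \<in> pairs K}"
  have CK: "H \<in> pairs K" if "H \<in> C" for H
    using rotK [of "\<lambda>t. rot (- t) (H t)"] that by (simp add: C_def)
  have rotC: "(\<lambda>t. rot t (F t)) \<in> C" if "F \<in> pairs K" for F
    using that by (simp add: C_def)
  obtain H where H: "H \<in> C" "\<And>F. F \<in> C \<Longrightarrow> l2_inner arc_measure (\<lambda>t. G t - H t) F = 0"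
  proof (rule arc.l2_projection [of C G])
    show "square_integrable arc_measure F" if "F \<in> C" for F
      by (rule pairs_square_integrable [OF CK [OF that]])
    show "(\<lambda>_. 0) \<in> C" using pairs_zero [OF K] by (simp add: C_def)
    show "(\<lambda>t. F1 t + F2 t) \<in> C" if "F1 \<in> C" "F2 \<in> C" for F1 F2
      using pairs_add [OF K] that by (simp add: C_def)
    show "(\<lambda>t. s *\<^sub>R F t) \<in> C" if "F \<in> C" for F s
      using pairs_scaleR [OF K] that by (simp add: C_def)
    show "L \<in> C" if F: "\<And>n. F n \<in> C" and L: "square_integrable arc_measure L"
      and lim: "(\<lambda>n. sqnorm arc_measure (\<lambda>t. F n t - L t)) \<longlonglongrightarrow> 0" for F L
    proof -
      have "(\<lambda>n. sqnorm arc_measure (\<lambda>t. rot (- t) (F n t) - rot (- t) (L t))) \<longlonglongrightarrow> 0"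
        using lim by (simp add: sqnorm_def flip: rot_linear)
      then have "(\<lambda>t. rot (- t) (L t)) \<in> pairs K"
        using F square_integrable_rot [OF L, of "-1"]
        by - (rule pairs_closed [OF K, of "\<lambda>n t. rot (- t) (F n t)"], simp_all add: C_def)
      then show ?thesis by (simp add: C_def)
    qed
    show "square_integrable arc_measure G" using G by (rule pairs_square_integrable)
  qed blast
  define P0 where "P0 t = G t - H t" for t
  have P0: "P0 \<in> pairs K" unfolding P0_def [abs_def] by (rule pairs_diff [OF K G CK [OF H(1)]])
  have P0o: "l2_inner arc_measure P0 F = 0" if "F \<in> C" for F
    using H(2) that by (simp add: P0_def [abs_def])
  have "sqnorm arc_measure P0 \<noteq> 0"
  proof
    assume "sqnorm arc_measure P0 = 0"
    then have "AE t in arc_measure. P0 t = 0"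
      by (rule sqnorm_zero_AE [OF pairs_square_integrable [OF P0]])
    then have GH: "AE t in arc_measure. G t = H t" by (simp add: P0_def)
    define f where "f = slice_ext (\<lambda>t. rot (- t) (H t))"
    have f: "f \<in> K" "AE t in arc_measure. slice_pair f t = rot (- t) (H t)"
      using H(1) L2s_ext(2) [of "\<lambda>t. rot (- t) (H t)"] by (auto simp: C_def pairs_def f_def)
    have "AE t in arc_measure. slice_pair g t = rot t (slice_pair f t)"
      using GH f(2) by eventually_elim (simp add: G_def)
    then have "g \<in> M_q_image K" using f(1) g(1) KL by (auto simp: M_q_image_iff)
    then show False using g by simp
  qed
  then have pos: "0 < sqnorm arc_measure P0"
    using sqnorm_nonneg [of arc_measure P0] by linarith
  define P where "P t = (1 / sqrt (sqnorm arc_measure P0)) *\<^sub>R P0 t" for t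
  show ?thesis
  proof (rule that)
    show "shift_invariant (pairs K)" using rotK by (simp add: shift_invariant_def)
    show "P \<in> pairs K" unfolding P_def [abs_def] by (rule pairs_scaleR [OF K P0])
    have "sqnorm arc_measure P = (1 / sqrt (sqnorm arc_measure P0))\<^sup>2 * sqnorm arc_measure P0"
      unfolding sqnorm_def P_def by (simp add: power_mult_distrib power_divide)
    then show "sqnorm arc_measure P = 1" using pos by (simp add: power_divide)
    show "l2_inner arc_measure P (\<lambda>t. rot t (F t)) = 0" if "F \<in> pairs K" for F
      using P0o [OF rotC [OF that]] by (simp add: l2_inner_def P_def)
  qed
qed

lemma shift_invariant_power:
  assumes "shift_invariant C" "F \<in> C" shows "(\<lambda>t. rot (real m * t) (F t)) \<in> C"
proof (induction m)
  case (Suc m)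
  have "(\<lambda>t. rot t (rot (real m * t) (F t))) \<in> C"
    using assms(1) Suc unfolding shift_invariant_def by (rule bspec)
  then show ?case by (simp add: distrib_right)
qed (use assms in simp)

text \<open>The coefficient \<open>c\<close> is the quaternionic inner product of the shifted function
\<open>G = e\<^sup>-\<^sup>\<iota>\<^sup>n\<^sup>t F\<close> with \<open>P\<close>. Real orthogonality of \<open>P\<close> to \<open>G\<close> alone only kills the real part of \<open>c\<close>;
right linearity of the subspace allows the multiple of \<open>G\<close> by the conjugate of \<open>c\<close>, which gives
\<open>|c|\<^sup>2 = 0\<close>.\<close>

lemma wandering_coef:
  assumes K: "closed_right_subspace K" and inv: "shift_invariant (pairs K)" and P: "P \<in> pairs K"
    and orth: "\<And>F. F \<in> pairs K \<Longrightarrow> l2_inner arc_measure P (\<lambda>t. rot t (F t)) = 0"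
    and F: "F \<in> pairs K" and n: "n < 0"
  shows "coef n (\<lambda>t. badj (P t) \<odot> F t) = 0"
proof -
  define c where "c = coef n (\<lambda>t. badj (P t) \<odot> F t)"
  \<comment> \<open>of the - n shifts, orth accounts for one and invariance of the subspace for the other m\<close>
  define m where "m = nat (- n - 1)"
  have m: "real (Suc m) = - of_int n" using n by (simp add: m_def)
  define G where "G t = rot (real (Suc m) * t) (F t)" for t
  have G: "G \<in> pairs K" unfolding G_def [abs_def] by (rule shift_invariant_power [OF inv F])
  have i: "integrable arc_measure (\<lambda>t. badj (P t) \<odot> G t)" "integrable arc_measure (\<lambda>t. badj (P t) \<odot> F t)"
    by (rule integrable_bmul [OF square_integrable_badj [OF pairs_square_integrable [OF P]]
          pairs_square_integrable [OF G]])
      (rule integrable_bmul [OF square_integrable_badj [OF pairs_square_integrable [OF P]]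
          pairs_square_integrable [OF F]])
  have c0: "coef 0 (\<lambda>t. badj (P t) \<odot> G t) = c"
    unfolding G_def m bmul_rot using coef_rot [of 0 "- n" "\<lambda>t. badj (P t) \<odot> F t"] by (simp add: c_def)
  have "(\<lambda>t. rot (real m * t) (F t) \<odot> (qcnj c, 0)) \<in> pairs K"
    by (intro pairs_bmul_quat [OF K] shift_invariant_power [OF inv F])
  from orth [OF this] have "l2_inner arc_measure P (\<lambda>t. G t \<odot> (qcnj c, 0)) = 0"
    by (simp add: G_def rot_bmul [symmetric] algebra_simps)
  moreover have "inner (P t) (G t \<odot> (qcnj c, 0)) = qre (fst (badj (P t) \<odot> G t) * qcnj c)" for t
    by (simp add: inner_biquat bmul_assoc [symmetric]) (simp add: bmul_quat)
  moreover have "integrable arc_measure (\<lambda>t. fst (badj (P t) \<odot> G t))"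
    by (rule integrable_bounded_linear [OF bounded_linear_fst i(1)])
  then have "(\<integral>t. qre (fst (badj (P t) \<odot> G t) * qcnj c) \<partial>arc_measure)
      = qre ((\<integral>t. fst (badj (P t) \<odot> G t) \<partial>arc_measure) * qcnj c)"
    by (simp add: integral_bounded_linear [OF bounded_linear_qre] del: quat_sel_mult)
  ultimately have "qre (c * qcnj c) = 0"
    using c0 by (simp add: l2_inner_def coef_def del: quat_sel_mult)
  then have "c = 0" unfolding mult_qcnj_self by simp
  then show ?thesis by (simp only: c_def)
qed

text \<open>The function \<open>P\<^sup>\<dagger> P\<close> is self-adjoint, so its coefficients at \<open>n\<close> and \<open>-n\<close> are conjugate, and the
constant coefficient is the square norm of \<open>P\<close>.\<close>

lemma wandering_bunitary:
  assumes K: "closed_right_subspace K" and inv: "shift_invariant (pairs K)" and P: "P \<in> pairs K"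
    and norm: "sqnorm arc_measure P = 1"
    and orth: "\<And>F. F \<in> pairs K \<Longrightarrow> l2_inner arc_measure P (\<lambda>t. rot t (F t)) = 0"
  shows "AE t in arc_measure. bunitary (P t)"
proof -
  define Q where "Q t = badj (P t) \<odot> P t" for t
  have sq: "square_integrable arc_measure P" by (rule pairs_square_integrable [OF P])
  have i: "integrable arc_measure Q"
    unfolding Q_def [abs_def] by (intro integrable_bmul square_integrable_badj sq)
  have neg: "coef n Q = 0" if "n < 0" for n
    unfolding Q_def [abs_def] by (rule wandering_coef [OF K inv P orth P that])
  have "badj (Q t) = Q t" for t by (simp add: Q_def badj_bmul)
  then have pos: "coef n Q = 0" if "0 < n" for n
    using coef_badj [OF i, of n] neg [of "- n"] that by simp
  have zero: "coef 0 Q = 1"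
  proof -
    have "coef 0 Q = (\<integral>t. (norm (P t))\<^sup>2 *\<^sub>R 1 \<partial>arc_measure)"
      by (simp add: coef_def Q_def badj_bmul_self)
    also have "\<dots> = (\<integral>t. (norm (P t))\<^sup>2 \<partial>arc_measure) *\<^sub>R 1"
      using sq by (intro integral_scaleR_left) (simp add: square_integrable_def)
    finally show ?thesis using norm by (simp add: sqnorm_def)
  qed
  have "AE t in arc_measure. Q t = (1, 0)"
  proof (rule coef_eq_AE [OF i])
    fix n :: int
    show "coef n Q = coef n (\<lambda>t. (1, 0))"
      using neg [of n] pos [of n] zero by (cases n "0::int" rule: linorder_cases) (simp_all add: coef_const)
  qed simp
  then show ?thesis by (simp add: bunitary_def Q_def)
qed

text \<open>If \<open>h\<close> lies in \<open>K\<close>, its \<open>H2\<close> factor is \<open>P\<^sup>\<dagger>\<close> times its biquaternion function. Conversely, the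
product of \<open>P\<close> with the partial sums of an \<open>H2\<close> function lies in the subspace, and multiplication
by \<open>P\<close> is isometric.\<close>

lemma simply_invariant_imp_star_H2:
  assumes K: "closed_right_subspace K" and inv: "simply_invariant K"
  shows "\<exists>\<phi>. unimodular \<phi> \<and> K = star_H2 \<phi>"
proof -
  obtain P where sinv: "shift_invariant (pairs K)" and P: "P \<in> pairs K" "sqnorm arc_measure P = 1"
    and orth: "\<And>F. F \<in> pairs K \<Longrightarrow> l2_inner arc_measure P (\<lambda>t. rot t (F t)) = 0"
    using wandering_vector [OF K inv] by blast
  have KL: "K \<subseteq> L2s" using K by (simp add: closed_right_subspace_def)
  have sq: "square_integrable arc_measure P" by (rule pairs_square_integrable [OF P(1)])
  have u: "AE t in arc_measure. bunitary (P t)" by (rule wandering_bunitary [OF K sinv P orth])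
  define \<phi> where "\<phi> = slice_ext P"
  note phi = L2s_ext [OF sq, folded \<phi>_def]
  have "AE t in arc_measure. bunitary (slice_pair \<phi> t)"
    using u phi(2) by eventually_elim simp
  then have uni: "unimodular \<phi>" using phi(1) by (simp add: unimodular_iff)
  have "h \<in> star_H2 \<phi>" if h: "h \<in> K" for h
  proof -
    let ?H = "slice_pair h" and ?F = "\<lambda>t. badj (P t) \<odot> slice_pair h t"
    have hL: "h \<in> L2s" and H: "?H \<in> pairs K" using h KL by (auto simp: slice_pair_in_pairs_iff K)
    have "AE t in arc_measure. bunitary (badj (P t))" using u by (simp add: bunitary_badj)
    then have "square_integrable arc_measure ?F"
      by (intro square_integrable_bmul_bunitary square_integrable_badj pairs_square_integrable [OF H] sq)
    moreover have "\<forall>n<0. coef n ?F = 0" using wandering_coef [OF K sinv P(1) orth H] by simp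
    moreover have "AE t in arc_measure. slice_pair h t = slice_pair \<phi> t \<odot> ?F t"
      using u phi(2) by eventually_elim (simp add: bmul_badj_cancel)
    ultimately show ?thesis using phi(1) hL unfolding star_H2_iff by blast
  qed
  moreover have "h \<in> K" if h: "h \<in> star_H2 \<phi>" for h
  proof -
    obtain F where hL: "h \<in> L2s" and F: "square_integrable arc_measure F" and c: "\<And>n. n < 0 \<Longrightarrow> coef n F = 0"
      and ae: "AE t in arc_measure. slice_pair h t = slice_pair \<phi> t \<odot> F t"
      using h unfolding star_H2_iff by blast
    define S where "S N = fsum (sym_interval N) (\<lambda>n. coef n F)" for N
    have S: "square_integrable arc_measure (S N)" for N by (simp add: S_def)
    have "(\<lambda>t. P t \<odot> S N t) \<in> pairs K" for N
    proof -
      have "(\<lambda>t. P t \<odot> monomial n (coef n F) t) \<in> pairs K" for n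
      proof (cases "n < 0")
        case True
        then have "P t \<odot> monomial n (coef n F) t = 0" for t
          using c [of n] by (simp add: monomial_def bmul_def prod_eq_iff rot_sel)
        then show ?thesis using pairs_zero [OF K] by simp
      next
        case False
        then have "real_of_int n = real (nat n)" by simp
        then have "P t \<odot> monomial n (coef n F) t = rot (real (nat n) * t) (P t \<odot> (coef n F, 0))" for t
          unfolding monomial_def bmul_rot by (simp only:)
        then show ?thesis
          by (simp only: shift_invariant_power [OF sinv pairs_bmul_quat [OF K P(1)]])
      qed
      then show ?thesis
        unfolding S_def fsum_def bounded_bilinear.sum_right [OF bounded_bilinear_bmul]
        by (intro pairs_sum [OF K])
    qed
    moreover have PF: "square_integrable arc_measure (\<lambda>t. P t \<odot> F t)"
      by (rule square_integrable_bmul_bunitary [OF F sq u])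
    moreover have "sqnorm arc_measure (\<lambda>t. P t \<odot> S N t - P t \<odot> F t) = sqnorm arc_measure (\<lambda>t. S N t - F t)" for N
    proof -
      have "AE t in arc_measure. (norm (P t \<odot> S N t - P t \<odot> F t))\<^sup>2 = (norm (S N t - F t))\<^sup>2"
        using u by eventually_elim
          (simp add: norm_bmul_bunitary flip: bounded_bilinear.diff_right [OF bounded_bilinear_bmul])
      then show ?thesis
        unfolding sqnorm_def
        by (rule integral_cong_AE [rotated 2])
          (use square_integrableD [OF square_integrable_diff [OF square_integrable_bmul_bunitary [OF S sq u] PF]]
            square_integrableD [OF square_integrable_diff [OF S F]] in measurable)
    qed
    moreover have "(\<lambda>N. sqnorm arc_measure (\<lambda>t. S N t - F t)) \<longlonglongrightarrow> 0"
      unfolding S_def by (rule Fourier_series(2) [OF F])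
    ultimately have "(\<lambda>t. P t \<odot> F t) \<in> pairs K"
      by - (rule pairs_closed [OF K, of "\<lambda>N t. P t \<odot> S N t"], simp_all)
    moreover have "AE t in arc_measure. P t \<odot> F t = slice_pair h t"
      using ae phi(2) by eventually_elim simp
    ultimately have "slice_pair h \<in> pairs K"
      using pairs_cong [OF K] hL by (simp add: L2s_iff)
    then show ?thesis using hL by (simp add: slice_pair_in_pairs_iff K)
  qed
  ultimately show ?thesis using uni by blast
qed

lemma square_integrable_const: "square_integrable arc_measure (\<lambda>_. c)"
  by (simp add: square_integrable_def)

lemma self_in_star_H2: "unimodular \<phi> \<Longrightarrow> \<phi> \<in> star_H2 \<phi>"
  using unimodularD [of \<phi>] unfolding star_H2_iff
  by (auto intro!: exI [of _ "\<lambda>_. (1, 0)"] simp: coef_const square_integrable_const)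

text \<open>The function \<open>\<phi>\<close> itself is not in the image of \<open>M_q\<close>: cancelling \<open>P\<close> in \<open>P = P e\<^sup>\<iota>\<^sup>t F\<close> leaves
\<open>1 = e\<^sup>\<iota>\<^sup>t F\<close>, whose constant coefficient would be the coefficient of \<open>F\<close> at \<open>-1\<close>.\<close>

lemma star_H2_imp_simply_invariant:
  assumes u: "unimodular \<phi>" and K: "K = star_H2 \<phi>"
  shows "simply_invariant K"
proof -
  note phi = unimodularD [OF u]
  have KL: "K \<subseteq> L2s" by (auto simp: K star_H2_iff)
  have shift: "\<exists>F. square_integrable arc_measure F \<and> (\<forall>n<0. coef n F = 0) \<and>
      (AE t in arc_measure. slice_pair g t = slice_pair \<phi> t \<odot> rot t (F t))" if g: "g \<in> M_q_image K" for g
  proof -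
    obtain f where f: "f \<in> K" "AE t in arc_measure. slice_pair g t = rot t (slice_pair f t)"
      using g by (auto simp: M_q_image_iff [OF KL])
    then obtain F where F: "square_integrable arc_measure F" "\<forall>n<0. coef n F = 0"
      "AE t in arc_measure. slice_pair f t = slice_pair \<phi> t \<odot> F t"
      unfolding K star_H2_iff by blast
    have "AE t in arc_measure. slice_pair g t = slice_pair \<phi> t \<odot> rot t (F t)"
      using f(2) F(3) by eventually_elim (simp add: bmul_rot)
    then show ?thesis using F by blast
  qed
  have coef_shift: "coef n (\<lambda>t. rot t (F t)) = coef (n - 1) F" for n F
    using coef_rot [of n 1 F] by simp
  have "M_q_image K \<subseteq> K"
  proof
    fix g assume g: "g \<in> M_q_image K"
    obtain F where F: "square_integrable arc_measure F" "\<forall>n<0. coef n F = 0"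
      "AE t in arc_measure. slice_pair g t = slice_pair \<phi> t \<odot> rot t (F t)"
      using shift [OF g] by blast
    have "\<forall>n<0. coef n (\<lambda>t. rot t (F t)) = 0" using F(2) by (simp add: coef_shift)
    moreover have "square_integrable arc_measure (\<lambda>t. rot t (F t))"
      using square_integrable_rot [OF F(1), of 1] by simp
    moreover have "g \<in> L2s" using g by (simp add: M_q_image_def)
    ultimately show "g \<in> K" unfolding K star_H2_iff using F(3) phi(1) by blast
  qed
  moreover have "\<phi> \<in> K" using self_in_star_H2 [OF u] by (simp add: K)
  moreover have "\<phi> \<notin> M_q_image K"
  proof
    assume "\<phi> \<in> M_q_image K"
    then obtain F where F: "square_integrable arc_measure F" "\<forall>n<0. coef n F = 0"
      "AE t in arc_measure. slice_pair \<phi> t = slice_pair \<phi> t \<odot> rot t (F t)"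
      using shift by blast
    have sqr: "square_integrable arc_measure (\<lambda>t. rot t (F t))"
      using square_integrable_rot [OF F(1), of 1] by simp
    have "AE t in arc_measure. rot t (F t) = (1, 0)"
      using F(3) phi(3)
    proof eventually_elim
      case (elim t)
      then have "badj (slice_pair \<phi> t) \<odot> slice_pair \<phi> t = badj (slice_pair \<phi> t) \<odot> (slice_pair \<phi> t \<odot> rot t (F t))"
        by simp
      then show ?case using elim(2) by (simp only: bmul_badj_cancel) (simp add: bunitary_def)
    qed
    then have "coef 0 (\<lambda>t. rot t (F t)) = coef 0 (\<lambda>t. (1, 0))"
      using square_integrableD [OF sqr] by (rule coef_cong_AE) simp
    then show False using F(2) by (simp add: coef_shift coef_const)
  qed
  ultimately show ?thesis by (auto simp: simply_invariant_def)
qed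

text \<open>The transition functions \<open>F\<close> from \<open>\<phi>1\<close> to \<open>\<phi>2\<close> and \<open>G\<close> back are adjoint to each other, so \<open>F\<close>
has neither negative nor positive coefficients. The constant is a unit because \<open>\<phi>1\<close> and \<open>\<phi>2\<close>
are unimodular.\<close>

lemma star_H2_unique:
  assumes u1: "unimodular \<phi>1" and u2: "unimodular \<phi>2" and eq: "star_H2 \<phi>1 = star_H2 \<phi>2"
  shows "\<exists>u::quat. norm u = 1 \<and> star_product \<phi>1 (\<lambda>_. u) \<phi>2"
proof -
  note p1 = unimodularD [OF u1] and p2 = unimodularD [OF u2]
  let ?P1 = "slice_pair \<phi>1" and ?P2 = "slice_pair \<phi>2"
  obtain F where F: "square_integrable arc_measure F" "\<forall>n<0. coef n F = 0"
    "AE t in arc_measure. ?P2 t = ?P1 t \<odot> F t"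
    using self_in_star_H2 [OF u2] unfolding eq [symmetric] star_H2_iff by blast
  obtain G where G: "square_integrable arc_measure G" "\<forall>n<0. coef n G = 0"
    "AE t in arc_measure. ?P1 t = ?P2 t \<odot> G t"
    using self_in_star_H2 [OF u1] unfolding eq star_H2_iff by blast
  have "AE t in arc_measure. G t = badj (F t)"
    using F(3) G(3) p1(3) p2(3)
  proof eventually_elim
    case (elim t)
    have "badj (?P2 t) \<odot> ?P1 t = G t" using elim by (metis bmul_badj_cancel(1))
    moreover have "badj (?P1 t) \<odot> ?P2 t = F t" using elim by (metis bmul_badj_cancel(1))
    ultimately show ?case by (metis badj_bmul badj_badj)
  qed
  then have "coef n G = coef n (\<lambda>t. badj (F t))" for n
    using square_integrableD [OF G(1)] square_integrableD [OF square_integrable_badj [OF F(1)]]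
    by (rule coef_cong_AE)
  then have conj: "coef n G = qcnj (coef (- n) F)" for n
    using coef_badj [OF arc.square_integrable_integrable [OF F(1)]] by simp
  define u where "u = coef 0 F"
  have "AE t in arc_measure. F t = (u, 0)"
  proof (rule coef_eq_AE [OF arc.square_integrable_integrable [OF F(1)]])
    fix n :: int
    have "coef n F = 0" if "0 < n"
      using conj [of "- n"] G(2) that qcnj_simps(1) [of "coef n F"] by simp
    then show "coef n F = coef n (\<lambda>t. (u, 0))"
      using F(2) by (cases n "0::int" rule: linorder_cases) (simp_all add: coef_const u_def)
  qed simp
  with F(3) have P2: "AE t in arc_measure. ?P2 t = ?P1 t \<odot> (u, 0)"
    by eventually_elim simp
  have "AE t in arc_measure. norm u = 1"
    using P2 p1(3) p2(3)
  proof eventually_elim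
    case (elim t)
    have "norm (?P1 t \<odot> (u, 0)) = norm (?P2 t \<odot> (1, 0))" using elim by simp
    then show ?case using elim by (simp only: norm_bmul_bunitary) (simp add: norm_Pair)
  qed
  then have "norm u = 1" by simp
  moreover have "star_product \<phi>1 (\<lambda>_. u) \<phi>2"
    unfolding star_product_iff using p1(1) p2(1) P2
    by (simp add: slice_const L2s_iff square_integrable_const slice_const(2) [abs_def])
  ultimately show ?thesis by blast
qed

theorem theorem1p3:
  fixes \<K> :: "(quat \<Rightarrow> quat) set"
  assumes "closed_right_subspace \<K>"
  shows "(simply_invariant \<K> \<longleftrightarrow> (\<exists>\<phi>. unimodular \<phi> \<and> \<K> = star_H2 \<phi>)) \<and>
    (\<forall>\<phi>1 \<phi>2. unimodular \<phi>1 \<and> unimodular \<phi>2 \<and> \<K> = star_H2 \<phi>1 \<and> \<K> = star_H2 \<phi>2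
      \<longrightarrow> (\<exists>u::quat. norm u = 1 \<and> star_product \<phi>1 (\<lambda>_. u) \<phi>2))"
proof (intro conjI iffI allI impI)
  show "\<exists>\<phi>. unimodular \<phi> \<and> \<K> = star_H2 \<phi>" if "simply_invariant \<K>"
    by (rule simply_invariant_imp_star_H2 [OF assms that])
  show "simply_invariant \<K>" if "\<exists>\<phi>. unimodular \<phi> \<and> \<K> = star_H2 \<phi>"
    using that star_H2_imp_simply_invariant by blast
  show "\<exists>u. norm u = 1 \<and> star_product \<phi>1 (\<lambda>_. u) \<phi>2"
    if "unimodular \<phi>1 \<and> unimodular \<phi>2 \<and> \<K> = star_H2 \<phi>1 \<and> \<K> = star_H2 \<phi>2" for \<phi>1 \<phi>2
    using that by (intro star_H2_unique) auto
qed

end
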